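(* Let $\mathcal{I}=[0,1]$, $p\in[1,\infty)$ and $\beta\in(0,1]$. If $q\in C^{0,\beta}(\mathcal{I})$ is non-negative, then $$\sup_{\tau\ge0}\left\|e^{-\tau(D_0+Q)}-\left(e^{-\tau D_0/n}\,e^{-\tau Q/n}\right)^n\right\|_{\mathcal{L}(L^p(\mathcal{I}))}=O(1/n^{\beta})\qquad\text{as } n\to\infty.$$
   Context: $L^p(\mathcal{I})=L^p(\mathcal{I},\mathbb{C})$, and $\mathcal{L}(L^p(\mathcal{I}))$ is the space of bounded operators on it with the operator norm. Sign convention: $e^{-\tau G}$ denotes the $C_0$-semigroup with $\lim_{\tau\to+0}(e^{-\tau G}f-f)/\tau=-Gf$ for $f\in\mathrm{dom}(G)$. $D_0$ is the differentiation operator $(D_0f)(t)=\partial_tf(t)$ with $\mathrm{dom}(D_0)=\{f\in W^{1,p}(\mathcal{I}): f(0)=0\}$; it generates the shift semigroup $(e^{-\tau D_0}f)(t)=\chi_{\mathcal{I}}(t-\tau)f(t-\tau)$. $Q$ is the bounded multiplication operator $(Qf)(t)=q(t)f(t)$ on $L^p(\mathcal{I})$, and $D_0+Q$ has domain $\mathrm{dom}(D_0)$. $C^{0,\beta}(\mathcal{I})$ is the set of $f:\mathcal{I}\to\mathbb{C}$ for which there is $K>0$ with $|f(x)-f(y)|\le K|x-y|^\beta$ for all $x,y\in\mathcal{I}$. $g(n)=O(f(n))$ means $\limsup_{n\to\infty}|g(n)/f(n)|<\infty$. *)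

theory Defs
  imports "HOL-Analysis.Analysis" "HOL-Library.Nonpos_Ints"
begin

section \<open>Classes of measurable functions on the unit interval\<close>

abbreviation unit_interval :: "real measure" where
  "unit_interval \<equiv> restrict_space lborel {0..1}"

text \<open>
  The distribution has no \<open>L\<^sup>p\<close> spaces.  We form the algebra of measurable functions
  on \<open>[0,1]\<close> modulo equality almost everywhere, and carve \<open>L\<^sup>p\<close> out of it as a set, so that
  the exponent can be an ordinary real variable.  Borel representatives lose nothing, because every
  Lebesgue measurable function agrees almost everywhere with a Borel one.
\<close>

definition ae_rel :: "(real \<Rightarrow> complex) \<Rightarrow> (real \<Rightarrow> complex) \<Rightarrow> bool" where
  "ae_rel f g \<longleftrightarrow> f \<in> borel_measurable unit_interval \<and> g \<in> borel_measurable unit_interval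
     \<and> (AE t in unit_interval. f t = g t)"

lemma part_equivp_ae_rel: "part_equivp ae_rel"
proof (rule part_equivpI)
  show "\<exists>f. ae_rel f f"
    by (intro exI[of _ "\<lambda>_. 0"]) (simp add: ae_rel_def)
  show "symp ae_rel"
    by (auto simp: symp_def ae_rel_def elim: AE_mp)
  show "transp ae_rel"
    unfolding transp_def ae_rel_def by (auto elim: eventually_elim2)
qed

quotient_type ae_fun = "real \<Rightarrow> complex" / partial: ae_rel
  morphisms rep_ae_fun ae_class
  by (rule part_equivp_ae_rel)

instantiation ae_fun :: comm_ring
begin

lift_definition zero_ae_fun :: ae_fun is "\<lambda>_. 0"
  by (simp add: ae_rel_def)

lift_definition plus_ae_fun :: "ae_fun \<Rightarrow> ae_fun \<Rightarrow> ae_fun" is "\<lambda>f g t. f t + g t"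
  unfolding ae_rel_def by (auto elim: eventually_elim2)

lift_definition minus_ae_fun :: "ae_fun \<Rightarrow> ae_fun \<Rightarrow> ae_fun" is "\<lambda>f g t. f t - g t"
  unfolding ae_rel_def by (auto elim: eventually_elim2)

lift_definition uminus_ae_fun :: "ae_fun \<Rightarrow> ae_fun" is "\<lambda>f t. - f t"
  unfolding ae_rel_def by auto

lift_definition times_ae_fun :: "ae_fun \<Rightarrow> ae_fun \<Rightarrow> ae_fun" is "\<lambda>f g t. f t * g t"
  unfolding ae_rel_def by (auto elim: eventually_elim2)

instance
  by standard (transfer; auto simp: ae_rel_def algebra_simps)+

end

lift_definition scaleC :: "complex \<Rightarrow> ae_fun \<Rightarrow> ae_fun" (infixr \<open>*\<^sub>C\<close> 75)
  is "\<lambda>c f t. c * f t"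
  unfolding ae_rel_def by auto


section \<open>The spaces \<open>L\<^sup>p\<close> and their operators\<close>

lift_definition in_Lp :: "real \<Rightarrow> ae_fun \<Rightarrow> bool"
  is "\<lambda>p f. integrable unit_interval (\<lambda>t. norm (f t) powr p)"
  unfolding ae_rel_def
  by (intro integrable_cong_AE) auto

definition Lp :: "real \<Rightarrow> ae_fun set" where
  "Lp p = {f. in_Lp p f}"

lift_definition Lp_norm :: "real \<Rightarrow> ae_fun \<Rightarrow> real"
  is "\<lambda>p f. (LINT t|unit_interval. norm (f t) powr p) powr (1 / p)"
  unfolding ae_rel_def
  by (intro arg_cong[where f = "\<lambda>x. x powr _"] integral_cong_AE) auto

definition bounded_op :: "real \<Rightarrow> (ae_fun \<Rightarrow> ae_fun) \<Rightarrow> bool" where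
  "bounded_op p T \<longleftrightarrow>
     (\<forall>f\<in>Lp p. T f \<in> Lp p) \<and>
     (\<forall>f\<in>Lp p. \<forall>g\<in>Lp p. T (f + g) = T f + T g) \<and>
     (\<forall>c. \<forall>f\<in>Lp p. T (c *\<^sub>C f) = c *\<^sub>C T f) \<and>
     (\<exists>K. \<forall>f\<in>Lp p. Lp_norm p (T f) \<le> K * Lp_norm p f)"

text \<open>Extended values keep the later supremum over \<open>\<tau>\<close> free of boundedness side conditions.\<close>

definition op_norm :: "real \<Rightarrow> (ae_fun \<Rightarrow> ae_fun) \<Rightarrow> ennreal" where
  "op_norm p T = (SUP f\<in>{f \<in> Lp p. Lp_norm p f \<le> 1}. ennreal (Lp_norm p (T f)))"


section \<open>Strongly continuous semigroups\<close>

definition C0_semigroup :: "real \<Rightarrow> (real \<Rightarrow> ae_fun \<Rightarrow> ae_fun) \<Rightarrow> bool" where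
  "C0_semigroup p S \<longleftrightarrow>
     (\<forall>\<tau>\<ge>0. bounded_op p (S \<tau>)) \<and>
     (\<forall>f\<in>Lp p. S 0 f = f) \<and>
     (\<forall>\<sigma>\<ge>0. \<forall>\<tau>\<ge>0. \<forall>f\<in>Lp p. S (\<sigma> + \<tau>) f = S \<sigma> (S \<tau> f)) \<and>
     (\<forall>f\<in>Lp p. \<forall>\<tau>\<ge>0. ((\<lambda>\<sigma>. Lp_norm p (S \<sigma> f - S \<tau> f)) \<longlongrightarrow> 0) (at \<tau> within {0..}))"

text \<open>\<open>g\<close> is the limit in \<open>L\<^sup>p\<close> of \<open>(S \<tau> f - f) / \<tau>\<close> as \<open>\<tau>\<close> tends to 0 from the right.\<close>

definition has_right_deriv0 :: "real \<Rightarrow> (real \<Rightarrow> ae_fun \<Rightarrow> ae_fun) \<Rightarrow> ae_fun \<Rightarrow> ae_fun \<Rightarrow> bool" where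
  "has_right_deriv0 p S f g \<longleftrightarrow>
     ((\<lambda>\<tau>. Lp_norm p (complex_of_real (1 / \<tau>) *\<^sub>C (S \<tau> f - f) - g)) \<longlongrightarrow> 0) (at_right 0)"

text \<open>
  An unbounded operator is given by its domain \<open>D\<close> and a function \<open>G\<close>, of which only the values on
  \<open>D\<close> matter.  The generator of \<open>S\<close> in the usual convention is \<open>-G\<close>, with domain exactly \<open>D\<close>.
\<close>

definition generated_by_minus ::
  "real \<Rightarrow> ae_fun set \<Rightarrow> (ae_fun \<Rightarrow> ae_fun) \<Rightarrow> (real \<Rightarrow> ae_fun \<Rightarrow> ae_fun) \<Rightarrow> bool" where
  "generated_by_minus p D G S \<longleftrightarrow>
     C0_semigroup p S \<and>
     D = {f \<in> Lp p. \<exists>g\<in>Lp p. has_right_deriv0 p S f g} \<and>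
     (\<forall>f\<in>D. G f \<in> Lp p \<and> has_right_deriv0 p S f (- G f))"

text \<open>
  \<open>exp_minus p D G \<tau>\<close> is \<open>e\<^sup>-\<^sup>\<tau>\<^sup>G\<close>.  A semigroup is determined by its generator only for
  \<open>\<tau> \<ge> 0\<close> and on \<open>L\<^sup>p\<close>; the value 0 is prescribed elsewhere so that the description is unique.
\<close>

definition exp_minus :: "real \<Rightarrow> ae_fun set \<Rightarrow> (ae_fun \<Rightarrow> ae_fun) \<Rightarrow> real \<Rightarrow> ae_fun \<Rightarrow> ae_fun" where
  "exp_minus p D G = (THE S. generated_by_minus p D G S \<and>
                             (\<forall>\<tau> f. \<tau> < 0 \<or> f \<notin> Lp p \<longrightarrow> S \<tau> f = 0))"


section \<open>The operators \<open>D\<^sub>0\<close> and \<open>Q\<close>\<close>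

definition test_fun :: "(real \<Rightarrow> real) \<Rightarrow> bool" where
  "test_fun \<phi> \<longleftrightarrow> \<phi> C1_differentiable_on UNIV \<and> closure {t. \<phi> t \<noteq> 0} \<subseteq> {0<..<1}"

lemma test_fun_continuous:
  assumes "test_fun \<phi>"
  shows "continuous_on UNIV \<phi>" and "continuous_on UNIV (deriv \<phi>)"
proof -
  from assms obtain D where D: "\<And>t. (\<phi> has_vector_derivative D t) (at t)" "continuous_on UNIV D"
    by (auto simp: test_fun_def C1_differentiable_on_def)
  have "deriv \<phi> = D"
    using D(1) by (auto intro!: DERIV_imp_deriv simp: has_real_derivative_iff_has_vector_derivative)
  with D(2) show "continuous_on UNIV (deriv \<phi>)"
    by simp
  show "continuous_on UNIV \<phi>"
    using D(1) by (auto intro!: continuous_at_imp_continuous_on has_vector_derivative_continuous)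
qed

lemma test_fun_measurable:
  assumes "test_fun \<phi>"
  shows "(\<lambda>t. complex_of_real (\<phi> t)) \<in> borel_measurable unit_interval"
    and "(\<lambda>t. complex_of_real (deriv \<phi> t)) \<in> borel_measurable unit_interval"
  using test_fun_continuous[OF assms]
  by (auto intro!: measurable_restrict_space1 borel_measurable_continuous_onI continuous_on_of_real)

lift_definition has_weak_deriv :: "ae_fun \<Rightarrow> ae_fun \<Rightarrow> bool"
  is "\<lambda>f g. \<forall>\<phi>. test_fun \<phi> \<longrightarrow>
        (LINT t|unit_interval. f t * complex_of_real (deriv \<phi> t)) =
        - (LINT t|unit_interval. g t * complex_of_real (\<phi> t))"
proof -
  have cong: "(LINT t|unit_interval. f t * h t) = (LINT t|unit_interval. g t * h t)"
    if "ae_rel f g" "h \<in> borel_measurable unit_interval" for f g h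
    using that unfolding ae_rel_def by (intro integral_cong_AE) auto
  show "?thesis f1 f2 g1 g2" if "ae_rel f1 f2" "ae_rel g1 g2" for f1 f2 g1 g2
    using that by (auto simp: cong test_fun_measurable)
qed

definition weak_deriv :: "ae_fun \<Rightarrow> ae_fun" where
  "weak_deriv f = (THE g. g \<in> Lp 1 \<and> has_weak_deriv f g)"

definition W1p :: "real \<Rightarrow> ae_fun set" where
  "W1p p = {f \<in> Lp p. \<exists>g\<in>Lp p. has_weak_deriv f g}"

text \<open>The boundary value \<open>f(0)\<close> is that of the continuous representative of \<open>f\<close>.\<close>

definition dom_D0 :: "real \<Rightarrow> ae_fun set" where
  "dom_D0 p = {f \<in> W1p p. \<exists>F. continuous_on {0..1} F \<and> f = ae_class F \<and> F 0 = 0}"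

definition D0 :: "ae_fun \<Rightarrow> ae_fun" where
  "D0 f = weak_deriv f"

definition mult_op :: "(real \<Rightarrow> complex) \<Rightarrow> ae_fun \<Rightarrow> ae_fun" where
  "mult_op q f = ae_class q * f"

definition holder_space :: "real \<Rightarrow> (real \<Rightarrow> complex) set" where
  "holder_space \<beta> =
     {f. \<exists>K>0. \<forall>x\<in>{0..1}. \<forall>y\<in>{0..1}. norm (f x - f y) \<le> K * \<bar>x - y\<bar> powr \<beta>}"

end

theory Submission
  imports Defs
begin

text \<open>
  All three semigroups are written down explicitly: \<open>e\<^sup>-\<^sup>\<tau>\<^sup>D\<close> for \<open>D = D\<^sub>0\<close> is the shift, \<open>e\<^sup>-\<^sup>\<tau>\<^sup>Q\<close> is
  multiplication by \<open>exp (- \<tau> q)\<close>, and \<open>D\<^sub>0 + Q\<close> generates the shift followed by multiplication by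
  \<open>exp (- \<integral> q)\<close>, the integral being over \<open>[t - \<tau>, t]\<close>.  The \<open>n\<close>-th product formula is the same shift with
  the integral replaced by its left Riemann sum with \<open>n\<close> nodes.  For \<open>\<tau> > 1\<close> both vanish; for \<open>\<tau> \<le> 1\<close>
  the Riemann sum of a \<open>\<beta>\<close>-Hoelder function with constant \<open>K\<close> is off by at most \<open>K / n\<^sup>\<beta>\<close>, and \<open>exp (- x)\<close>
  is 1-Lipschitz for \<open>x \<ge> 0\<close>.
\<close>

section \<open>Minkowski's inequality and the algebra of \<open>L\<^sup>p\<close>\<close>

text \<open>Each exponential in the statement is a definite description over all semigroups with a
  prescribed generator. Writing down a formula is therefore the smaller part: the domain of the
  generator has to be matched exactly, and no second semigroup may share the generator. Uniqueness
  compares an arbitrary competitor with a contraction semigroup on the domain and then passes to all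
  of L^p by density. The domain is matched directly for the shift alone: \<open>dom_D0\<close>,
  given through weak derivatives and a boundary value, and the domain of the generator of the shift
  both turn out to be the set of primitives from 0 of L^p functions. A du Bois-Reymond argument
  settles one side, nilpotency of the shift the other. The remaining two generators arise by bounded
  perturbation, of the shift for D_0 + Q and of the identity semigroup for Q. Integrals of the
  potential enter only as increments of an antiderivative; the mean value theorem then yields both
  the first-order bound at time 0 and the error on each Riemann cell.\<close>

lemma powr_convex_combination:
  fixes x y p t :: real
  assumes "1 \<le> p" "0 \<le> x" "0 \<le> y" "0 \<le> t" "t \<le> 1"
  shows "((1 - t) * x + t * y) powr p \<le> (1 - t) * x powr p + t * y powr p"
proof (cases "x = 0 \<or> y = 0")
  case True
  \<comment> \<open>With one of the points at 0, convexity is only \<open>s powr p \<le> s\<close>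
    on [0,1].\<close>
  have *: "(s * z) powr p \<le> s * z powr p" if "0 \<le> s" "s \<le> 1" "0 \<le> z" for s z :: real
  proof -
    have "s powr p \<le> s"
      using powr_mono'[of 1 p s] that assms by simp
    then show ?thesis
      using that by (simp add: powr_mult mult_right_mono)
  qed
  show ?thesis
    using True *[of t y] *[of "1 - t" x] assms by auto
next
  case False
  then show ?thesis
    using convex_onD[OF powr_convex[OF assms(1)], of t x y] assms by simp
qed

text \<open>\<open>(x + y) / (a + b)\<close> is the convex combination of \<open>x / a\<close> and
  \<open>y / b\<close> with weights \<open>a / (a + b)\<close> and \<open>b / (a + b)\<close>. The
  parameters stand for the two norms in Minkowski's inequality: the bound integrates to
  \<open>(a + b) powr p\<close> when \<open>x\<close> and \<open>y\<close> have norms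
  \<open>a\<close> and \<open>b\<close>.\<close>

lemma powr_add_le:
  fixes x y a b p :: real
  assumes "1 \<le> p" "0 \<le> x" "0 \<le> y" "0 < a" "0 < b"
  shows "(x + y) powr p \<le> (a + b) powr (p - 1) * (a powr (1 - p) * x powr p + b powr (1 - p) * y powr p)"
proof -
  define t where "t = b / (a + b)"
  have t: "0 \<le> t" "t \<le> 1" "1 - t = a / (a + b)"
    using assms by (auto simp: t_def field_simps)
  have "((1 - t) * (x / a) + t * (y / b)) powr p \<le> (1 - t) * (x / a) powr p + t * (y / b) powr p"
    using assms t by (intro powr_convex_combination) auto
  also have "(1 - t) * (x / a) + t * (y / b) = (x + y) / (a + b)"
    unfolding t(3) using assms by (simp add: t_def add_divide_distrib)
  finally have "(a + b) powr p * ((x + y) / (a + b)) powr p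
     \<le> (a + b) powr p * ((1 - t) * (x / a) powr p + t * (y / b) powr p)"
    by (intro mult_left_mono) auto
  also have "(a + b) powr p * ((x + y) / (a + b)) powr p = (x + y) powr p"
    using assms by (simp add: powr_divide)
  also have "(a + b) powr p * ((1 - t) * (x / a) powr p + t * (y / b) powr p)
     = (a + b) powr (p - 1) * (a powr (1 - p) * x powr p + b powr (1 - p) * y powr p)"
    unfolding t(3) unfolding t_def using assms
    by (simp add: powr_divide powr_diff distrib_left)
  finally show ?thesis .
qed

text \<open>A pointwise bound with free constants is integrated, so Hoelder's inequality is
  bypassed. The choice \<open>a = b = 1\<close> gives integrability.\<close>

lemma Minkowski_powr:
  fixes f g :: "'a \<Rightarrow> 'b :: {second_countable_topology, real_normed_vector}"
  assumes p: "1 \<le> p" and [measurable]: "f \<in> borel_measurable M" "g \<in> borel_measurable M"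
    and f: "integrable M (\<lambda>t. norm (f t) powr p)" and g: "integrable M (\<lambda>t. norm (g t) powr p)"
  shows "integrable M (\<lambda>t. norm (f t + g t) powr p)" (is ?I)
    and "(LINT t|M. norm (f t + g t) powr p) powr (1 / p)
      \<le> (LINT t|M. norm (f t) powr p) powr (1 / p) + (LINT t|M. norm (g t) powr p) powr (1 / p)"
proof -
  have bound: "norm (f t + g t) powr p \<le> (a + b) powr (p - 1) *
      (a powr (1 - p) * norm (f t) powr p + b powr (1 - p) * norm (g t) powr p)"
    if "0 < a" "0 < b" for a b t
  proof -
    have "norm (f t + g t) powr p \<le> (norm (f t) + norm (g t)) powr p"
      using p by (intro powr_mono2 norm_triangle_ineq) auto
    also have "\<dots> \<le> (a + b) powr (p - 1) *
      (a powr (1 - p) * norm (f t) powr p + b powr (1 - p) * norm (g t) powr p)"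
      using that p by (intro powr_add_le) auto
    finally show ?thesis .
  qed
  show I: ?I
    by (rule Bochner_Integration.integrable_bound[OF _ _ AE_I2, where f = "\<lambda>t. (1 + 1) powr (p - 1) *
      (1 powr (1 - p) * norm (f t) powr p + 1 powr (1 - p) * norm (g t) powr p)"])
      (use f g bound[of 1 1] in auto)
  define A where "A = (LINT t|M. norm (f t) powr p)"
  define B where "B = (LINT t|M. norm (g t) powr p)"
  have AB: "0 \<le> A" "0 \<le> B"
    by (auto simp: A_def B_def intro!: integral_nonneg_AE)
  \<comment> \<open>Strict inequalities keep \<open>a\<close> and \<open>b\<close> positive even if
    a norm vanishes; the norms themselves are reached in the limit.\<close>
  have ineq: "(LINT t|M. norm (f t + g t) powr p) powr (1 / p) \<le> a + b"
    if a: "A powr (1/p) < a" and b: "B powr (1/p) < b" for a b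
  proof -
    have pos: "0 < a" "0 < b"
      using a b by (smt (verit) powr_ge_zero)+
    have "A = (A powr (1/p)) powr p" "B = (B powr (1/p)) powr p"
      using p AB by (auto simp: powr_powr)
    then have le: "A \<le> a powr p" "B \<le> b powr p"
      using a b p by (smt (verit) powr_ge_zero powr_mono2)+
    have "(LINT t|M. norm (f t + g t) powr p) \<le> (LINT t|M. (a + b) powr (p - 1) *
      (a powr (1 - p) * norm (f t) powr p + b powr (1 - p) * norm (g t) powr p))"
      using f g I pos bound by (intro integral_mono) auto
    also have "\<dots> = (a + b) powr (p - 1) * (a powr (1 - p) * A + b powr (1 - p) * B)"
      using f g by (simp add: A_def B_def)
    also have "\<dots> \<le> (a + b) powr (p - 1) * (a powr (1 - p) * a powr p + b powr (1 - p) * b powr p)"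
      using le by (intro mult_left_mono add_mono) auto
    also have "\<dots> = (a + b) powr p"
      using pos by (simp add: powr_add[symmetric] powr_diff)
    finally have "(LINT t|M. norm (f t + g t) powr p) powr (1 / p) \<le> ((a + b) powr p) powr (1/p)"
      using p by (intro powr_mono2) (auto intro!: integral_nonneg_AE)
    also have "\<dots> = a + b"
      using pos p by (simp add: powr_powr)
    finally show ?thesis .
  qed
  have "(LINT t|M. norm (f t + g t) powr p) powr (1 / p) \<le> A powr (1/p) + B powr (1/p) + e" if "e > 0" for e
    using ineq[of "A powr (1/p) + e/2" "B powr (1/p) + e/2"] that by simp
  then show "(LINT t|M. norm (f t + g t) powr p) powr (1 / p)
      \<le> (LINT t|M. norm (f t) powr p) powr (1 / p) + (LINT t|M. norm (g t) powr p) powr (1 / p)"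
    unfolding A_def B_def by (rule field_le_epsilon)
qed

section \<open>Representatives and the normed-space laws of \<open>Lp p\<close>\<close>

lemma finite_measure_unit_interval: "finite_measure unit_interval"
  by (intro finite_measureI) (simp add: emeasure_restrict_space)

lemma borel_measurable_unit_interval [measurable_dest]:
  "u \<in> borel_measurable borel \<Longrightarrow> u \<in> borel_measurable unit_interval"
  by (intro measurable_restrict_space1) simp

lemma ae_rel_borel: "u \<in> borel_measurable borel \<Longrightarrow> ae_rel u u"
  by (auto simp: ae_rel_def intro: borel_measurable_unit_interval)

lemma ae_rel_self: "u \<in> borel_measurable unit_interval \<Longrightarrow> ae_rel u u"
  by (auto simp: ae_rel_def)

lemma ae_class_eqI:
  assumes "u \<in> borel_measurable unit_interval" "v \<in> borel_measurable unit_interval"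
    and "AE t in lborel. t \<in> {0..1} \<longrightarrow> u t = v t"
  shows "ae_class u = ae_class v"
proof -
  have "ae_rel u v"
    using assms by (auto simp: ae_rel_def AE_restrict_space_iff)
  then show ?thesis
    using Quotient3_rel[OF Quotient3_ae_fun] by blast
qed

lemma borel_zero_extension:
  assumes "f \<in> borel_measurable unit_interval"
  shows "(\<lambda>t. if t \<in> {0..1} then f t else (0 :: complex)) \<in> borel_measurable borel"
proof -
  have "(\<lambda>t. if t \<in> {0..1} then f t else 0) \<in> borel_measurable lborel"
    using assms by (subst (asm) measurable_restrict_space_iff[where c = 0]) auto
  then show ?thesis by simp
qed

text \<open>A representative that is Borel on the whole line and 0 off the interval can be
  translated, and its integrals over the interval become integrals over the line.\<close>

lemma ae_class_cases:
  obtains u where "u \<in> borel_measurable borel" "\<And>t. t \<notin> {0..1} \<Longrightarrow> u t = 0" "f = ae_class u"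
proof -
  define v where "v = rep_ae_fun f"
  have v: "ae_rel v v" "f = ae_class v"
    unfolding v_def by (simp_all add: Quotient3_rep_reflp[OF Quotient3_ae_fun] Quotient3_abs_rep[OF Quotient3_ae_fun])
  define u where "u = (\<lambda>t. if t \<in> {0..1} then v t else 0)"
  have vm: "v \<in> borel_measurable unit_interval"
    using v by (simp add: ae_rel_def)
  then have um: "u \<in> borel_measurable borel"
    unfolding u_def by (rule borel_zero_extension)
  moreover have "f = ae_class u"
    unfolding v(2) by (intro ae_class_eqI vm borel_measurable_unit_interval um) (auto simp: u_def)
  ultimately show thesis
    by (intro that[of u]) (auto simp: u_def)
qed

lemma ae_class_plus:
  "u \<in> borel_measurable unit_interval \<Longrightarrow> v \<in> borel_measurable unit_interval \<Longrightarrow>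
    ae_class u + ae_class v = ae_class (\<lambda>t. u t + v t)"
  by (intro plus_ae_fun.abs_eq ae_rel_self)

lemma ae_class_minus:
  "u \<in> borel_measurable unit_interval \<Longrightarrow> v \<in> borel_measurable unit_interval \<Longrightarrow>
    ae_class u - ae_class v = ae_class (\<lambda>t. u t - v t)"
  by (intro minus_ae_fun.abs_eq ae_rel_self)

lemma ae_class_times:
  "u \<in> borel_measurable unit_interval \<Longrightarrow> v \<in> borel_measurable unit_interval \<Longrightarrow>
    ae_class u * ae_class v = ae_class (\<lambda>t. u t * v t)"
  by (intro times_ae_fun.abs_eq ae_rel_self)

lemma ae_class_scaleC:
  "u \<in> borel_measurable unit_interval \<Longrightarrow> c *\<^sub>C ae_class u = ae_class (\<lambda>t. c * u t)"
  by (intro scaleC.abs_eq ae_rel_self)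

lemma zero_eq_ae_class: "0 = ae_class (\<lambda>_. 0)"
  by (simp add: zero_ae_fun_def)

lemma scaleC_add_right: "c *\<^sub>C (f + g) = c *\<^sub>C f + c *\<^sub>C g"
  by transfer (auto simp: ae_rel_def algebra_simps)

lemma scaleC_diff_right: "c *\<^sub>C (f - g) = c *\<^sub>C f - c *\<^sub>C g"
  by transfer (auto simp: ae_rel_def algebra_simps)

lemma scaleC_scaleC: "c *\<^sub>C d *\<^sub>C f = (c * d) *\<^sub>C f"
  by transfer (auto simp: ae_rel_def algebra_simps)

lemma scaleC_one [simp]: "1 *\<^sub>C f = f"
  by transfer (auto simp: ae_rel_def algebra_simps)

lemma scaleC_minus_one: "(-1) *\<^sub>C f = - f"
  by transfer (auto simp: ae_rel_def algebra_simps)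

lemma scaleC_zero_right [simp]: "c *\<^sub>C 0 = 0"
  using scaleC_diff_right[of c 0 0] by simp

lemma times_scaleC: "f * (c *\<^sub>C g) = c *\<^sub>C (f * g)"
  by transfer (auto simp: ae_rel_def algebra_simps)

lemma ae_class_in_Lp:
  "u \<in> borel_measurable unit_interval \<Longrightarrow>
    ae_class u \<in> Lp p \<longleftrightarrow> integrable unit_interval (\<lambda>t. norm (u t) powr p)"
  by (simp add: Lp_def in_Lp.abs_eq ae_rel_self)

lemma Lp_norm_ae_class:
  "u \<in> borel_measurable unit_interval \<Longrightarrow>
    Lp_norm p (ae_class u) = (LINT t|unit_interval. norm (u t) powr p) powr (1 / p)"
  by (simp add: Lp_norm.abs_eq ae_rel_self)

lemma Lp_norm_nonneg [simp]: "0 \<le> Lp_norm p f"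
  by (cases f rule: ae_class_cases) (simp add: Lp_norm_ae_class borel_measurable_unit_interval)

lemma Lp_zero [simp]: "0 \<in> Lp p"
  by (simp add: zero_eq_ae_class ae_class_in_Lp)

lemma Lp_norm_zero [simp]: "Lp_norm p 0 = 0"
  by (simp add: zero_eq_ae_class Lp_norm_ae_class)

lemma
  assumes "1 \<le> p" "f \<in> Lp p" "g \<in> Lp p"
  shows Lp_add: "f + g \<in> Lp p" and Lp_norm_triangle: "Lp_norm p (f + g) \<le> Lp_norm p f + Lp_norm p g"
proof -
  obtain u where u: "u \<in> borel_measurable borel" "f = ae_class u"
    by (cases f rule: ae_class_cases)
  obtain v where v: "v \<in> borel_measurable borel" "g = ae_class v"
    by (cases g rule: ae_class_cases)
  note [measurable] = u(1) v(1)
  from assms show "f + g \<in> Lp p"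
    unfolding u v by (simp add: ae_class_plus ae_class_in_Lp Minkowski_powr(1))
  from assms show "Lp_norm p (f + g) \<le> Lp_norm p f + Lp_norm p g"
    unfolding u v by (simp add: ae_class_plus ae_class_in_Lp Lp_norm_ae_class Minkowski_powr(2))
qed

lemma
  shows Lp_scaleC: "f \<in> Lp p \<Longrightarrow> c *\<^sub>C f \<in> Lp p"
  and Lp_norm_scaleC: "1 \<le> p \<Longrightarrow> Lp_norm p (c *\<^sub>C f) = norm c * Lp_norm p f"
  by (cases f rule: ae_class_cases;
      simp add: ae_class_scaleC ae_class_in_Lp Lp_norm_ae_class borel_measurable_unit_interval
        norm_mult powr_mult powr_powr)+

lemma Lp_uminus: "f \<in> Lp p \<Longrightarrow> - f \<in> Lp p"
  using Lp_scaleC[of f p "-1"] by (simp add: scaleC_minus_one)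

lemma Lp_norm_minus [simp]: "1 \<le> p \<Longrightarrow> Lp_norm p (- f) = Lp_norm p f"
  using Lp_norm_scaleC[of p "-1" f] by (simp add: scaleC_minus_one)

lemma Lp_diff: "1 \<le> p \<Longrightarrow> f \<in> Lp p \<Longrightarrow> g \<in> Lp p \<Longrightarrow> f - g \<in> Lp p"
  using Lp_add[of p f "- g"] by (simp add: Lp_uminus)

lemma Lp_norm_triangle_diff:
  assumes "1 \<le> p" "f \<in> Lp p" "g \<in> Lp p"
  shows "Lp_norm p (f - g) \<le> Lp_norm p f + Lp_norm p g"
  using Lp_norm_triangle[of p f "- g"] assms by (simp add: Lp_uminus)

lemma Lp_norm_diff_triangle:
  assumes "1 \<le> p" "f \<in> Lp p" "g \<in> Lp p" "h \<in> Lp p"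
  shows "Lp_norm p (f - h) \<le> Lp_norm p (f - g) + Lp_norm p (g - h)"
  using Lp_norm_triangle[of p "f - g" "g - h"] assms by (simp add: Lp_diff)

lemma Lp_norm_minus_commute: "1 \<le> p \<Longrightarrow> Lp_norm p (f - g) = Lp_norm p (g - f)"
  using Lp_norm_minus[of p "f - g"] by simp

lemma Lp_norm_eq_0D:
  assumes "1 \<le> p" "f \<in> Lp p" "Lp_norm p f = 0"
  shows "f = 0"
proof -
  obtain u where u [measurable]: "u \<in> borel_measurable borel" and f: "f = ae_class u"
    by (cases f rule: ae_class_cases)
  have *: "integrable unit_interval (\<lambda>t. norm (u t) powr p)" "(LINT t|unit_interval. norm (u t) powr p) = 0"
    using assms by (simp_all add: f ae_class_in_Lp Lp_norm_ae_class)
  then have "AE t in unit_interval. norm (u t) powr p = 0"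
    by (subst (asm) integral_nonneg_eq_0_iff_AE) auto
  then show ?thesis
    unfolding f zero_eq_ae_class by (intro ae_class_eqI) (auto simp: AE_restrict_space_iff)
qed

lemma Lp_dominated:
  assumes "1 \<le> p" "g \<in> Lp p" "g = ae_class v" "f = ae_class u" "0 \<le> C"
    and [measurable]: "u \<in> borel_measurable unit_interval" "v \<in> borel_measurable unit_interval"
    and le: "\<And>t. t \<in> {0..1} \<Longrightarrow> norm (u t) \<le> C * norm (v t)"
  shows "f \<in> Lp p" and "Lp_norm p f \<le> C * Lp_norm p g"
proof -
  have v: "integrable unit_interval (\<lambda>t. norm (v t) powr p)"
    using assms by (simp add: ae_class_in_Lp)
  then have i: "integrable unit_interval (\<lambda>t. C powr p * norm (v t) powr p)"
    by simp
  have bound: "norm (u t) powr p \<le> C powr p * norm (v t) powr p" if "t \<in> {0..1}" for t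
  proof -
    have "norm (u t) powr p \<le> (C * norm (v t)) powr p"
      using assms(1) by (intro powr_mono2 le that) auto
    then show ?thesis
      using \<open>0 \<le> C\<close> by (simp add: powr_mult)
  qed
  then have u: "integrable unit_interval (\<lambda>t. norm (u t) powr p)"
    by (intro Bochner_Integration.integrable_bound[OF i]) (auto intro!: AE_I2 simp: space_restrict_space)
  then show "f \<in> Lp p"
    by (simp add: assms(4) ae_class_in_Lp)
  have "(LINT t|unit_interval. norm (u t) powr p) \<le> (LINT t|unit_interval. C powr p * norm (v t) powr p)"
    using bound by (intro integral_mono u i) (auto simp: space_restrict_space)
  then have "(LINT t|unit_interval. norm (u t) powr p) powr (1/p)
     \<le> (C powr p * (LINT t|unit_interval. norm (v t) powr p)) powr (1/p)"
    using assms(1) by (intro powr_mono2) (auto intro!: integral_nonneg_AE)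
  also have "\<dots> = C * (LINT t|unit_interval. norm (v t) powr p) powr (1/p)"
    using assms(1) \<open>0 \<le> C\<close> by (simp add: powr_mult powr_powr)
  finally show "Lp_norm p f \<le> C * Lp_norm p g"
    by (simp add: assms(3,4) Lp_norm_ae_class)
qed

lemma Lp_times_bounded:
  assumes "1 \<le> p" "f \<in> Lp p" "0 \<le> C" and [measurable]: "w \<in> borel_measurable unit_interval"
    and w: "\<And>t. t \<in> {0..1} \<Longrightarrow> norm (w t) \<le> C"
  shows "ae_class w * f \<in> Lp p" and "Lp_norm p (ae_class w * f) \<le> C * Lp_norm p f"
proof -
  obtain u where u [measurable]: "u \<in> borel_measurable borel" and f: "f = ae_class u"
    by (cases f rule: ae_class_cases)
  have "ae_class w * f = ae_class (\<lambda>t. w t * u t)"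
    by (simp add: f ae_class_times)
  note dom = Lp_dominated[OF assms(1,2) f this assms(3)]
  show "ae_class w * f \<in> Lp p" "Lp_norm p (ae_class w * f) \<le> C * Lp_norm p f"
    by (rule dom; simp add: norm_mult mult_right_mono w)+
qed

text \<open>From \<open>x \<le> 1 + x powr p\<close> on a space of finite measure. The inclusion
  makes primitives of L^p functions meaningful, and it is required because \<open>weak_deriv\<close>
  selects its value in \<open>Lp 1\<close> for every exponent.\<close>

lemma Lp_subset_L1:
  assumes "1 \<le> p"
  shows "Lp p \<subseteq> Lp 1"
proof
  fix f assume f: "f \<in> Lp p"
  obtain u where u [measurable]: "u \<in> borel_measurable borel" and fu: "f = ae_class u"
    by (cases f rule: ae_class_cases)
  have i: "integrable unit_interval (\<lambda>t. 1 + norm (u t) powr p)"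
    using f finite_measure.integrable_const[OF finite_measure_unit_interval]
    by (intro Bochner_Integration.integrable_add) (simp_all add: fu ae_class_in_Lp)
  have "norm (u t) \<le> 1 + norm (u t) powr p" for t
  proof (cases "norm (u t) \<le> 1")
    case False
    then have "norm (u t) powr 1 \<le> norm (u t) powr p"
      using assms by (intro powr_mono) auto
    then show ?thesis by simp
  qed (simp add: add_increasing2)
  then have "integrable unit_interval (\<lambda>t. norm (u t))"
    by (intro Bochner_Integration.integrable_bound[OF i]) (auto intro!: AE_I2)
  then show "f \<in> Lp 1"
    by (simp add: fu ae_class_in_Lp)
qed

section \<open>Uniqueness and perturbation of semigroups\<close>

lemma eventually_at_right_0_less: "0 < b \<Longrightarrow> \<forall>\<^sub>F h :: real in at_right 0. 0 < h \<and> h < b"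
  using eventually_at_right_real[of 0 b] by (auto elim: eventually_mono)

text \<open>Tilt \<phi> by a small slope \<open>d\<close> and take the last point \<open>s\<close>
  at which the tilted function is at most \<open>\<phi> 0\<close>. If \<open>s < T\<close>, the
  one-sided bound at \<open>s\<close> carries the inequality strictly beyond
  \<open>s\<close>.\<close>

lemma right_Dini_nonincreasing:
  fixes \<phi> :: "real \<Rightarrow> real"
  assumes cont: "continuous_on {0..T} \<phi>" and T: "0 \<le> T"
    and dini: "\<And>s e. 0 \<le> s \<Longrightarrow> s < T \<Longrightarrow> 0 < e \<Longrightarrow> \<forall>\<^sub>F h in at_right 0. \<phi> (s + h) \<le> \<phi> s + e * h"
  shows "\<phi> T \<le> \<phi> 0"
proof (rule field_le_epsilon)
  fix e :: real assume "e > 0"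
  \<comment> \<open>The summand 1 keeps the denominator positive for \<open>T = 0\<close>.\<close>
  define d where "d = e / (T + 1)"
  have d: "d > 0" "d * T \<le> e"
    using T \<open>e > 0\<close> by (auto simp: d_def field_simps)
  define \<psi> where "\<psi> s = \<phi> s - d * s" for s
  define A where "A = {s \<in> {0..T}. \<psi> s \<le> \<phi> 0}"
  have "closed A"
    unfolding A_def \<psi>_def using cont by (intro continuous_closed_preimage_constant continuous_intros
      closed_Collect_le continuous_on_closed_Collect_le) auto
  moreover have "A \<subseteq> {0..T}"
    by (auto simp: A_def)
  ultimately have "compact A"
    by (metis compact_Icc compact_Int_closed inf.absorb_iff2)
  moreover have "0 \<in> A"
    using T by (simp add: A_def \<psi>_def)
  ultimately obtain s where s: "s \<in> A" "\<And>r. r \<in> A \<Longrightarrow> r \<le> s"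
    using compact_attains_sup[of A] by auto
  have "s = T"
  proof (rule ccontr)
    assume "s \<noteq> T"
    with s have sT: "0 \<le> s" "s < T"
      by (auto simp: A_def)
    have "\<forall>\<^sub>F h in at_right 0. \<phi> (s + h) \<le> \<phi> s + d * h"
      using sT d by (intro dini)
    moreover have "\<forall>\<^sub>F h in at_right 0. 0 < h \<and> h < T - s"
      using sT by (intro eventually_at_right_0_less) auto
    ultimately have "\<forall>\<^sub>F h in at_right 0. \<phi> (s + h) \<le> \<phi> s + d * h \<and> 0 < h \<and> h < T - s"
      by eventually_elim auto
    then obtain h where h: "\<phi> (s + h) \<le> \<phi> s + d * h" "0 < h" "h < T - s"
      using eventually_happens'[OF trivial_limit_at_right_real] by blast
    have "\<psi> (s + h) \<le> \<psi> s"
      using h(1) by (simp add: \<psi>_def distrib_left)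
    moreover have "\<psi> s \<le> \<phi> 0"
      using s(1) by (simp add: A_def)
    ultimately have "s + h \<in> A"
      using h(2,3) sT by (simp add: A_def)
    then show False
      using s(2)[of "s + h"] h by simp
  qed
  with s(1) have "\<psi> T \<le> \<phi> 0"
    by (simp add: A_def)
  with d(2) show "\<phi> T \<le> \<phi> 0 + e"
    by (simp add: \<psi>_def)
qed

section \<open>Contraction semigroups and curves in \<open>Lp p\<close>\<close>

definition contractive :: "real \<Rightarrow> (real \<Rightarrow> ae_fun \<Rightarrow> ae_fun) \<Rightarrow> bool" where
  "contractive p S \<longleftrightarrow> (\<forall>\<tau>\<ge>0. \<forall>f\<in>Lp p. Lp_norm p (S \<tau> f) \<le> Lp_norm p f)"

lemma contractiveD: "contractive p S \<Longrightarrow> 0 \<le> \<tau> \<Longrightarrow> f \<in> Lp p \<Longrightarrow> Lp_norm p (S \<tau> f) \<le> Lp_norm p f"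
  by (simp add: contractive_def)

lemma bounded_op_add: "bounded_op p T \<Longrightarrow> f \<in> Lp p \<Longrightarrow> g \<in> Lp p \<Longrightarrow> T (f + g) = T f + T g"
  and bounded_op_scaleC: "bounded_op p T \<Longrightarrow> f \<in> Lp p \<Longrightarrow> T (c *\<^sub>C f) = c *\<^sub>C T f"
  by (auto simp: bounded_op_def)

lemma bounded_op_diff:
  assumes "bounded_op p T" "f \<in> Lp p" "g \<in> Lp p"
  shows "T (f - g) = T f - T g"
proof -
  have "T (f + (-1) *\<^sub>C g) = T f + (-1) *\<^sub>C T g"
    using assms by (simp add: bounded_op_add bounded_op_scaleC Lp_scaleC)
  then show ?thesis
    by (simp add: scaleC_minus_one)
qed

lemma bounded_op_bound:
  assumes "bounded_op p T"
  obtains K where "0 \<le> K" "\<And>f. f \<in> Lp p \<Longrightarrow> Lp_norm p (T f) \<le> K * Lp_norm p f"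
proof -
  from assms obtain K where K: "\<And>f. f \<in> Lp p \<Longrightarrow> Lp_norm p (T f) \<le> K * Lp_norm p f"
    unfolding bounded_op_def by blast
  show thesis
  proof (rule that[of "max K 0"])
    fix f assume "f \<in> Lp p"
    then show "Lp_norm p (T f) \<le> max K 0 * Lp_norm p f"
      using K[of f] mult_right_mono[of K "max K 0" "Lp_norm p f"] by simp
  qed simp
qed

lemma C0_semigroupD:
  assumes "C0_semigroup p S"
  shows C0_bounded_op: "0 \<le> \<tau> \<Longrightarrow> bounded_op p (S \<tau>)"
    and C0_Lp: "0 \<le> \<tau> \<Longrightarrow> f \<in> Lp p \<Longrightarrow> S \<tau> f \<in> Lp p"
    and C0_zero: "f \<in> Lp p \<Longrightarrow> S 0 f = f"
    and C0_plus: "0 \<le> \<sigma> \<Longrightarrow> 0 \<le> \<tau> \<Longrightarrow> f \<in> Lp p \<Longrightarrow> S (\<sigma> + \<tau>) f = S \<sigma> (S \<tau> f)"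
    and C0_cont: "0 \<le> \<tau> \<Longrightarrow> f \<in> Lp p \<Longrightarrow> ((\<lambda>\<sigma>. Lp_norm p (S \<sigma> f - S \<tau> f)) \<longlongrightarrow> 0) (at \<tau> within {0..})"
  using assms by (auto simp: C0_semigroup_def bounded_op_def)

text \<open>Right continuity at time 0 suffices: the semigroup law writes the difference at two
  times as \<open>S\<close> at the smaller time applied to
  \<open>S \<bar>\<sigma> - \<tau>\<bar> f - f\<close>, up to sign, and contractivity removes the
  outer operator. This gives continuity from both sides.\<close>

lemma contractive_C0_semigroupI:
  assumes p: "1 \<le> p" and contr: "contractive p S"
    and Lp: "\<And>\<tau> f. 0 \<le> \<tau> \<Longrightarrow> f \<in> Lp p \<Longrightarrow> S \<tau> f \<in> Lp p"
    and add: "\<And>\<tau> f g. 0 \<le> \<tau> \<Longrightarrow> f \<in> Lp p \<Longrightarrow> g \<in> Lp p \<Longrightarrow> S \<tau> (f + g) = S \<tau> f + S \<tau> g"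
    and scale: "\<And>\<tau> c f. 0 \<le> \<tau> \<Longrightarrow> f \<in> Lp p \<Longrightarrow> S \<tau> (c *\<^sub>C f) = c *\<^sub>C S \<tau> f"
    and zero: "\<And>f. f \<in> Lp p \<Longrightarrow> S 0 f = f"
    and plus: "\<And>\<sigma> \<tau> f. 0 \<le> \<sigma> \<Longrightarrow> 0 \<le> \<tau> \<Longrightarrow> f \<in> Lp p \<Longrightarrow> S (\<sigma> + \<tau>) f = S \<sigma> (S \<tau> f)"
    and cont: "\<And>f. f \<in> Lp p \<Longrightarrow> ((\<lambda>\<tau>. Lp_norm p (S \<tau> f - f)) \<longlongrightarrow> 0) (at_right 0)"
  shows "C0_semigroup p S"
proof -
  have bounded: "bounded_op p (S \<tau>)" if "0 \<le> \<tau>" for \<tau>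
    unfolding bounded_op_def using that Lp add scale contractiveD[OF contr]
    by (auto intro!: exI[of _ 1])
  have shift: "Lp_norm p (S \<sigma> f - S \<tau> f) \<le> Lp_norm p (S (\<bar>\<sigma> - \<tau>\<bar>) f - f)"
    if "0 \<le> \<sigma>" "0 \<le> \<tau>" "f \<in> Lp p" for \<sigma> \<tau> f
  proof -
    have *: "Lp_norm p (S \<sigma> f - S \<tau> f) \<le> Lp_norm p (S (\<sigma> - \<tau>) f - f)"
      if "\<tau> \<le> \<sigma>" "0 \<le> \<tau>" for \<sigma> \<tau>
    proof -
      have "S \<sigma> f = S \<tau> (S (\<sigma> - \<tau>) f)"
        using plus[of \<tau> "\<sigma> - \<tau>" f] that \<open>f \<in> Lp p\<close> by simp
      then have "S \<sigma> f - S \<tau> f = S \<tau> (S (\<sigma> - \<tau>) f - f)"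
        using bounded_op_diff[OF bounded] that Lp \<open>f \<in> Lp p\<close> by simp
      then show ?thesis
        using contractiveD[OF contr] that Lp \<open>f \<in> Lp p\<close> p by (simp add: Lp_diff)
    qed
    show ?thesis
      using *[of \<tau> \<sigma>] *[of \<sigma> \<tau>] that p by (cases "\<tau> \<le> \<sigma>") (auto simp: Lp_norm_minus_commute abs_if)
  qed
  have "((\<lambda>\<sigma>. Lp_norm p (S \<sigma> f - S \<tau> f)) \<longlongrightarrow> 0) (at \<tau> within {0..})" if "0 \<le> \<tau>" "f \<in> Lp p" for \<tau> f
  proof (rule tendsto_sandwich[OF _ _ tendsto_const])
    show "\<forall>\<^sub>F \<sigma> in at \<tau> within {0..}. Lp_norm p (S \<sigma> f - S \<tau> f) \<le> Lp_norm p (S (\<bar>\<sigma> - \<tau>\<bar>) f - f)"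
      using shift that by (auto simp: eventually_at_filter)
    have "filterlim (\<lambda>\<sigma>. \<bar>\<sigma> - \<tau>\<bar>) (at_right 0) (at \<tau> within {0..})"
      unfolding filterlim_at by (auto simp: eventually_at_filter intro!: tendsto_eq_intros)
    then show "((\<lambda>\<sigma>. Lp_norm p (S (\<bar>\<sigma> - \<tau>\<bar>) f - f)) \<longlongrightarrow> 0) (at \<tau> within {0..})"
      by (rule filterlim_compose[OF cont[OF that(2)]])
  qed auto
  then show ?thesis
    unfolding C0_semigroup_def using bounded zero plus by blast
qed

text \<open>The distance to the starting point is a continuous real function whose right Dini
  derivative is at most 0. One-sided information is all that a generator supplies, which is why a
  Dini argument stands in for the mean value theorem.\<close>

lemma C0_curve_constant:
  assumes p: "1 \<le> p" and T: "0 \<le> T" and u: "\<And>s. 0 \<le> s \<Longrightarrow> s \<le> T \<Longrightarrow> u s \<in> Lp p"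
    and cont: "\<And>s. 0 \<le> s \<Longrightarrow> s \<le> T \<Longrightarrow> ((\<lambda>\<sigma>. Lp_norm p (u \<sigma> - u s)) \<longlongrightarrow> 0) (at s within {0..T})"
    and deriv: "\<And>s e. 0 \<le> s \<Longrightarrow> s < T \<Longrightarrow> 0 < e \<Longrightarrow>
      \<forall>\<^sub>F h in at_right 0. Lp_norm p (u (s + h) - u s) \<le> e * h"
  shows "u T = u 0"
proof -
  define \<phi> where "\<phi> s = Lp_norm p (u s - u 0)" for s
  have diff: "\<bar>\<phi> \<sigma> - \<phi> s\<bar> \<le> Lp_norm p (u \<sigma> - u s)" if "0 \<le> s" "s \<le> T" "0 \<le> \<sigma>" "\<sigma> \<le> T" for s \<sigma>
    using Lp_norm_diff_triangle[of p "u \<sigma>" "u s" "u 0"] Lp_norm_diff_triangle[of p "u s" "u \<sigma>" "u 0"]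
      p u that Lp_norm_minus_commute[of p "u s" "u \<sigma>"] by (auto simp: \<phi>_def)
  have "(\<phi> \<longlongrightarrow> \<phi> s) (at s within {0..T})" if "0 \<le> s" "s \<le> T" for s
  proof (rule LIM_zero_cancel, rule Lim_null_comparison[OF _ cont[OF that]])
    show "\<forall>\<^sub>F x in at s within {0..T}. norm (\<phi> x - \<phi> s) \<le> Lp_norm p (u x - u s)"
      using diff[OF that] by (auto simp: eventually_at_filter)
  qed
  then have "continuous_on {0..T} \<phi>"
    by (auto simp: continuous_on_def)
  then have "\<phi> T \<le> \<phi> 0"
  proof (rule right_Dini_nonincreasing[OF _ T])
    fix s e :: real assume se: "0 \<le> s" "s < T" "0 < e"
    have "\<forall>\<^sub>F h in at_right 0. 0 < h \<and> h < T - s"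
      using se by (intro eventually_at_right_0_less) auto
    with deriv[OF se] show "\<forall>\<^sub>F h in at_right 0. \<phi> (s + h) \<le> \<phi> s + e * h"
    proof eventually_elim
      case (elim h)
      then show ?case
        using diff[of s "s + h"] se by simp
    qed
  qed
  then have "Lp_norm p (u T - u 0) = 0"
    using Lp_norm_nonneg[of p "u T - u 0"] by (simp add: \<phi>_def)
  then show ?thesis
    using Lp_norm_eq_0D[OF p, of "u T - u 0"] u T p by (simp add: Lp_diff)
qed

section \<open>Right derivatives at time 0\<close>

lemma has_right_deriv0_iff:
  assumes "1 \<le> p"
  shows "has_right_deriv0 p S f g \<longleftrightarrow>
    (\<forall>e>0. \<forall>\<^sub>F \<tau> in at_right 0. Lp_norm p (S \<tau> f - f - complex_of_real \<tau> *\<^sub>C g) \<le> e * \<tau>)"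
proof -
  have eq: "Lp_norm p (S \<tau> f - f - complex_of_real \<tau> *\<^sub>C g)
      = \<tau> * Lp_norm p (complex_of_real (1 / \<tau>) *\<^sub>C (S \<tau> f - f) - g)" if "0 < \<tau>" for \<tau>
  proof -
    have "S \<tau> f - f - complex_of_real \<tau> *\<^sub>C g
        = complex_of_real \<tau> *\<^sub>C (complex_of_real (1 / \<tau>) *\<^sub>C (S \<tau> f - f) - g)"
      using that by (simp add: scaleC_diff_right scaleC_scaleC flip: of_real_mult)
    then show ?thesis
      using that assms by (simp add: Lp_norm_scaleC)
  qed
  have pos: "\<forall>\<^sub>F \<tau> in at_right (0::real). 0 < \<tau>"
    by (simp add: eventually_at_filter)
  show ?thesis
  proof
    assume *: "has_right_deriv0 p S f g"
    show "\<forall>e>0. \<forall>\<^sub>F \<tau> in at_right 0. Lp_norm p (S \<tau> f - f - complex_of_real \<tau> *\<^sub>C g) \<le> e * \<tau>"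
    proof safe
      fix e :: real assume "e > 0"
      with * have "\<forall>\<^sub>F \<tau> in at_right 0. Lp_norm p (complex_of_real (1 / \<tau>) *\<^sub>C (S \<tau> f - f) - g) < e"
        unfolding has_right_deriv0_def by (auto dest: order_tendstoD)
      with pos show "\<forall>\<^sub>F \<tau> in at_right 0. Lp_norm p (S \<tau> f - f - complex_of_real \<tau> *\<^sub>C g) \<le> e * \<tau>"
        by eventually_elim (simp add: eq mult.commute[of e])
    qed
  next
    assume *: "\<forall>e>0. \<forall>\<^sub>F \<tau> in at_right 0. Lp_norm p (S \<tau> f - f - complex_of_real \<tau> *\<^sub>C g) \<le> e * \<tau>"
    show "has_right_deriv0 p S f g"
      unfolding has_right_deriv0_def
    proof (rule tendstoI)
      fix e :: real assume "e > 0"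
      then have "\<forall>\<^sub>F \<tau> in at_right 0. Lp_norm p (S \<tau> f - f - complex_of_real \<tau> *\<^sub>C g) \<le> e / 2 * \<tau>"
        using * by (metis half_gt_zero)
      with pos show "\<forall>\<^sub>F \<tau> in at_right 0. dist (Lp_norm p (complex_of_real (1 / \<tau>) *\<^sub>C (S \<tau> f - f) - g)) 0 < e"
      proof eventually_elim
        case (elim \<tau>)
        then have "\<tau> * Lp_norm p (complex_of_real (1 / \<tau>) *\<^sub>C (S \<tau> f - f) - g) \<le> \<tau> * (e / 2)"
          by (simp add: eq mult.commute[of _ \<tau>])
        then have "Lp_norm p (complex_of_real (1 / \<tau>) *\<^sub>C (S \<tau> f - f) - g) \<le> e / 2"
          using elim by (simp only: mult_le_cancel_left_pos)
        then show ?case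
          using \<open>e > 0\<close> by simp
      qed
    qed
  qed
qed

text \<open>The little-o form avoids the quotient, so that estimates can be added and operators
  applied to them.\<close>

lemma has_right_deriv0D:
  assumes "has_right_deriv0 p S f g" "1 \<le> p" "0 < e"
  shows "\<forall>\<^sub>F \<tau> in at_right 0. Lp_norm p (S \<tau> f - f - complex_of_real \<tau> *\<^sub>C g) \<le> e * \<tau>"
  using assms by (simp add: has_right_deriv0_iff)

lemma has_right_deriv0_diff:
  assumes p: "1 \<le> p" and S: "C0_semigroup p S"
    and f: "f \<in> Lp p" "g \<in> Lp p" "has_right_deriv0 p S f g"
    and f': "f' \<in> Lp p" "g' \<in> Lp p" "has_right_deriv0 p S f' g'"
  shows "has_right_deriv0 p S (f - f') (g - g')"
  unfolding has_right_deriv0_iff[OF p]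
proof safe
  fix e :: real assume "e > 0"
  then have "\<forall>\<^sub>F \<tau> in at_right 0. Lp_norm p (S \<tau> f - f - complex_of_real \<tau> *\<^sub>C g) \<le> e / 2 * \<tau>"
    "\<forall>\<^sub>F \<tau> in at_right 0. Lp_norm p (S \<tau> f' - f' - complex_of_real \<tau> *\<^sub>C g') \<le> e / 2 * \<tau>"
    "\<forall>\<^sub>F \<tau> in at_right (0::real). 0 < \<tau>"
    using has_right_deriv0D[OF f(3) p, of "e / 2"] has_right_deriv0D[OF f'(3) p, of "e / 2"]
    by (simp_all add: eventually_at_filter)
  then show "\<forall>\<^sub>F \<tau> in at_right 0.
      Lp_norm p (S \<tau> (f - f') - (f - f') - complex_of_real \<tau> *\<^sub>C (g - g')) \<le> e * \<tau>"
  proof eventually_elim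
    case (elim \<tau>)
    have "S \<tau> (f - f') - (f - f') - complex_of_real \<tau> *\<^sub>C (g - g') =
       (S \<tau> f - f - complex_of_real \<tau> *\<^sub>C g) - (S \<tau> f' - f' - complex_of_real \<tau> *\<^sub>C g')"
      using bounded_op_diff[OF C0_bounded_op[OF S]] elim f f' by (simp add: scaleC_diff_right algebra_simps)
    also have "Lp_norm p \<dots> \<le> Lp_norm p (S \<tau> f - f - complex_of_real \<tau> *\<^sub>C g)
        + Lp_norm p (S \<tau> f' - f' - complex_of_real \<tau> *\<^sub>C g')"
      using p f f' elim by (intro Lp_norm_triangle_diff Lp_diff Lp_scaleC C0_Lp[OF S]) auto
    finally show ?case
      using elim by simp
  qed
qed

lemma has_right_deriv0_scaleC:
  assumes p: "1 \<le> p" and S: "C0_semigroup p S" and f: "f \<in> Lp p" "has_right_deriv0 p S f g"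
  shows "has_right_deriv0 p S (c *\<^sub>C f) (c *\<^sub>C g)"
proof -
  have "((\<lambda>\<tau>. norm c * Lp_norm p (complex_of_real (1 / \<tau>) *\<^sub>C (S \<tau> f - f) - g)) \<longlongrightarrow> 0) (at_right 0)"
    using f(2) unfolding has_right_deriv0_def by (rule tendsto_mult_right_zero)
  moreover have "\<forall>\<^sub>F \<tau> in at_right 0. norm c * Lp_norm p (complex_of_real (1 / \<tau>) *\<^sub>C (S \<tau> f - f) - g)
      = Lp_norm p (complex_of_real (1 / \<tau>) *\<^sub>C (S \<tau> (c *\<^sub>C f) - c *\<^sub>C f) - c *\<^sub>C g)"
    unfolding eventually_at_filter
    using bounded_op_scaleC[OF C0_bounded_op[OF S]] f
    by (auto simp: Lp_norm_scaleC[OF p, symmetric] scaleC_diff_right scaleC_scaleC mult.commute intro!: always_eventually)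
  ultimately show ?thesis
    unfolding has_right_deriv0_def by (rule Lim_transform_eventually)
qed

text \<open>\<open>S s\<close> commutes with every \<open>S \<tau>\<close>, hence can be pulled out
  of the difference quotient, where its bound \<open>K\<close> controls the remainder.\<close>

lemma has_right_deriv0_invariant:
  assumes p: "1 \<le> p" and S: "C0_semigroup p S"
    and f: "f \<in> Lp p" "g \<in> Lp p" "has_right_deriv0 p S f g" and s: "0 \<le> s"
  shows "has_right_deriv0 p S (S s f) (S s g)"
proof -
  obtain K where K: "0 \<le> K" "\<And>f. f \<in> Lp p \<Longrightarrow> Lp_norm p (S s f) \<le> K * Lp_norm p f"
    using bounded_op_bound[OF C0_bounded_op[OF S s]] by blast
  note b = C0_bounded_op[OF S s]
  have "((\<lambda>\<tau>. K * Lp_norm p (complex_of_real (1 / \<tau>) *\<^sub>C (S \<tau> f - f) - g)) \<longlongrightarrow> 0) (at_right 0)"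
    using f(3) unfolding has_right_deriv0_def by (rule tendsto_mult_right_zero)
  then show ?thesis
    unfolding has_right_deriv0_def
  proof (rule Lim_null_comparison[rotated])
    have pos: "\<forall>\<^sub>F \<tau> in at_right (0::real). 0 < \<tau>"
      by (simp add: eventually_at_filter)
    then show "\<forall>\<^sub>F \<tau> in at_right 0. norm (Lp_norm p (complex_of_real (1 / \<tau>) *\<^sub>C (S \<tau> (S s f) - S s f) - S s g))
        \<le> K * Lp_norm p (complex_of_real (1 / \<tau>) *\<^sub>C (S \<tau> f - f) - g)"
    proof eventually_elim
      case (elim \<tau>)
      have "S \<tau> (S s f) = S s (S \<tau> f)"
        using C0_plus[OF S, of \<tau> s f] C0_plus[OF S, of s \<tau> f] s elim f by (simp add: add.commute)
      then have "complex_of_real (1 / \<tau>) *\<^sub>C (S \<tau> (S s f) - S s f) - S s g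
         = S s (complex_of_real (1 / \<tau>) *\<^sub>C (S \<tau> f - f) - g)"
        using p f elim C0_Lp[OF S, of \<tau> f]
        by (simp add: bounded_op_diff[OF b] bounded_op_scaleC[OF b] Lp_diff Lp_scaleC del: of_real_divide)
      then show ?case
        using K(2)[of "complex_of_real (1 / \<tau>) *\<^sub>C (S \<tau> f - f) - g"] p f elim C0_Lp[OF S, of \<tau> f]
        by (simp add: Lp_diff Lp_scaleC)
    qed
  qed
qed

text \<open>By the semigroup law the increment of the orbit at time \<open>s\<close> is
  \<open>S s\<close> applied to the increment at time 0, so the right derivative vanishes along the
  whole orbit. For a nilpotent semigroup this forces \<open>f = 0\<close>.\<close>

lemma has_right_deriv0_zero_imp_fixed:
  assumes p: "1 \<le> p" and S: "C0_semigroup p S" and c: "contractive p S"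
    and f: "f \<in> Lp p" "has_right_deriv0 p S f 0" and T: "0 \<le> T"
  shows "S T f = f"
proof -
  have "S T f = S 0 f"
  proof (rule C0_curve_constant[OF p T])
    show "S s f \<in> Lp p" if "0 \<le> s" for s
      using C0_Lp[OF S that f(1)] .
    show "((\<lambda>\<sigma>. Lp_norm p (S \<sigma> f - S s f)) \<longlongrightarrow> 0) (at s within {0..T})" if "0 \<le> s" for s
      by (rule tendsto_within_subset[OF C0_cont[OF S that f(1)]]) auto
    fix s e :: real assume s: "0 \<le> s" "0 < e"
    have "\<forall>\<^sub>F \<tau> in at_right 0. Lp_norm p (S \<tau> f - f - complex_of_real \<tau> *\<^sub>C 0) \<le> e * \<tau>"
      using f(2) s by (auto simp: has_right_deriv0_iff[OF p])
    moreover have "\<forall>\<^sub>F \<tau> in at_right (0::real). 0 < \<tau>"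
      by (simp add: eventually_at_filter)
    ultimately show "\<forall>\<^sub>F h in at_right 0. Lp_norm p (S (s + h) f - S s f) \<le> e * h"
    proof eventually_elim
      case (elim h)
      have "S (s + h) f - S s f = S s (S h f - f)"
        using bounded_op_diff[OF C0_bounded_op[OF S s(1)]] C0_plus[OF S s(1), of h f] elim f
          C0_Lp[OF S, of h f] by simp
      moreover have "Lp_norm p (S s (S h f - f)) \<le> Lp_norm p (S h f - f)"
        using contractiveD[OF c s(1), of "S h f - f"] C0_Lp[OF S, of h f] elim f p by (simp add: Lp_diff)
      ultimately show ?case
        using elim by simp
    qed
  qed
  then show ?thesis
    using C0_zero[OF S f(1)] by simp
qed

section \<open>Uniqueness of the semigroup with a given generator\<close>

lemma generated_by_minusD:
  assumes "generated_by_minus p D G S"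
  shows generated_by_minus_C0: "C0_semigroup p S"
    and generated_by_minus_domain: "D = {f \<in> Lp p. \<exists>g\<in>Lp p. has_right_deriv0 p S f g}"
    and generated_by_minus_deriv: "f \<in> D \<Longrightarrow> has_right_deriv0 p S f (- G f)"
    and generated_by_minus_Lp: "f \<in> D \<Longrightarrow> G f \<in> Lp p"
  using assms by (auto simp: generated_by_minus_def)

text \<open>
  On the domain, the curve \<open>S (t - s) (S' s f)\<close> has right derivative 0 in \<open>s\<close>; that \<open>S\<close> is
  contractive replaces the appeal to the uniform boundedness principle.
\<close>

lemma generated_semigroup_unique_on_domain:
  assumes p: "1 \<le> p" and gS: "generated_by_minus p D G S" and gS': "generated_by_minus p D G S'"
    and c: "contractive p S" and f: "f \<in> D" and t: "0 \<le> t"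
  shows "S' t f = S t f"
proof -
  note S = generated_by_minus_C0[OF gS] and S' = generated_by_minus_C0[OF gS']
  have fLp: "f \<in> Lp p"
    using f generated_by_minus_domain[OF gS] by auto
  \<comment> \<open>The orbit has to stay in \<open>D\<close>, since the derivative of the curve at
    \<open>s\<close> involves \<open>G\<close> at \<open>S' s f\<close>.\<close>
  have orbit: "S' s f \<in> D" if "0 \<le> s" for s
  proof -
    have "has_right_deriv0 p S' (S' s f) (S' s (- G f))"
      using has_right_deriv0_invariant[OF p S' fLp _ generated_by_minus_deriv[OF gS' f] that]
        generated_by_minus_Lp[OF gS' f] by (simp add: Lp_uminus)
    then show ?thesis
      using generated_by_minus_domain[OF gS'] C0_Lp[OF S' that] fLp generated_by_minus_Lp[OF gS' f]
      by (auto simp: Lp_uminus)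
  qed
  have orbit_Lp: "S' s f \<in> Lp p" if "0 \<le> s" for s
    using C0_Lp[OF S' that fLp] .
  define u where "u s = S (t - s) (S' s f)" for s
  have "u t = u 0"
  proof (rule C0_curve_constant[OF p t])
    show "u s \<in> Lp p" if "0 \<le> s" "s \<le> t" for s
      unfolding u_def using that by (intro C0_Lp[OF S] orbit_Lp) auto
    show "((\<lambda>\<sigma>. Lp_norm p (u \<sigma> - u s)) \<longlongrightarrow> 0) (at s within {0..t})" if s: "0 \<le> s" "s \<le> t" for s
    proof (rule Lim_null_comparison)
      have 1: "((\<lambda>\<sigma>. Lp_norm p (S' \<sigma> f - S' s f)) \<longlongrightarrow> 0) (at s within {0..t})"
        by (rule tendsto_within_subset[OF C0_cont[OF S' s(1) fLp]]) auto
      have "((\<lambda>\<sigma>. Lp_norm p (S \<sigma> (S' s f) - S (t - s) (S' s f))) \<longlongrightarrow> 0) (at (t - s) within {0..})"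
        using s by (intro C0_cont[OF S] orbit_Lp) auto
      moreover have "filterlim (\<lambda>\<sigma>. t - \<sigma>) (at (t - s) within {0..}) (at s within {0..t})"
        unfolding filterlim_at using s by (auto simp: eventually_at_filter intro!: tendsto_eq_intros)
      ultimately have 2: "((\<lambda>\<sigma>. Lp_norm p (S (t - \<sigma>) (S' s f) - S (t - s) (S' s f))) \<longlongrightarrow> 0) (at s within {0..t})"
        by (rule filterlim_compose)
      show "((\<lambda>\<sigma>. Lp_norm p (S' \<sigma> f - S' s f) + Lp_norm p (S (t - \<sigma>) (S' s f) - S (t - s) (S' s f))) \<longlongrightarrow> 0)
          (at s within {0..t})"
        using tendsto_add[OF 1 2] by simp
      have "norm (Lp_norm p (u \<sigma> - u s)) \<le> Lp_norm p (S' \<sigma> f - S' s f)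
            + Lp_norm p (S (t - \<sigma>) (S' s f) - S (t - s) (S' s f))" if "0 \<le> \<sigma>" "\<sigma> \<le> t" for \<sigma>
      proof -
        have "Lp_norm p (u \<sigma> - u s) \<le> Lp_norm p (S (t - \<sigma>) (S' \<sigma> f) - S (t - \<sigma>) (S' s f))
            + Lp_norm p (S (t - \<sigma>) (S' s f) - S (t - s) (S' s f))"
          unfolding u_def using s that p by (intro Lp_norm_diff_triangle C0_Lp[OF S] orbit_Lp) auto
        also have "S (t - \<sigma>) (S' \<sigma> f) - S (t - \<sigma>) (S' s f) = S (t - \<sigma>) (S' \<sigma> f - S' s f)"
          using s that orbit_Lp bounded_op_diff[OF C0_bounded_op[OF S]] by simp
        also have "Lp_norm p \<dots> \<le> Lp_norm p (S' \<sigma> f - S' s f)"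
          using s that p orbit_Lp by (intro contractiveD[OF c]) (auto intro: Lp_diff)
        finally show ?thesis by simp
      qed
      then show "\<forall>\<^sub>F \<sigma> in at s within {0..t}. norm (Lp_norm p (u \<sigma> - u s)) \<le> Lp_norm p (S' \<sigma> f - S' s f)
            + Lp_norm p (S (t - \<sigma>) (S' s f) - S (t - s) (S' s f))"
        by (auto simp: eventually_at_filter)
    qed
    fix s e :: real assume s: "0 \<le> s" "s < t" "0 < e"
    \<comment> \<open>At \<open>v\<close> both semigroups have right derivative
      \<open>- G v\<close>, so the first-order terms of \<open>S' h v\<close> and
      \<open>S h v\<close> cancel and only \<open>e * h\<close> is left.\<close>
    define v where "v = S' s f"
    have v: "v \<in> D" "v \<in> Lp p" "G v \<in> Lp p"
      using orbit orbit_Lp s generated_by_minus_Lp[OF gS] by (auto simp: v_def)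
    have "\<forall>\<^sub>F h in at_right 0. Lp_norm p (S h v - v - complex_of_real h *\<^sub>C (- G v)) \<le> e / 2 * h"
      "\<forall>\<^sub>F h in at_right 0. Lp_norm p (S' h v - v - complex_of_real h *\<^sub>C (- G v)) \<le> e / 2 * h"
      "\<forall>\<^sub>F h in at_right (0::real). 0 < h \<and> h < t - s"
      using has_right_deriv0D[OF generated_by_minus_deriv[OF gS v(1)] p, of "e / 2"]
        has_right_deriv0D[OF generated_by_minus_deriv[OF gS' v(1)] p, of "e / 2"]
        eventually_at_right_0_less[of "t - s"] s by simp_all
    then show "\<forall>\<^sub>F h in at_right 0. Lp_norm p (u (s + h) - u s) \<le> e * h"
    proof eventually_elim
      case (elim h)
      have Lp: "S h v \<in> Lp p" "S' h v \<in> Lp p"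
        using elim v C0_Lp[OF S] C0_Lp[OF S'] by auto
      have "S' (s + h) f = S' h v"
        using C0_plus[OF S', of h s f] s elim fLp by (simp add: v_def add.commute)
      moreover have "S (t - s) v = S (t - (s + h)) (S h v)"
        using C0_plus[OF S, of "t - (s + h)" h v] v elim by simp
      ultimately have "u (s + h) - u s = S (t - (s + h)) (S' h v - S h v)"
        using bounded_op_diff[OF C0_bounded_op[OF S]] elim Lp
        by (simp add: u_def v_def[symmetric])
      then have "Lp_norm p (u (s + h) - u s) \<le> Lp_norm p (S' h v - S h v)"
        using contractiveD[OF c, of "t - (s + h)" "S' h v - S h v"] elim Lp p by (simp add: Lp_diff)
      also have "S' h v - S h v = (S' h v - v - complex_of_real h *\<^sub>C (- G v))
          - (S h v - v - complex_of_real h *\<^sub>C (- G v))"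
        by simp
      also have "Lp_norm p \<dots> \<le> Lp_norm p (S' h v - v - complex_of_real h *\<^sub>C (- G v))
          + Lp_norm p (S h v - v - complex_of_real h *\<^sub>C (- G v))"
        using p Lp v by (intro Lp_norm_triangle_diff Lp_diff Lp_scaleC Lp_uminus)
      also have "\<dots> \<le> e * h"
        using elim by simp
      finally show ?case .
    qed
  qed
  then show ?thesis
    using C0_zero[OF S, of "S' t f"] C0_zero[OF S' fLp] orbit_Lp[OF t] t by (simp add: u_def)
qed

text \<open>Density extends the agreement from \<open>D\<close>. Of the competitor, only the bound
  of the single operator \<open>S' t\<close> enters this step.\<close>

lemma generated_semigroup_unique:
  assumes p: "1 \<le> p" and gS: "generated_by_minus p D G S" and gS': "generated_by_minus p D G S'"
    and c: "contractive p S" and dense: "\<And>f e. f \<in> Lp p \<Longrightarrow> 0 < e \<Longrightarrow> \<exists>g\<in>D. Lp_norm p (f - g) < e"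
    and f: "f \<in> Lp p" and t: "0 \<le> t"
  shows "S' t f = S t f"
proof -
  note S = generated_by_minus_C0[OF gS] and S' = generated_by_minus_C0[OF gS']
  obtain K where K: "0 \<le> K" "\<And>f. f \<in> Lp p \<Longrightarrow> Lp_norm p (S' t f) \<le> K * Lp_norm p f"
    using bounded_op_bound[OF C0_bounded_op[OF S' t]] by blast
  have "Lp_norm p (S' t f - S t f) \<le> 0 + e" if "e > 0" for e
  proof -
    \<comment> \<open>The factor \<open>K + 1\<close> collects the bound \<open>K\<close> of
      \<open>S' t\<close> and the bound 1 of the contraction \<open>S t\<close>.\<close>
    obtain g where g: "g \<in> D" "Lp_norm p (f - g) < e / (K + 1)"
      using dense[OF f, of "e / (K + 1)"] K \<open>e > 0\<close> by auto
    have gLp: "g \<in> Lp p"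
      using g generated_by_minus_domain[OF gS] by auto
    have "S' t f - S t f = S' t (f - g) - S t (f - g)"
      using bounded_op_diff[OF C0_bounded_op[OF S t] f gLp] bounded_op_diff[OF C0_bounded_op[OF S' t] f gLp]
        generated_semigroup_unique_on_domain[OF p gS gS' c g(1) t] by simp
    also have "Lp_norm p \<dots> \<le> Lp_norm p (S' t (f - g)) + Lp_norm p (S t (f - g))"
      using p f gLp t by (intro Lp_norm_triangle_diff C0_Lp[OF S] C0_Lp[OF S'] Lp_diff)
    also have "\<dots> \<le> K * Lp_norm p (f - g) + Lp_norm p (f - g)"
      using p f gLp t by (intro add_mono K(2) contractiveD[OF c] Lp_diff)
    also have "\<dots> = (K + 1) * Lp_norm p (f - g)"
      by (simp add: algebra_simps)
    also have "\<dots> \<le> (K + 1) * (e / (K + 1))"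
      using g(2) K(1) by (intro mult_left_mono) auto
    finally show ?thesis
      using K(1) by simp
  qed
  then have "Lp_norm p (S' t f - S t f) \<le> 0"
    by (rule field_le_epsilon)
  then have "Lp_norm p (S' t f - S t f) = 0"
    using Lp_norm_nonneg order_antisym by blast
  then show ?thesis
    using Lp_norm_eq_0D[OF p, of "S' t f - S t f"] p f t C0_Lp[OF S] C0_Lp[OF S'] by (simp add: Lp_diff)
qed

text \<open>Generation sees only times \<ge> 0 and elements of \<open>Lp p\<close>, so a semigroup
  may be padded with 0 elsewhere, as \<open>exp_minus\<close> demands.\<close>

lemma generated_by_minus_cong:
  assumes p: "1 \<le> p" and eq: "\<And>\<tau> f. 0 \<le> \<tau> \<Longrightarrow> f \<in> Lp p \<Longrightarrow> S' \<tau> f = S \<tau> f" and S: "generated_by_minus p D G S"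
  shows "generated_by_minus p D G S'"
proof -
  note C0 = generated_by_minus_C0[OF S]
  have lim: "((\<lambda>\<tau>. Lp_norm p (S' \<tau> f - S' \<sigma> f)) \<longlongrightarrow> 0) (at \<sigma> within {0..})" if "0 \<le> \<sigma>" "f \<in> Lp p" for f \<sigma>
    by (rule Lim_transform_eventually[OF C0_cont[OF C0 that]]) (auto simp: eventually_at_filter eq that)
  have deriv: "has_right_deriv0 p S' f g \<longleftrightarrow> has_right_deriv0 p S f g" if "f \<in> Lp p" for f g
    unfolding has_right_deriv0_def
    by (intro tendsto_cong) (auto simp: eventually_at_filter eq that intro!: always_eventually)
  have "bounded_op p (S' \<tau>)" if "0 \<le> \<tau>" for \<tau>
    using C0_bounded_op[OF C0 that] p unfolding bounded_op_def by (simp add: eq that Lp_add Lp_scaleC)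
  then have "C0_semigroup p S'"
    unfolding C0_semigroup_def using lim C0_Lp[OF C0] C0_zero[OF C0] C0_plus[OF C0]
    by (simp add: eq)
  then show ?thesis
    using S unfolding generated_by_minus_def by (auto simp: deriv)
qed

text \<open>The bridge from the definite description to explicit formulas: the zero-padded
  \<open>S\<close> satisfies the description, and uniqueness excludes every other candidate.\<close>

lemma exp_minus_eq:
  assumes p: "1 \<le> p" and gS: "generated_by_minus p D G S" and c: "contractive p S"
    and dense: "\<And>f e. f \<in> Lp p \<Longrightarrow> 0 < e \<Longrightarrow> \<exists>g\<in>D. Lp_norm p (f - g) < e"
    and f: "f \<in> Lp p" and t: "0 \<le> t"
  shows "exp_minus p D G t f = S t f"
proof -
  define S0 where "S0 \<tau> f = (if \<tau> < 0 \<or> f \<notin> Lp p then 0 else S \<tau> f)" for \<tau> f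
  have S0: "S0 \<tau> f = S \<tau> f" if "0 \<le> \<tau>" "f \<in> Lp p" for \<tau> f
    using that by (simp add: S0_def)
  have "exp_minus p D G = S0"
    unfolding exp_minus_def
  proof (rule the_equality)
    show "generated_by_minus p D G S0 \<and> (\<forall>\<tau> f. \<tau> < 0 \<or> f \<notin> Lp p \<longrightarrow> S0 \<tau> f = 0)"
      using generated_by_minus_cong[of p S0 S D G] p S0 gS by (simp add: S0_def)
  next
    fix S' assume S': "generated_by_minus p D G S' \<and> (\<forall>\<tau> f. \<tau> < 0 \<or> f \<notin> Lp p \<longrightarrow> S' \<tau> f = 0)"
    show "S' = S0"
    proof (intro ext)
      fix \<tau> f
      show "S' \<tau> f = S0 \<tau> f"
        using S' generated_semigroup_unique[OF p gS _ c dense, of S' f \<tau>] by (auto simp: S0_def)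
    qed
  qed
  then show ?thesis
    using S0 f t by simp
qed

text \<open>A first-order bound on \<open>T - S\<close> at time 0 moves the generator of \<open>S\<close> by a bounded operator,
  so no product rule is needed to find the domain of the generator of \<open>T\<close>.\<close>

lemma generated_by_minus_perturb:
  assumes p: "1 \<le> p" and gS: "generated_by_minus p D G S" and T: "C0_semigroup p T"
    and B: "\<And>f. f \<in> Lp p \<Longrightarrow> B f \<in> Lp p"
    and lim: "\<And>f. f \<in> Lp p \<Longrightarrow>
      ((\<lambda>\<tau>. Lp_norm p (complex_of_real (1 / \<tau>) *\<^sub>C (T \<tau> f - S \<tau> f) + B f)) \<longlongrightarrow> 0) (at_right 0)"
  shows "generated_by_minus p D (\<lambda>f. G f + B f) T"
proof -
  note S = generated_by_minus_C0[OF gS]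
  have pos: "\<forall>\<^sub>F \<tau> in at_right (0::real). 0 < \<tau>"
    by (simp add: eventually_at_filter)
  have fwd: "has_right_deriv0 p T f (g - B f)" if f: "f \<in> Lp p" "g \<in> Lp p" "has_right_deriv0 p S f g" for f g
    unfolding has_right_deriv0_def
  proof (rule Lim_null_comparison)
    show "((\<lambda>\<tau>. Lp_norm p (complex_of_real (1 / \<tau>) *\<^sub>C (T \<tau> f - S \<tau> f) + B f)
        + Lp_norm p (complex_of_real (1 / \<tau>) *\<^sub>C (S \<tau> f - f) - g)) \<longlongrightarrow> 0) (at_right 0)"
      using tendsto_add[OF lim[OF f(1)] f(3)[unfolded has_right_deriv0_def]] by simp
    show "\<forall>\<^sub>F \<tau> in at_right 0. norm (Lp_norm p (complex_of_real (1 / \<tau>) *\<^sub>C (T \<tau> f - f) - (g - B f)))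
      \<le> Lp_norm p (complex_of_real (1 / \<tau>) *\<^sub>C (T \<tau> f - S \<tau> f) + B f)
        + Lp_norm p (complex_of_real (1 / \<tau>) *\<^sub>C (S \<tau> f - f) - g)" (is "\<forall>\<^sub>F \<tau> in _. _ \<le> ?R1 \<tau> + ?R2 \<tau>")
      using pos
    proof eventually_elim
      case (elim \<tau>)
      have "complex_of_real (1 / \<tau>) *\<^sub>C (T \<tau> f - f) - (g - B f) =
        (complex_of_real (1 / \<tau>) *\<^sub>C (T \<tau> f - S \<tau> f) + B f) + (complex_of_real (1 / \<tau>) *\<^sub>C (S \<tau> f - f) - g)"
        by (simp add: scaleC_diff_right algebra_simps)
      also have "Lp_norm p \<dots> \<le> ?R1 \<tau> + ?R2 \<tau>"
        using elim f p by (intro Lp_norm_triangle Lp_add Lp_diff Lp_scaleC B C0_Lp[OF S] C0_Lp[OF T]) auto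
      finally show ?case
        by simp
    qed
  qed
  have bwd: "has_right_deriv0 p S f (g + B f)" if f: "f \<in> Lp p" "g \<in> Lp p" "has_right_deriv0 p T f g" for f g
    unfolding has_right_deriv0_def
  proof (rule Lim_null_comparison)
    show "((\<lambda>\<tau>. Lp_norm p (complex_of_real (1 / \<tau>) *\<^sub>C (T \<tau> f - f) - g)
       + Lp_norm p (complex_of_real (1 / \<tau>) *\<^sub>C (T \<tau> f - S \<tau> f) + B f)) \<longlongrightarrow> 0) (at_right 0)"
      using tendsto_add[OF f(3)[unfolded has_right_deriv0_def] lim[OF f(1)]] by simp
    show "\<forall>\<^sub>F \<tau> in at_right 0. norm (Lp_norm p (complex_of_real (1 / \<tau>) *\<^sub>C (S \<tau> f - f) - (g + B f)))
      \<le> Lp_norm p (complex_of_real (1 / \<tau>) *\<^sub>C (T \<tau> f - f) - g)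
        + Lp_norm p (complex_of_real (1 / \<tau>) *\<^sub>C (T \<tau> f - S \<tau> f) + B f)" (is "\<forall>\<^sub>F \<tau> in _. _ \<le> ?R1 \<tau> + ?R2 \<tau>")
      using pos
    proof eventually_elim
      case (elim \<tau>)
      have "complex_of_real (1 / \<tau>) *\<^sub>C (S \<tau> f - f) - (g + B f) =
        (complex_of_real (1 / \<tau>) *\<^sub>C (T \<tau> f - f) - g) - (complex_of_real (1 / \<tau>) *\<^sub>C (T \<tau> f - S \<tau> f) + B f)"
        by (simp add: scaleC_diff_right algebra_simps)
      also have "Lp_norm p \<dots> \<le> ?R1 \<tau> + ?R2 \<tau>"
        using elim f p by (intro Lp_norm_triangle_diff Lp_add Lp_diff Lp_scaleC B C0_Lp[OF S] C0_Lp[OF T]) auto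
      finally show ?case
        by simp
    qed
  qed
  have "D = {f \<in> Lp p. \<exists>g\<in>Lp p. has_right_deriv0 p T f g}"
  proof -
    have "(\<exists>g\<in>Lp p. has_right_deriv0 p S f g) \<longleftrightarrow> (\<exists>g\<in>Lp p. has_right_deriv0 p T f g)" if "f \<in> Lp p" for f
      using fwd[OF that] bwd[OF that] Lp_add[OF p _ B[OF that]] Lp_diff[OF p _ B[OF that]] by blast
    then show ?thesis
      unfolding generated_by_minus_domain[OF gS] by blast
  qed
  moreover have "G f + B f \<in> Lp p \<and> has_right_deriv0 p T f (- (G f + B f))" if "f \<in> D" for f
  proof -
    have "f \<in> Lp p" "G f \<in> Lp p" "has_right_deriv0 p S f (- G f)"
      using that generated_by_minus_domain[OF gS] generated_by_minus_Lp[OF gS] generated_by_minus_deriv[OF gS]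
      by auto
    then show ?thesis
      using fwd[of f "- G f"] B p by (simp add: Lp_uminus Lp_add)
  qed
  ultimately show ?thesis
    using T unfolding generated_by_minus_def by blast
qed

text \<open>With \<open>w\<close> the quotient that tends to 0,
  \<open>T \<tau> f - f = \<tau> w - \<tau> b + (S \<tau> f - f)\<close>. Thus the first-order bound
  which moves the generator also yields the strong continuity of \<open>T\<close> at 0.\<close>

lemma perturb_strongly_continuous:
  assumes p: "1 \<le> p" and S: "C0_semigroup p S" and f: "f \<in> Lp p" and b: "b \<in> Lp p"
    and T: "\<And>\<tau>. 0 < \<tau> \<Longrightarrow> T \<tau> f \<in> Lp p"
    and lim: "((\<lambda>\<tau>. Lp_norm p (complex_of_real (1 / \<tau>) *\<^sub>C (T \<tau> f - S \<tau> f) + b)) \<longlongrightarrow> 0) (at_right 0)"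
  shows "((\<lambda>\<tau>. Lp_norm p (T \<tau> f - f)) \<longlongrightarrow> 0) (at_right 0)"
proof (rule Lim_null_comparison)
  have "((\<lambda>\<tau>. Lp_norm p (S \<tau> f - S 0 f)) \<longlongrightarrow> 0) (at_right 0)"
    by (rule tendsto_within_subset[OF C0_cont[OF S _ f]]) auto
  then have 1: "((\<lambda>\<tau>. Lp_norm p (S \<tau> f - f)) \<longlongrightarrow> 0) (at_right 0)"
    by (simp add: C0_zero[OF S f])
  have 2: "((\<lambda>\<tau>. \<tau> * Lp_norm p b) \<longlongrightarrow> 0) (at_right 0)"
    by (auto intro!: tendsto_eq_intros)
  have 3: "((\<lambda>\<tau>. \<tau> * Lp_norm p (complex_of_real (1 / \<tau>) *\<^sub>C (T \<tau> f - S \<tau> f) + b)) \<longlongrightarrow> 0) (at_right 0)"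
    by (rule tendsto_eq_rhs[OF tendsto_mult[OF tendsto_ident_at lim]]) simp
  show "((\<lambda>\<tau>. \<tau> * Lp_norm p (complex_of_real (1 / \<tau>) *\<^sub>C (T \<tau> f - S \<tau> f) + b) + \<tau> * Lp_norm p b
      + Lp_norm p (S \<tau> f - f)) \<longlongrightarrow> 0) (at_right 0)"
    using tendsto_add[OF tendsto_add[OF 3 2] 1] by simp
  have "\<forall>\<^sub>F \<tau> in at_right (0::real). 0 < \<tau>"
    by (simp add: eventually_at_filter)
  then show "\<forall>\<^sub>F \<tau> in at_right 0. norm (Lp_norm p (T \<tau> f - f))
    \<le> \<tau> * Lp_norm p (complex_of_real (1 / \<tau>) *\<^sub>C (T \<tau> f - S \<tau> f) + b) + \<tau> * Lp_norm p b + Lp_norm p (S \<tau> f - f)"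
  proof eventually_elim
    case (elim \<tau>)
    have Lp: "T \<tau> f \<in> Lp p" "S \<tau> f \<in> Lp p"
      using elim f T C0_Lp[OF S] by auto
    define w where "w = complex_of_real (1 / \<tau>) *\<^sub>C (T \<tau> f - S \<tau> f) + b"
    have w: "w \<in> Lp p"
      using p Lp b by (auto simp: w_def intro!: Lp_add Lp_diff Lp_scaleC)
    have "T \<tau> f - f = (complex_of_real \<tau> *\<^sub>C w - complex_of_real \<tau> *\<^sub>C b) + (S \<tau> f - f)"
      using elim by (simp add: w_def scaleC_add_right scaleC_scaleC flip: of_real_mult)
    also have "Lp_norm p \<dots> \<le> Lp_norm p (complex_of_real \<tau> *\<^sub>C w - complex_of_real \<tau> *\<^sub>C b) + Lp_norm p (S \<tau> f - f)"
      using p Lp b w f by (intro Lp_norm_triangle Lp_diff Lp_scaleC)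
    also have "Lp_norm p (complex_of_real \<tau> *\<^sub>C w - complex_of_real \<tau> *\<^sub>C b)
        \<le> Lp_norm p (complex_of_real \<tau> *\<^sub>C w) + Lp_norm p (complex_of_real \<tau> *\<^sub>C b)"
      using p Lp b w f by (intro Lp_norm_triangle_diff Lp_scaleC)
    finally show ?case
      using p elim by (simp add: Lp_norm_scaleC w_def)
  qed
qed

section \<open>The shift semigroup\<close>

lemma tendsto_0_approx:
  fixes \<psi> :: "'a \<Rightarrow> real"
  assumes "\<And>e. 0 < e \<Longrightarrow> \<exists>\<phi>. (\<phi> \<longlongrightarrow> 0) F \<and> (\<forall>\<^sub>F x in F. \<bar>\<psi> x\<bar> \<le> \<phi> x + e)"
  shows "(\<psi> \<longlongrightarrow> 0) F"
proof (rule tendstoI)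
  fix e :: real assume "e > 0"
  then obtain \<phi> where \<phi>: "(\<phi> \<longlongrightarrow> 0) F" "\<forall>\<^sub>F x in F. \<bar>\<psi> x\<bar> \<le> \<phi> x + e / 2"
    using assms[of "e / 2"] by auto
  have "\<forall>\<^sub>F x in F. \<phi> x < e / 2"
    using \<phi>(1) \<open>e > 0\<close> by (intro order_tendstoD(2)) auto
  with \<phi>(2) show "\<forall>\<^sub>F x in F. dist (\<psi> x) 0 < e"
    by eventually_elim auto
qed

lemma lborel_integral_translate:
  fixes f :: "real \<Rightarrow> 'a :: {banach, second_countable_topology}"
  shows "(LINT t|lborel. f (t - h)) = (LINT t|lborel. f t)"
  using lborel_integral_real_affine[of 1 f "- h"] by simp

lemma lborel_integrable_translate:
  fixes f :: "real \<Rightarrow> 'a :: {banach, second_countable_topology}"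
  shows "integrable lborel (\<lambda>t. f (t - h)) \<longleftrightarrow> integrable lborel f"
  using lborel_integrable_real_affine_iff[of 1 f "- h"] by simp

text \<open>Translation preserves the integral, so the approximation error is paid once for
  \<open>f\<close> and once for its translate, which explains \<open>e / 2\<close>.\<close>

lemma L1_translation_approx:
  fixes f g :: "real \<Rightarrow> 'a :: {banach, second_countable_topology}"
  assumes f: "integrable lborel f" and g: "integrable lborel g"
    and e: "(LINT t|lborel. norm (f t - g t)) \<le> e / 2"
  shows "(LINT t|lborel. norm (f (t - h) - f t)) \<le> (LINT t|lborel. norm (g (t - h) - g t)) + e"
proof -
  note i = f g lborel_integrable_translate[of f h, THEN iffD2, OF f] lborel_integrable_translate[of g h, THEN iffD2, OF g]
  have "(LINT t|lborel. norm (f (t - h) - f t))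
      \<le> (LINT t|lborel. norm (f (t - h) - g (t - h)) + norm (g (t - h) - g t) + norm (f t - g t))"
  proof (rule integral_mono)
    show "norm (f (t - h) - f t) \<le> norm (f (t - h) - g (t - h)) + norm (g (t - h) - g t) + norm (f t - g t)" for t
      using norm_triangle_ineq[of "f (t - h) - g (t - h)" "g (t - h) - g t"]
        norm_triangle_ineq[of "f (t - h) - g t" "g t - f t"]
      by (simp add: norm_minus_commute)
  qed (use i in auto)
  also have "\<dots> = (LINT t|lborel. norm (f (t - h) - g (t - h))) + (LINT t|lborel. norm (g (t - h) - g t))
      + (LINT t|lborel. norm (f t - g t))"
    using i by simp
  also have "(LINT t|lborel. norm (f (t - h) - g (t - h))) = (LINT t|lborel. norm (f t - g t))"
    by (rule lborel_integral_translate)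
  finally show ?thesis
    using e by simp
qed

text \<open>The positive and negative parts of \<open>\<chi>\<^sub>U - \<chi>\<^sub>U(\<cdot> - h)\<close> have the same integral, and for open \<open>U\<close>
  the positive part tends to 0 pointwise.\<close>

lemma L1_translation_open:
  fixes U :: "real set"
  assumes "open U" "emeasure lborel U < \<infinity>"
  shows "((\<lambda>h. LINT t|lborel. \<bar>indicat_real U (t - h) - indicat_real U t\<bar>) \<longlongrightarrow> 0) (at_right 0)"
proof -
  have [measurable]: "U \<in> sets borel"
    using assms by simp
  have iU: "integrable lborel (indicat_real U)"
    using assms by (intro integrable_real_indicator) auto
  have iUh: "integrable lborel (\<lambda>t. indicat_real U (t - h))" for h
    using lborel_integrable_translate[of "indicat_real U" h] iU by simp
  have imax: "integrable lborel (\<lambda>t. max 0 (indicat_real U t - indicat_real U (t - h)))" for h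
    using iU iUh[of h] by (intro integrable_max) auto
  have eq: "(LINT t|lborel. \<bar>indicat_real U (t - h) - indicat_real U t\<bar>)
      = 2 * (LINT t|lborel. max 0 (indicat_real U t - indicat_real U (t - h)))" for h
  proof -
    have "(LINT t|lborel. \<bar>indicat_real U (t - h) - indicat_real U t\<bar>)
      = (LINT t|lborel. 2 * max 0 (indicat_real U t - indicat_real U (t - h))
          + (indicat_real U (t - h) - indicat_real U t))"
      by (intro Bochner_Integration.integral_cong) (auto simp: indicator_def)
    also have "\<dots> = 2 * (LINT t|lborel. max 0 (indicat_real U t - indicat_real U (t - h)))
      + ((LINT t|lborel. indicat_real U (t - h)) - (LINT t|lborel. indicat_real U t))"
      using iU iUh[of h] imax[of h] by (simp del: Bochner_Integration.integral_indicator)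
    also have "(LINT t|lborel. indicat_real U (t - h)) = (LINT t|lborel. indicat_real U t)"
      by (rule lborel_integral_translate)
    finally show ?thesis
      by simp
  qed
  \<comment> \<open>Substituting \<open>h = inverse x\<close> turns the right limit at 0 into a
    limit at infinity, to which dominated convergence applies.\<close>
  have "((\<lambda>x. LINT t|lborel. max 0 (indicat_real U t - indicat_real U (t - inverse x))) \<longlongrightarrow>
      (LINT (t :: real)|lborel. 0 :: real)) at_top"
  proof (rule integral_dominated_convergence_at_top[where w = "indicat_real U"])
    show "AE t in lborel. ((\<lambda>x. max 0 (indicat_real U t - indicat_real U (t - inverse x))) \<longlongrightarrow> 0) at_top"
    proof (rule AE_I2)
      fix t
      show "((\<lambda>x. max 0 (indicat_real U t - indicat_real U (t - inverse x))) \<longlongrightarrow> 0) at_top"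
      proof (cases "t \<in> U")
        case True
        have "((\<lambda>x::real. t - inverse x) \<longlongrightarrow> t - 0) at_top"
          by (intro tendsto_intros tendsto_inverse_0_at_top filterlim_ident)
        then have "\<forall>\<^sub>F x in at_top. t - inverse x \<in> U"
          using assms(1) True by (intro topological_tendstoD) auto
        then show ?thesis
          by (intro tendsto_eventually) (auto elim!: eventually_mono)
      qed (auto intro!: tendsto_eventually always_eventually simp: indicator_def)
    qed
    show "\<forall>\<^sub>F x in at_top. AE t in lborel.
        norm (max 0 (indicat_real U t - indicat_real U (t - inverse x))) \<le> indicat_real U t"
      by (auto intro!: always_eventually AE_I2 simp: indicator_def)
  qed (use iU in auto)
  then have "((\<lambda>h. LINT t|lborel. max 0 (indicat_real U t - indicat_real U (t - h))) \<longlongrightarrow> 0) (at_right 0)"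
    by (simp add: filterlim_at_right_to_top)
  from tendsto_mult_right_zero[OF this, of 2] show ?thesis
    by (simp add: eq)
qed

text \<open>Indicators are approximated from above by open sets of finite measure through outer
  regularity; sums use the triangle inequality, and limits the approximation lemma for L^1.\<close>

lemma L1_translation_continuous:
  fixes f :: "real \<Rightarrow> 'a :: {banach, second_countable_topology}"
  assumes "integrable lborel f"
  shows "((\<lambda>h. LINT t|lborel. norm (f (t - h) - f t)) \<longlongrightarrow> 0) (at_right 0)"
  using assms
proof (induction rule: integrable_induct)
  case (base A c)
  then have A [measurable]: "A \<in> sets borel"
    by simp
  have iA: "integrable lborel (indicat_real A)"
    using base by (intro integrable_real_indicator) auto
  have "((\<lambda>h. LINT t|lborel. \<bar>indicat_real A (t - h) - indicat_real A t\<bar>) \<longlongrightarrow> 0) (at_right 0)"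
  proof (rule tendsto_0_approx)
    fix e :: real assume "e > 0"
    then obtain U where U: "open U" "A \<subseteq> U" "emeasure lborel (U - A) < ennreal (e / 2)"
      using outer_regular_lborel[OF A, of "e / 2"] by auto
    have [measurable]: "U \<in> sets borel"
      using U by simp
    have "emeasure lborel U = emeasure lborel A + emeasure lborel (U - A)"
      using U by (subst plus_emeasure) (auto simp: Un_absorb1)
    also have "\<dots> < \<infinity>"
      using base U(3) by (simp add: less_top[symmetric]) (metis ennreal_less_top order_less_trans less_irrefl)
    finally have fin: "emeasure lborel U < \<infinity>" .
    have iU: "integrable lborel (indicat_real U)"
      using fin by (intro integrable_real_indicator) auto
    have "(LINT t|lborel. norm (indicat_real A t - indicat_real U t)) = (LINT t|lborel. indicat_real (U - A) t)"
      using U(2) by (intro Bochner_Integration.integral_cong) (auto simp: indicator_def)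
    also have "\<dots> = measure lborel (U - A)"
      by simp
    also have "\<dots> \<le> e / 2"
      using U(3) \<open>e > 0\<close> unfolding measure_def by (metis enn2real_leI half_gt_zero less_imp_le)
    finally have le: "(LINT t|lborel. norm (indicat_real A t - indicat_real U t)) \<le> e / 2" .
    show "\<exists>\<phi>. (\<phi> \<longlongrightarrow> 0) (at_right 0) \<and> (\<forall>\<^sub>F h in at_right 0.
        \<bar>LINT t|lborel. \<bar>indicat_real A (t - h) - indicat_real A t\<bar>\<bar> \<le> \<phi> h + e)"
      using L1_translation_open[OF U(1) fin] L1_translation_approx[OF iA iU le]
      by (intro exI[of _ "\<lambda>h. LINT t|lborel. \<bar>indicat_real U (t - h) - indicat_real U t\<bar>"])
         (auto intro!: always_eventually simp: abs_of_nonneg)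
  qed
  from tendsto_mult_left_zero[OF this, of "norm c"] show ?case
    by (simp flip: scaleR_diff_left)
next
  case (add f g)
  note i = add.hyps lborel_integrable_translate[THEN iffD2, OF add.hyps(1)]
    lborel_integrable_translate[THEN iffD2, OF add.hyps(2)]
  show ?case
  proof (rule Lim_null_comparison[OF always_eventually])
    show "\<forall>h. norm (LINT t|lborel. norm (f (t - h) + g (t - h) - (f t + g t)))
      \<le> (LINT t|lborel. norm (f (t - h) - f t)) + (LINT t|lborel. norm (g (t - h) - g t))"
    proof
      fix h
      have "(LINT t|lborel. norm (f (t - h) + g (t - h) - (f t + g t)))
         \<le> (LINT t|lborel. norm (f (t - h) - f t) + norm (g (t - h) - g t))"
        using i by (intro integral_mono) (auto simp: norm_diff_triangle_ineq)
      also have "\<dots> = (LINT t|lborel. norm (f (t - h) - f t)) + (LINT t|lborel. norm (g (t - h) - g t))"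
        using i by simp
      finally show "norm (LINT t|lborel. norm (f (t - h) + g (t - h) - (f t + g t)))
        \<le> (LINT t|lborel. norm (f (t - h) - f t)) + (LINT t|lborel. norm (g (t - h) - g t))"
        by simp
    qed
  qed (use tendsto_add[OF add.IH] in simp)
next
  case (lim f s)
  show ?case
  proof (rule tendsto_0_approx)
    fix e :: real assume "e > 0"
    have m: "f \<in> borel_measurable lborel" "\<And>i. s i \<in> borel_measurable lborel"
      using lim.hyps(1,4) by auto
    \<comment> \<open>The approximants satisfy \<open>norm (s i t) \<le> 2 * norm (f t)\<close>,
      which gives the factor 3 in the dominating function.\<close>
    have "(\<lambda>i. LINT t|lborel. norm (f t - s i t)) \<longlonglongrightarrow> (LINT t|lborel. norm (f t - f t))"
    proof (rule integral_dominated_convergence[where w = "\<lambda>t. 3 * norm (f t)"])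
      show "AE t in lborel. (\<lambda>i. norm (f t - s i t)) \<longlonglongrightarrow> norm (f t - f t)"
        using lim.hyps(2) by (intro AE_I2 tendsto_intros) auto
      show "AE t in lborel. norm (norm (f t - s i t)) \<le> 3 * norm (f t)" for i
      proof (rule AE_I2)
        fix t
        show "norm (norm (f t - s i t)) \<le> 3 * norm (f t)"
          using norm_triangle_ineq4[of "f t" "s i t"] lim.hyps(3)[of t i] by simp
      qed
    qed (use lim.hyps(4) m in auto)
    then have "\<forall>\<^sub>F i in sequentially. (LINT t|lborel. norm (f t - s i t)) < e / 2"
      using \<open>e > 0\<close> by (intro order_tendstoD(2)) auto
    then obtain i where "(LINT t|lborel. norm (f t - s i t)) \<le> e / 2"
      by (auto simp: eventually_sequentially intro: less_imp_le)
    from L1_translation_approx[OF lim.hyps(4,1) this] lim.IH[of i]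
    show "\<exists>\<phi>. (\<phi> \<longlongrightarrow> 0) (at_right 0) \<and>
        (\<forall>\<^sub>F h in at_right 0. \<bar>LINT t|lborel. norm (f (t - h) - f t)\<bar> \<le> \<phi> h + e)"
      by (intro exI[of _ "\<lambda>h. LINT t|lborel. norm (s i (t - h) - s i t)"]) (auto intro!: always_eventually)
  qed
qed

section \<open>Translation on \<open>Lp p\<close> of the interval\<close>

lemma integral_unit_interval:
  fixes f :: "real \<Rightarrow> 'a :: {banach, second_countable_topology}"
  shows "(LINT t|unit_interval. f t) = (LINT t|lborel. indicator {0..1} t *\<^sub>R f t)"
  by (subst integral_restrict_space) auto

lemma integrable_unit_interval:
  fixes f :: "real \<Rightarrow> 'a :: {banach, second_countable_topology}"
  shows "integrable unit_interval f \<longleftrightarrow> integrable lborel (\<lambda>t. indicator {0..1} t *\<^sub>R f t)"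
  by (subst integrable_restrict_space) auto

text \<open>On these representatives the shift is literally \<open>u (t - \<tau>)\<close>: the
  cut-off at the left end is built into the zero values.\<close>

definition zext :: "(real \<Rightarrow> complex) set" where
  "zext = {u \<in> borel_measurable borel. \<forall>t. t \<notin> {0..1} \<longrightarrow> u t = 0}"

lemma zext_measurable: "u \<in> zext \<Longrightarrow> u \<in> borel_measurable borel"
  and zext_outside: "u \<in> zext \<Longrightarrow> t \<notin> {0..1} \<Longrightarrow> u t = 0"
  by (auto simp: zext_def)

lemma zext_cases:
  obtains u where "u \<in> zext" "f = ae_class u"
  by (rule ae_class_cases[of f]) (auto simp: zext_def)

lemma Lp_norm_le_lborel:
  assumes "1 \<le> p" and [measurable]: "v \<in> borel_measurable borel"
    and i: "integrable lborel (\<lambda>t. norm (v t) powr p)"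
  shows "ae_class v \<in> Lp p" and "Lp_norm p (ae_class v) \<le> (LINT t|lborel. norm (v t) powr p) powr (1 / p)"
proof -
  have m: "v \<in> borel_measurable unit_interval"
    by (rule borel_measurable_unit_interval) simp
  have i': "integrable lborel (\<lambda>t. indicator {0..1} t *\<^sub>R (norm (v t) powr p))"
    using integrable_mult_indicator[OF _ i, of "{0..1}"] by simp
  then show "ae_class v \<in> Lp p"
    by (simp add: ae_class_in_Lp m integrable_unit_interval)
  have "(LINT t|unit_interval. norm (v t) powr p) \<le> (LINT t|lborel. norm (v t) powr p)"
    unfolding integral_unit_interval by (intro integral_mono i' i) (auto simp: indicator_def)
  then show "Lp_norm p (ae_class v) \<le> (LINT t|lborel. norm (v t) powr p) powr (1 / p)"
    using assms(1) by (simp add: Lp_norm_ae_class m) (intro powr_mono2, auto intro: integral_nonneg_AE)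
qed

lemma
  assumes u: "u \<in> zext"
  shows Lp_lborel: "ae_class u \<in> Lp p \<longleftrightarrow> integrable lborel (\<lambda>t. norm (u t) powr p)"
    and Lp_norm_lborel: "Lp_norm p (ae_class u) = (LINT t|lborel. norm (u t) powr p) powr (1 / p)"
proof -
  have m: "u \<in> borel_measurable unit_interval"
    by (intro borel_measurable_unit_interval zext_measurable u)
  have eq: "(\<lambda>t. indicator {0..1} t *\<^sub>R (norm (u t) powr p)) = (\<lambda>t. norm (u t) powr p)"
    using zext_outside[OF u] by (auto simp: indicator_def fun_eq_iff)
  show "ae_class u \<in> Lp p \<longleftrightarrow> integrable lborel (\<lambda>t. norm (u t) powr p)"
    by (simp add: ae_class_in_Lp m integrable_unit_interval eq del: real_scaleR_def)
  show "Lp_norm p (ae_class u) = (LINT t|lborel. norm (u t) powr p) powr (1 / p)"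
    by (simp add: Lp_norm_ae_class m integral_unit_interval eq del: real_scaleR_def)
qed

text \<open>The test on \<open>t - \<tau>\<close> lets zeros flow in and discards values outside the
  interval, about which \<open>ae_rel\<close> says nothing. Well-definedness is the translation
  invariance of null sets.\<close>

lift_definition shift :: "real \<Rightarrow> ae_fun \<Rightarrow> ae_fun"
  is "\<lambda>\<tau> f t. if t - \<tau> \<in> {0..1} then f (t - \<tau>) else 0"
proof -
  fix \<tau> :: real and f g :: "real \<Rightarrow> complex"
  assume fg: "ae_rel f g"
  define f' where "f' = (\<lambda>t. if t \<in> {0..1} then f t else 0)"
  define g' where "g' = (\<lambda>t. if t \<in> {0..1} then g t else 0)"
  have [measurable]: "f' \<in> borel_measurable borel" "g' \<in> borel_measurable borel"
    using fg unfolding f'_def g'_def ae_rel_def by (intro borel_zero_extension; simp)+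
  have "AE t in lborel. f' t = g' t"
    using fg by (auto simp: ae_rel_def AE_restrict_space_iff f'_def g'_def)
  then have "AE t in lborel. f' (- \<tau> + 1 * t) = g' (- \<tau> + 1 * t)"
    by (intro AE_borel_affine) auto
  then have "ae_rel (\<lambda>t. f' (t - \<tau>)) (\<lambda>t. g' (t - \<tau>))"
    by (auto simp: ae_rel_def AE_restrict_space_iff intro!: borel_measurable_unit_interval)
  then show "ae_rel (\<lambda>t. if t - \<tau> \<in> {0..1} then f (t - \<tau>) else 0) (\<lambda>t. if t - \<tau> \<in> {0..1} then g (t - \<tau>) else 0)"
    by (simp add: f'_def g'_def)
qed

lemma shift_ae_class:
  assumes "u \<in> zext"
  shows "shift \<tau> (ae_class u) = ae_class (\<lambda>t. u (t - \<tau>))"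
proof -
  have "shift \<tau> (ae_class u) = ae_class (\<lambda>t. if t - \<tau> \<in> {0..1} then u (t - \<tau>) else 0)"
    using assms by (intro shift.abs_eq ae_rel_borel zext_measurable)
  also have "(\<lambda>t. if t - \<tau> \<in> {0..1} then u (t - \<tau>) else 0) = (\<lambda>t. u (t - \<tau>))"
    using zext_outside[OF assms] by (auto simp: fun_eq_iff)
  finally show ?thesis .
qed

lemma shift_add: "shift \<tau> (f + g) = shift \<tau> f + shift \<tau> g"
proof (transfer, goal_cases)
  case (1 \<tau> f g)
  have "ae_rel (\<lambda>t. if t - \<tau> \<in> {0..1} then f (t - \<tau>) else 0) (\<lambda>t. if t - \<tau> \<in> {0..1} then f (t - \<tau>) else 0)"
    if "ae_rel f f" for f
    using that by (rule shift.rsp[unfolded rel_fun_def, rule_format, OF refl])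
  from this[OF 1(1)] this[OF 1(2)]
  have "ae_rel (\<lambda>t. (if t - \<tau> \<in> {0..1} then f (t - \<tau>) else 0) + (if t - \<tau> \<in> {0..1} then g (t - \<tau>) else 0))
     (\<lambda>t. (if t - \<tau> \<in> {0..1} then f (t - \<tau>) else 0) + (if t - \<tau> \<in> {0..1} then g (t - \<tau>) else 0))"
    by (rule plus_ae_fun.rsp[unfolded rel_fun_def, rule_format])
  then show ?case
    by (rule back_subst[of "\<lambda>h. ae_rel h _"]) auto
qed

lemma zext_scale: "u \<in> zext \<Longrightarrow> (\<lambda>t. c * u t) \<in> zext"
  and zext_diff: "u \<in> zext \<Longrightarrow> v \<in> zext \<Longrightarrow> (\<lambda>t. u t - v t) \<in> zext"
  by (auto simp: zext_def)

lemma shift_scaleC: "shift \<tau> (c *\<^sub>C f) = c *\<^sub>C shift \<tau> f"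
proof -
  obtain u where u: "u \<in> zext" "f = ae_class u"
    by (rule zext_cases)
  note [measurable] = zext_measurable[OF u(1)]
  show ?thesis
    using u by (simp add: ae_class_scaleC shift_ae_class zext_scale borel_measurable_unit_interval)
qed

lemma shift_diff: "shift \<tau> (f - g) = shift \<tau> f - shift \<tau> g"
  using shift_add[of \<tau> f "(-1) *\<^sub>C g"] shift_scaleC[of \<tau> "-1" g] by (simp add: scaleC_minus_one)

lemma shift_zero [simp]: "shift 0 f = f"
proof (rule zext_cases[of f])
  fix u assume "u \<in> zext" "f = ae_class u"
  then show "shift 0 f = f"
    using shift_ae_class[of u 0] by simp
qed

text \<open>The intermediate cut-off to the interval does no harm: for \<open>t\<close> in [0,1] the
  point \<open>t - \<sigma>\<close> never exceeds 1, and where it is negative,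
  \<open>t - \<sigma> - \<tau>\<close> is negative too.\<close>

lemma shift_shift:
  assumes "0 \<le> \<sigma>" "0 \<le> \<tau>"
  shows "shift (\<sigma> + \<tau>) f = shift \<sigma> (shift \<tau> f)"
proof -
  obtain u where u: "u \<in> zext" "f = ae_class u"
    by (rule zext_cases)
  note [measurable] = zext_measurable[OF u(1)]
  define v where "v = (\<lambda>t. if t \<in> {0..1} then u (t - \<tau>) else 0)"
  have v: "v \<in> zext"
    by (auto simp: v_def zext_def)
  note [measurable] = zext_measurable[OF this]
  have "shift \<tau> f = ae_class v"
    unfolding u(2) by (subst shift_ae_class[OF u(1)], intro ae_class_eqI borel_measurable_unit_interval)
      (auto simp: v_def)
  then have "shift \<sigma> (shift \<tau> f) = ae_class (\<lambda>t. v (t - \<sigma>))"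
    by (simp add: shift_ae_class v)
  also have "\<dots> = ae_class (\<lambda>t. u (t - (\<sigma> + \<tau>)))"
    using assms zext_outside[OF u(1)]
    by (intro ae_class_eqI borel_measurable_unit_interval) (auto simp: v_def diff_diff_add)
  finally show ?thesis
    unfolding u(2) using u(1) by (simp add: shift_ae_class)
qed

lemma
  assumes p: "1 \<le> p" and f: "f \<in> Lp p"
  shows Lp_shift: "shift \<tau> f \<in> Lp p" and Lp_norm_shift_le: "Lp_norm p (shift \<tau> f) \<le> Lp_norm p f"
proof -
  obtain u where u: "u \<in> zext" "f = ae_class u"
    by (rule zext_cases)
  note [measurable] = zext_measurable[OF u(1)]
  have i: "integrable lborel (\<lambda>t. norm (u (t - \<tau>)) powr p)"
    using f p u lborel_integrable_translate[of "\<lambda>t. norm (u t) powr p" \<tau>] by (simp add: Lp_lborel)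
  note le = Lp_norm_le_lborel[OF p _ i, measurable, simplified]
  show "shift \<tau> f \<in> Lp p"
    using le(1) u by (simp add: shift_ae_class)
  have "Lp_norm p (ae_class (\<lambda>t. u (t - \<tau>))) \<le> (LINT t|lborel. norm (u t) powr p) powr (1 / p)"
    using le(2) lborel_integral_translate[of "\<lambda>t. norm (u t) powr p" \<tau>] by simp
  then show "Lp_norm p (shift \<tau> f) \<le> Lp_norm p f"
    using u p by (simp add: shift_ae_class Lp_norm_lborel)
qed

lemma shift_eq_0:
  assumes "1 < \<tau>"
  shows "shift \<tau> f = 0"
proof -
  obtain u where u: "u \<in> zext" "f = ae_class u"
    by (rule zext_cases)
  note [measurable] = zext_measurable[OF u(1)]
  show ?thesis
    unfolding u(2) zero_eq_ae_class using u assms zext_outside[OF u(1)]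
    by (subst shift_ae_class) (auto intro!: ae_class_eqI borel_measurable_unit_interval)
qed

text \<open>For a function bounded by \<open>M\<close>, the \<open>p\<close>-th power of an
  increment is at most \<open>(2 * M) powr (p - 1)\<close> times the increment itself, so continuity
  of translation in L^1 carries over to L^p.\<close>

lemma shift_bounded_continuous:
  assumes p: "1 \<le> p" and v: "v \<in> zext" and M: "\<And>t. norm (v t) \<le> M"
  shows "((\<lambda>h. Lp_norm p (shift h (ae_class v) - ae_class v)) \<longlongrightarrow> 0) (at_right 0)"
proof -
  note [measurable] = zext_measurable[OF v]
  have i: "integrable lborel v"
  proof (rule Bochner_Integration.integrable_bound)
    show "integrable lborel (\<lambda>t :: real. M * indicat_real {0..1} t)"
      by (intro integrable_mult_right integrable_real_indicator) auto
    show "AE t in lborel. norm (v t) \<le> norm (M * indicat_real {0..1} t)"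
      using zext_outside[OF v] M
      by (intro AE_I2) (auto simp: indicator_def intro: order_trans[OF _ abs_ge_self])
  qed simp
  have ih: "integrable lborel (\<lambda>t. norm (v (t - h) - v t))" for h
    using i lborel_integrable_translate[of v h] by auto
  have M0: "0 \<le> M"
    using M[of 0] norm_ge_zero order_trans by blast
  have bound: "norm (v (t - h) - v t) powr p \<le> (2 * M) powr (p - 1) * norm (v (t - h) - v t)" for h t
  proof -
    have "norm (v (t - h) - v t) \<le> 2 * M"
      using norm_triangle_ineq4[of "v (t - h)" "v t"] M[of t] M[of "t - h"] by simp
    then have "norm (v (t - h) - v t) powr (p - 1) * norm (v (t - h) - v t)
        \<le> (2 * M) powr (p - 1) * norm (v (t - h) - v t)"
      using p by (intro mult_right_mono powr_mono2) auto
    also have "norm (v (t - h) - v t) powr (p - 1) * norm (v (t - h) - v t) = norm (v (t - h) - v t) powr p"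
      by (cases "v (t - h) = v t") (auto simp: powr_diff)
    finally show ?thesis .
  qed
  have ip: "integrable lborel (\<lambda>t. norm (v (t - h) - v t) powr p)" for h
  proof (rule Bochner_Integration.integrable_bound[OF integrable_mult_right[OF ih]])
    show "AE t in lborel. norm (norm (v (t - h) - v t) powr p) \<le> norm ((2 * M) powr (p - 1) * norm (v (t - h) - v t))"
      using bound by (intro AE_I2) simp
  qed simp
  show ?thesis
  proof (rule Lim_null_comparison[OF always_eventually])
    show "\<forall>h. norm (Lp_norm p (shift h (ae_class v) - ae_class v))
       \<le> ((2 * M) powr (p - 1) * (LINT t|lborel. norm (v (t - h) - v t))) powr (1 / p)"
    proof
      fix h
      have "shift h (ae_class v) - ae_class v = ae_class (\<lambda>t. v (t - h) - v t)"
        using v by (simp add: shift_ae_class ae_class_minus borel_measurable_unit_interval)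
      then have "Lp_norm p (shift h (ae_class v) - ae_class v)
          \<le> (LINT t|lborel. norm (v (t - h) - v t) powr p) powr (1 / p)"
        using Lp_norm_le_lborel(2)[OF p _ ip] by simp
      also have "\<dots> \<le> (LINT t|lborel. (2 * M) powr (p - 1) * norm (v (t - h) - v t)) powr (1 / p)"
        using ih p by (intro powr_mono2 integral_mono ip bound) auto
      finally show "norm (Lp_norm p (shift h (ae_class v) - ae_class v))
         \<le> ((2 * M) powr (p - 1) * (LINT t|lborel. norm (v (t - h) - v t))) powr (1 / p)"
        by simp
    qed
    show "((\<lambda>h. ((2 * M) powr (p - 1) * (LINT t|lborel. norm (v (t - h) - v t))) powr (1 / p)) \<longlongrightarrow> 0) (at_right 0)"
      using p by (intro tendsto_zero_powrI[OF tendsto_mult_right_zero[OF L1_translation_continuous[OF i]] tendsto_const])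
        auto
  qed
qed

text \<open>Truncation at height \<open>M\<close> approximates \<open>f\<close> in norm by bounded
  functions; contractivity of the shift makes the error uniform in \<open>h\<close>.\<close>

lemma shift_continuous:
  assumes p: "1 \<le> p" and f: "f \<in> Lp p"
  shows "((\<lambda>h. Lp_norm p (shift h f - f)) \<longlongrightarrow> 0) (at_right 0)"
proof (rule tendsto_0_approx)
  fix e :: real assume "e > 0"
  obtain u where u: "u \<in> zext" "f = ae_class u"
    by (rule zext_cases)
  note [measurable] = zext_measurable[OF u(1)]
  define v where "v M = (\<lambda>t. if norm (u t) \<le> real M then u t else 0)" for M :: nat
  have v: "v M \<in> zext" for M
    using zext_outside[OF u(1)] by (auto simp: v_def zext_def)
  note [measurable] = zext_measurable[OF v]
  have iu: "integrable lborel (\<lambda>t. norm (u t) powr p)"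
    using f u by (simp add: Lp_lborel)
  have iv: "integrable lborel (\<lambda>t. norm (v M t) powr p)" for M
    by (rule Bochner_Integration.integrable_bound[OF iu]) (auto simp: v_def intro!: AE_I2)
  have diff: "norm (u t - v M t) powr p \<le> norm (u t) powr p" for M t
    using p by (auto simp: v_def)
  have "(\<lambda>M. LINT t|lborel. norm (u t - v M t) powr p) \<longlonglongrightarrow> (LINT (t :: real)|lborel. 0 :: real)"
  proof (rule integral_dominated_convergence[OF _ _ iu])
    show "AE t in lborel. (\<lambda>M. norm (u t - v M t) powr p) \<longlonglongrightarrow> 0"
    proof (rule AE_I2, rule tendsto_eventually)
      fix t
      obtain N :: nat where N: "norm (u t) \<le> real N"
        using real_arch_simple by blast
      show "\<forall>\<^sub>F M in sequentially. norm (u t - v M t) powr p = 0"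
        using N p by (intro eventually_sequentiallyI[of N]) (auto simp: v_def)
    qed
  qed (use diff in auto)
  then have "(\<lambda>M. (LINT t|lborel. norm (u t - v M t) powr p) powr (1 / p)) \<longlonglongrightarrow> 0"
    using p by (intro tendsto_zero_powrI[OF _ tendsto_const]) auto
  then have "\<forall>\<^sub>F M in sequentially. (LINT t|lborel. norm (u t - v M t) powr p) powr (1 / p) < e / 2"
    using \<open>e > 0\<close> by (intro order_tendstoD(2)) auto
  then obtain M where "(LINT t|lborel. norm (u t - v M t) powr p) powr (1 / p) < e / 2"
    by (auto simp: eventually_sequentially)
  moreover define g where "g = ae_class (v M)"
  have "f - g = ae_class (\<lambda>t. u t - v M t)"
    by (simp add: u(2) g_def ae_class_minus borel_measurable_unit_interval)
  ultimately have le: "Lp_norm p (f - g) \<le> e / 2"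
    using Lp_norm_lborel[OF zext_diff[OF u(1) v[of M]], of p] by simp
  have g: "g \<in> Lp p"
    unfolding g_def using v iv by (simp add: Lp_lborel)
  have "Lp_norm p (shift h f - f) \<le> Lp_norm p (shift h g - g) + e" for h
  proof -
    have "shift h f - f = (shift h (f - g) + (shift h g - g)) - (f - g)"
      by (simp add: shift_diff)
    also have "Lp_norm p \<dots> \<le> Lp_norm p (shift h (f - g) + (shift h g - g)) + Lp_norm p (f - g)"
      using p f g by (intro Lp_norm_triangle_diff Lp_add Lp_diff Lp_shift)
    also have "Lp_norm p (shift h (f - g) + (shift h g - g))
        \<le> Lp_norm p (shift h (f - g)) + Lp_norm p (shift h g - g)"
      using p f g by (intro Lp_norm_triangle Lp_diff Lp_shift)
    also have "Lp_norm p (shift h (f - g)) \<le> Lp_norm p (f - g)"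
      using p f g by (intro Lp_norm_shift_le Lp_diff)
    finally show ?thesis
      using le by simp
  qed
  then show "\<exists>\<phi>. (\<phi> \<longlongrightarrow> 0) (at_right 0) \<and> (\<forall>\<^sub>F h in at_right 0. \<bar>Lp_norm p (shift h f - f)\<bar> \<le> \<phi> h + e)"
    using shift_bounded_continuous[OF p, of "v M" "real M"] v
    by (intro exI[of _ "\<lambda>h. Lp_norm p (shift h g - g)"]) (auto simp: g_def v_def intro!: always_eventually)
qed

lemma contractive_shift: "1 \<le> p \<Longrightarrow> contractive p shift"
  by (simp add: contractive_def Lp_norm_shift_le)

lemma C0_shift: "1 \<le> p \<Longrightarrow> C0_semigroup p shift"
  by (rule contractive_C0_semigroupI)
    (auto simp: contractive_shift Lp_shift shift_add shift_scaleC shift_shift shift_continuous)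

section \<open>Primitives and the generator of the shift\<close>

text \<open>The graph of \<open>x powr p\<close> lies above its tangent at \<open>m\<close>. This is
  Young's inequality with exponents \<open>1 / p\<close> and \<open>1 - 1 / p\<close>, multiplied by
  \<open>p\<close>.\<close>

lemma powr_tangent_le:
  fixes x m p :: real
  assumes "1 \<le> p" "0 \<le> x" "0 < m"
  shows "m powr p + p * m powr (p - 1) * (x - m) \<le> x powr p"
proof (cases "x = 0")
  case True
  have "p * m powr (p - 1) * m = p * m powr p"
    using assms by (simp add: powr_diff)
  moreover have "1 * m powr p \<le> p * m powr p"
    using assms by (intro mult_right_mono) auto
  ultimately show ?thesis
    using True assms by (simp add: algebra_simps)
next
  case False
  have "(x powr p) powr (1 / p) * (m powr p) powr (1 - 1 / p) \<le> 1 / p * x powr p + (1 - 1 / p) * m powr p"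
    using assms False by (intro Youngs_inequality_0) auto
  moreover have "p * (1 - 1 / p) = p - 1"
    using assms by (simp add: field_simps)
  ultimately have "x * m powr (p - 1) \<le> 1 / p * x powr p + (1 - 1 / p) * m powr p"
    using assms False by (simp add: powr_powr)
  then have "p * (x * m powr (p - 1)) \<le> p * (1 / p * x powr p + (1 - 1 / p) * m powr p)"
    using assms by (intro mult_left_mono) auto
  also have "\<dots> = x powr p + (p - 1) * m powr p"
    using assms by (simp add: field_simps)
  finally show ?thesis
    using assms by (simp add: powr_diff field_simps)
qed

text \<open>The tangent inequality at the mean \<open>m\<close> of \<phi> is integrated over [0,h);
  the linear term then integrates to 0.\<close>

lemma powr_average_le:
  fixes \<phi> :: "real \<Rightarrow> real"
  assumes p: "1 \<le> p" and h: "0 < h" and nonneg: "\<And>s. 0 \<le> \<phi> s"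
    and i: "integrable lborel (\<lambda>s. indicator {0..<h} s * \<phi> s)"
    and ip: "integrable lborel (\<lambda>s. indicator {0..<h} s * \<phi> s powr p)"
  shows "(1 / h * (LINT s|lborel. indicator {0..<h} s * \<phi> s)) powr p
    \<le> 1 / h * (LINT s|lborel. indicator {0..<h} s * \<phi> s powr p)"
proof -
  define m where "m = 1 / h * (LINT s|lborel. indicator {0..<h} s * \<phi> s)"
  have "0 \<le> m"
    using h nonneg by (auto simp: m_def intro!: integral_nonneg_AE mult_nonneg_nonneg)
  show ?thesis
  proof (cases "m = 0")
    case True
    then show ?thesis
      using h nonneg p unfolding m_def by (auto intro!: integral_nonneg_AE mult_nonneg_nonneg)
  next
    case False
    with \<open>0 \<le> m\<close> have "0 < m" by simp
    have ic: "integrable lborel (\<lambda>s :: real. indicator {0..<h} s * c)" for c :: real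
      using h by (intro integrable_mult_left integrable_real_indicator) auto
    have "h * m powr p = (LINT (s::real)|lborel. indicator {0..<h} s * (m powr p - p * m powr (p - 1) * m))
        + p * m powr (p - 1) * (h * m)"
      using h by (simp add: algebra_simps)
    also have "h * m = (LINT s|lborel. indicator {0..<h} s * \<phi> s)"
      using h by (simp add: m_def)
    also have "(LINT s|lborel. indicator {0..<h} s * (m powr p - p * m powr (p - 1) * m))
        + p * m powr (p - 1) * (LINT s|lborel. indicator {0..<h} s * \<phi> s)
      = (LINT s|lborel. indicator {0..<h} s * (m powr p - p * m powr (p - 1) * m)
          + p * m powr (p - 1) * (indicator {0..<h} s * \<phi> s))"
      using ic i by (subst Bochner_Integration.integral_add) (auto simp del: integral_mult_left_zero)
    also have "\<dots> \<le> (LINT s|lborel. indicator {0..<h} s * \<phi> s powr p)"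
    proof (rule integral_mono[OF _ ip])
      show "integrable lborel (\<lambda>s. indicator {0..<h} s * (m powr p - p * m powr (p - 1) * m)
          + p * m powr (p - 1) * (indicator {0..<h} s * \<phi> s))"
        by (intro Bochner_Integration.integrable_add integrable_mult_right ic i)
      show "indicator {0..<h} s * (m powr p - p * m powr (p - 1) * m)
          + p * m powr (p - 1) * (indicator {0..<h} s * \<phi> s) \<le> indicator {0..<h} s * \<phi> s powr p" for s
        using powr_tangent_le[OF p nonneg[of s] \<open>0 < m\<close>] by (simp add: indicator_def right_diff_distrib)
    qed
    finally have "h * m powr p \<le> (LINT s|lborel. indicator {0..<h} s * \<phi> s powr p)" .
    then show ?thesis
      unfolding m_def[symmetric] using h by (simp add: field_simps)
  qed
qed

lemma nn_integral_Lp_norm: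
  assumes "1 \<le> p" "ae_class w \<in> Lp p" and [measurable]: "w \<in> borel_measurable unit_interval"
  shows "(\<integral>\<^sup>+ t. ennreal (norm (w t) powr p) \<partial>unit_interval) = ennreal (Lp_norm p (ae_class w) powr p)"
  using assms by (subst nn_integral_eq_integral)
    (auto simp: ae_class_in_Lp Lp_norm_ae_class powr_powr integral_nonneg_AE)

text \<open>Norm bounds are moved to nonnegative integrals so that the order of integration can be
  exchanged before integrability is known.\<close>

lemma Lp_norm_le_nn_integral:
  assumes p: "1 \<le> p" and [measurable]: "w \<in> borel_measurable unit_interval" and e: "0 \<le> e"
    and le: "(\<integral>\<^sup>+ t. ennreal (norm (w t) powr p) \<partial>unit_interval) \<le> ennreal (e powr p)"
  shows "Lp_norm p (ae_class w) \<le> e"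
proof -
  have "integrable unit_interval (\<lambda>t. norm (w t) powr p)"
    using le by (intro integrableI_bounded) (auto simp: le_less_trans)
  then have *: "ae_class w \<in> Lp p"
    by (simp add: ae_class_in_Lp)
  have "Lp_norm p (ae_class w) powr p \<le> e powr p"
    using le nn_integral_Lp_norm[OF p *] by (simp add: ennreal_le_iff)
  then show "Lp_norm p (ae_class w) \<le> e"
    using p e by (metis Lp_norm_nonneg powr_less_mono2 not_le less_le_trans zero_less_one)
qed

section \<open>Primitives and their difference quotients\<close>

text \<open>For \<open>u\<close> in \<open>zext\<close> this is the integral from 0 to
  \<open>t\<close>. Integrating over a half-line gives a value at every real \<open>t\<close>,
  namely 0 for \<open>t \<le> 0\<close>, so that primitives can be translated.\<close>

definition prim :: "(real \<Rightarrow> complex) \<Rightarrow> real \<Rightarrow> complex" where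
  "prim u t = (LINT s|lborel. indicator {..t} s *\<^sub>R u s)"

lemma zext_integrable:
  assumes "1 \<le> p" "u \<in> zext" "ae_class u \<in> Lp p"
  shows "integrable lborel u"
proof -
  have "ae_class u \<in> Lp 1"
    using Lp_subset_L1 assms by blast
  then have "integrable lborel (\<lambda>t. norm (u t) powr 1)"
    using Lp_lborel[OF assms(2)] by blast
  then have "integrable lborel (\<lambda>t. norm (u t))"
    by simp
  then show ?thesis
    using zext_measurable[OF assms(2)] by (subst (asm) integrable_norm_iff) auto
qed

lemma prim_integrable:
  fixes u :: "real \<Rightarrow> complex"
  shows "integrable lborel u \<Longrightarrow> integrable lborel (\<lambda>s. indicator {..t} s *\<^sub>R u s)"
  by (intro integrable_mult_indicator) auto

lemma prim_bound:
  assumes "integrable lborel u"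
  shows "norm (prim u t) \<le> (LINT s|lborel. norm (u s))"
proof -
  have "norm (prim u t) \<le> (LINT s|lborel. norm (indicator {..t} s *\<^sub>R u s))"
    unfolding prim_def by (rule integral_norm_bound)
  also have "\<dots> \<le> (LINT s|lborel. norm (u s))"
    by (intro integral_mono integrable_norm prim_integrable assms) (auto simp: indicator_def)
  finally show ?thesis .
qed

lemma prim_continuous:
  assumes "integrable lborel u"
  shows "continuous_on UNIV (prim u)"
  unfolding continuous_on_sequentially
proof safe
  fix X :: "nat \<Rightarrow> real" and t assume X: "X \<longlonglongrightarrow> t"
  have "(\<lambda>n. LINT s|lborel. indicator {..X n} s *\<^sub>R u s) \<longlonglongrightarrow> (LINT s|lborel. indicator {..t} s *\<^sub>R u s)"
  proof (rule integral_dominated_convergence[where w = "\<lambda>s. norm (u s)"])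
    \<comment> \<open>The indicators are eventually constant at every \<open>s\<close> except
      possibly \<open>s = t\<close>, a null set.\<close>
    show "AE s in lborel. (\<lambda>n. indicator {..X n} s *\<^sub>R u s) \<longlonglongrightarrow> indicator {..t} s *\<^sub>R u s"
      using AE_lborel_singleton[of t]
    proof eventually_elim
      case (elim s)
      have "\<forall>\<^sub>F n in sequentially. indicator {..X n} s = indicat_real {..t} s"
      proof (cases "s < t")
        case True
        then show ?thesis
          using order_tendstoD(1)[OF X True] by (auto elim: eventually_mono)
      next
        case False
        then show ?thesis
          using elim order_tendstoD(2)[OF X, of s] by (auto elim: eventually_mono simp: indicator_def)
      qed
      then show ?case
        by (intro tendsto_eventually) (auto elim: eventually_mono)
    qed
  qed (use assms in \<open>auto simp: indicator_def\<close>)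
  then show "(prim u \<circ> X) \<longlonglongrightarrow> prim u t"
    by (simp add: prim_def o_def)
qed

lemma prim_borel [measurable]: "integrable lborel u \<Longrightarrow> prim u \<in> borel_measurable borel"
  by (intro borel_measurable_continuous_onI prim_continuous)

lemma prim_nonpos:
  assumes "u \<in> zext" "t \<le> 0"
  shows "prim u t = 0"
proof -
  have "AE s in lborel. indicator {..t} s *\<^sub>R u s = 0"
    using AE_lborel_singleton[of 0]
    by eventually_elim (use assms zext_outside[OF assms(1)] in \<open>auto simp: indicator_def\<close>)
  then show ?thesis
    unfolding prim_def by (rule integral_eq_zero_AE)
qed

lemma Lp_bounded:
  assumes "1 \<le> p" and [measurable]: "w \<in> borel_measurable unit_interval"
    and "\<And>t. t \<in> {0..1} \<Longrightarrow> norm (w t) \<le> C"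
  shows "ae_class w \<in> Lp p"
proof -
  have one: "ae_class (\<lambda>_. 1) \<in> Lp p"
    using finite_measure.integrable_const[OF finite_measure_unit_interval, of "1::real"]
    by (simp add: ae_class_in_Lp)
  have "0 \<le> C"
    using assms(3)[of 0] order_trans[OF norm_ge_zero] by auto
  then show ?thesis
    using Lp_times_bounded(1)[OF assms(1) one, of C w] assms(3) by (simp add: ae_class_times)
qed

lemma Lp_prim: "1 \<le> p \<Longrightarrow> integrable lborel u \<Longrightarrow> ae_class (prim u) \<in> Lp p"
  by (rule Lp_bounded[where C = "LINT s|lborel. norm (u s)"])
    (auto intro: borel_measurable_unit_interval prim_bound)

text \<open>A primitive stays constant to the right of 1 and so need not be in \<open>zext\<close>.
  For \<open>h \<ge> 0\<close> the shift only looks to the left, where the primitive is 0 below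
  0.\<close>

lemma shift_prim:
  assumes u: "u \<in> zext" "integrable lborel u" and h: "0 \<le> h"
  shows "shift h (ae_class (prim u)) = ae_class (\<lambda>t. prim u (t - h))"
proof -
  note [measurable] = prim_borel[OF u(2)]
  define v where "v = (\<lambda>t. if t \<in> {0..1} then prim u t else 0)"
  have v: "v \<in> zext"
    by (auto simp: v_def zext_def)
  note [measurable] = zext_measurable[OF v]
  have "ae_class (prim u) = ae_class v"
    by (intro ae_class_eqI borel_measurable_unit_interval) (auto simp: v_def)
  then have "shift h (ae_class (prim u)) = ae_class (\<lambda>t. v (t - h))"
    using v by (simp add: shift_ae_class)
  also have "\<dots> = ae_class (\<lambda>t. prim u (t - h))"
    using h by (intro ae_class_eqI borel_measurable_unit_interval) (auto simp: v_def prim_nonpos[OF u(1)])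
  finally show ?thesis .
qed

text \<open>The reflection \<open>s \<mapsto> t - s\<close> turns the increment into an integral of
  backward translates of \<open>u\<close> over a window that does not depend on
  \<open>t\<close>.\<close>

lemma prim_diff:
  assumes u: "integrable lborel u" and h: "0 \<le> h"
  shows "prim u t - prim u (t - h) = (LINT s|lborel. indicator {0..<h} s *\<^sub>R u (t - s))"
proof -
  have "prim u t - prim u (t - h)
      = (LINT s|lborel. indicator {..t} s *\<^sub>R u s - indicator {..t - h} s *\<^sub>R u s)"
    unfolding prim_def using prim_integrable[OF u] by simp
  also have "\<dots> = (LINT s|lborel. indicator {t - h<..t} s *\<^sub>R u s)"
    using h by (intro Bochner_Integration.integral_cong) (auto simp: indicator_def)
  also have "\<dots> = (LINT s|lborel. indicator {t - h<..t} (t - s) *\<^sub>R u (t - s))"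
    using lborel_integral_real_affine[of "-1" "\<lambda>s. indicator {t - h<..t} s *\<^sub>R u s" t] by simp
  also have "\<dots> = (LINT s|lborel. indicator {0..<h} s *\<^sub>R u (t - s))"
    by (intro Bochner_Integration.integral_cong) (auto simp: indicator_def)
  finally show ?thesis .
qed

text \<open>The quotient minus \<open>u t\<close> is the average of \<open>u (t - s) - u t\<close>
  over [0,h), to which Jensen's inequality applies.\<close>

lemma prim_difference_quotient_le:
  assumes p: "1 \<le> p" and u: "u \<in> zext" "ae_class u \<in> Lp p" and h: "0 < h"
  shows "norm (complex_of_real (1 / h) * (prim u t - prim u (t - h)) - u t) powr p
    \<le> 1 / h * (LINT s|lborel. indicator {0..<h} s * norm (u (t - s) - u t) powr p)"
    and "integrable lborel (\<lambda>s. indicator {0..<h} s * norm (u (t - s) - u t) powr p)"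
proof -
  note int = zext_integrable[OF p u]
  note [measurable] = zext_measurable[OF u(1)]
  have reflect: "integrable lborel (\<lambda>s. f (t - s))" if "integrable lborel f"
    for f :: "real \<Rightarrow> 'a :: {banach, second_countable_topology}"
    using lborel_integrable_real_affine[OF that, of "-1" t] by simp
  have const: "integrable lborel (\<lambda>s :: real. indicator {0..<h} s *\<^sub>R c)" for c :: complex
    using h by (intro integrable_scaleR_left integrable_real_indicator) auto
  have i1: "integrable lborel (\<lambda>s. indicator {0..<h} s *\<^sub>R u (t - s))"
    by (intro integrable_mult_indicator reflect int) auto
  have i2: "integrable lborel (\<lambda>s. indicator {0..<h} s *\<^sub>R (u (t - s) - u t))"
    using Bochner_Integration.integrable_diff[OF i1 const[of "u t"]] by (simp add: scaleR_diff_right)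
  have i3: "integrable lborel (\<lambda>s. indicator {0..<h} s * norm (u (t - s) - u t))"
    using integrable_norm[OF i2] by simp
  have pow_ind: "norm (indicator A s *\<^sub>R z) powr p = indicator A s * norm z powr p"
    for A and s :: real and z :: complex
    using p by (auto simp: indicator_def)
  have "integrable lborel (\<lambda>s. norm (indicator {0..<h} s *\<^sub>R u (t - s) + indicator {0..<h} s *\<^sub>R (- u t)) powr p)"
  proof (rule Minkowski_powr(1)[OF p])
    have "integrable lborel (\<lambda>s. norm (u s) powr p)"
      using u Lp_lborel by blast
    then have "integrable lborel (\<lambda>s. indicator {0..<h} s *\<^sub>R norm (u (t - s)) powr p)"
      by (intro integrable_mult_indicator reflect[of "\<lambda>s. norm (u s) powr p"]) auto
    then show "integrable lborel (\<lambda>s. norm (indicator {0..<h} s *\<^sub>R u (t - s)) powr p)"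
      by (simp only: pow_ind real_scaleR_def)
    show "integrable lborel (\<lambda>s. norm (indicator {0..<h} s *\<^sub>R (- u t)) powr p)"
      unfolding pow_ind using h by (intro integrable_mult_left integrable_real_indicator) auto
  qed auto
  then have "integrable lborel (\<lambda>s. norm (indicator {0..<h} s *\<^sub>R (u (t - s) - u t)) powr p)"
    by (simp only: scaleR_add_right[symmetric] add_uminus_conv_diff)
  then show i4: "integrable lborel (\<lambda>s. indicator {0..<h} s * norm (u (t - s) - u t) powr p)"
    by (simp only: pow_ind)
  have "(LINT s|lborel. indicator {0..<h} s *\<^sub>R (u (t - s) - u t))
      = (LINT s|lborel. indicator {0..<h} s *\<^sub>R u (t - s)) - (LINT s|lborel. indicator {0..<h} s *\<^sub>R u t)"
    using Bochner_Integration.integral_diff[OF i1 const[of "u t"]] by (simp add: scaleR_diff_right)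
  also have "(LINT s|lborel. indicator {0..<h} s *\<^sub>R u t) = h *\<^sub>R u t"
    using h by (subst integral_scaleR_left) (auto intro!: integrable_real_indicator)
  finally have "complex_of_real (1 / h) * (prim u t - prim u (t - h)) - u t
      = complex_of_real (1 / h) * (LINT s|lborel. indicator {0..<h} s *\<^sub>R (u (t - s) - u t))"
    using h by (simp add: prim_diff[OF int] scaleR_conv_of_real right_diff_distrib)
  then have "norm (complex_of_real (1 / h) * (prim u t - prim u (t - h)) - u t)
      = 1 / h * norm (LINT s|lborel. indicator {0..<h} s *\<^sub>R (u (t - s) - u t))"
    using h by (simp add: norm_mult norm_divide)
  also have "\<dots> \<le> 1 / h * (LINT s|lborel. indicator {0..<h} s * norm (u (t - s) - u t))"
    using h integral_norm_bound[of lborel "\<lambda>s. indicator {0..<h} s *\<^sub>R (u (t - s) - u t)"]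
    by (intro mult_left_mono) (auto simp del: of_real_indicator)
  finally have "norm (complex_of_real (1 / h) * (prim u t - prim u (t - h)) - u t) powr p
     \<le> (1 / h * (LINT s|lborel. indicator {0..<h} s * norm (u (t - s) - u t))) powr p"
    using p by (intro powr_mono2) auto
  also have "\<dots> \<le> 1 / h * (LINT s|lborel. indicator {0..<h} s * norm (u (t - s) - u t) powr p)"
    by (rule powr_average_le[OF p h _ i3 i4]) simp
  finally show "norm (complex_of_real (1 / h) * (prim u t - prim u (t - h)) - u t) powr p
    \<le> 1 / h * (LINT s|lborel. indicator {0..<h} s * norm (u (t - s) - u t) powr p)" .
qed

text \<open>After integration in \<open>t\<close> and exchange of the integrals, the inner integral
  is the \<open>p\<close>-th power of the norm of \<open>shift s u - u\<close>. Its average over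
  [0,h) inherits the uniform bound.\<close>

lemma prim_difference_quotient_Lp_norm_le:
  assumes p: "1 \<le> p" and u: "u \<in> zext" "ae_class u \<in> Lp p" and h: "0 < h"
    and e: "0 \<le> e" "\<And>s. 0 \<le> s \<Longrightarrow> s < h \<Longrightarrow> Lp_norm p (shift s (ae_class u) - ae_class u) \<le> e"
  shows "Lp_norm p (complex_of_real (1 / h) *\<^sub>C (ae_class (prim u) - shift h (ae_class (prim u))) - ae_class u) \<le> e"
proof -
  note int = zext_integrable[OF p u]
  note [measurable] = zext_measurable[OF u(1)] prim_borel[OF int]
  let ?w = "\<lambda>t. complex_of_real (1 / h) * (prim u t - prim u (t - h)) - u t"
  let ?k = "\<lambda>t s. indicator {0..1} t * (ennreal (indicator {0..<h} s * norm (u (t - s) - u t) powr p))"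
  have eq: "complex_of_real (1 / h) *\<^sub>C (ae_class (prim u) - shift h (ae_class (prim u))) - ae_class u = ae_class ?w"
    using h by (simp add: shift_prim[OF u(1) int] ae_class_minus ae_class_scaleC borel_measurable_unit_interval)
  have inner: "(\<integral>\<^sup>+ t. indicator {0..1} t * ennreal (norm (u (t - s) - u t) powr p) \<partial>lborel) \<le> ennreal (e powr p)"
    if s: "0 \<le> s" "s < h" for s
  proof -
    have "(\<integral>\<^sup>+ t. indicator {0..1} t * ennreal (norm (u (t - s) - u t) powr p) \<partial>lborel)
        = (\<integral>\<^sup>+ t. ennreal (norm (u (t - s) - u t) powr p) \<partial>unit_interval)"
      by (subst nn_integral_restrict_space) (auto simp: mult.commute)
    also have "\<dots> = ennreal (Lp_norm p (ae_class (\<lambda>t. u (t - s) - u t)) powr p)"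
      using p Lp_diff[OF p Lp_shift[OF p u(2), of s] u(2)]
      by (intro nn_integral_Lp_norm borel_measurable_unit_interval)
        (auto simp: shift_ae_class u ae_class_minus borel_measurable_unit_interval)
    also have "\<dots> \<le> ennreal (e powr p)"
      using e(2)[OF s] p
      by (intro ennreal_leI powr_mono2) (auto simp: shift_ae_class u ae_class_minus borel_measurable_unit_interval)
    finally show ?thesis .
  qed
  have "(\<integral>\<^sup>+ t. ennreal (norm (?w t) powr p) \<partial>unit_interval)
      = (\<integral>\<^sup>+ t. indicator {0..1} t * ennreal (norm (?w t) powr p) \<partial>lborel)"
    by (subst nn_integral_restrict_space) (auto simp: mult.commute)
  also have "\<dots> \<le> (\<integral>\<^sup>+ t. ennreal (1 / h) * (\<integral>\<^sup>+ s. ?k t s \<partial>lborel) \<partial>lborel)"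
  proof (intro nn_integral_mono)
    fix t
    have "(\<integral>\<^sup>+ s. ennreal (indicator {0..<h} s * norm (u (t - s) - u t) powr p) \<partial>lborel)
      = ennreal (LINT s|lborel. indicator {0..<h} s * norm (u (t - s) - u t) powr p)"
      by (intro nn_integral_eq_integral prim_difference_quotient_le(2)[OF p u h]) auto
    then have "ennreal (norm (?w t) powr p)
        \<le> ennreal (1 / h) * (\<integral>\<^sup>+ s. ennreal (indicator {0..<h} s * norm (u (t - s) - u t) powr p) \<partial>lborel)"
      using prim_difference_quotient_le(1)[OF p u h, of t] h
      by (simp add: ennreal_mult[symmetric] integral_nonneg_AE ennreal_leI)
    then show "indicator {0..1} t * ennreal (norm (?w t) powr p) \<le> ennreal (1 / h) * (\<integral>\<^sup>+ s. ?k t s \<partial>lborel)"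
      by (auto simp: indicator_def)
  qed
  also have "\<dots> = ennreal (1 / h) * (\<integral>\<^sup>+ t. \<integral>\<^sup>+ s. ?k t s \<partial>lborel \<partial>lborel)"
    by (intro nn_integral_cmult) auto
  also have "\<dots> \<le> ennreal (1 / h) * (ennreal h * ennreal (e powr p))"
  proof (intro mult_left_mono)
    have "(\<integral>\<^sup>+ t. \<integral>\<^sup>+ s. ?k t s \<partial>lborel \<partial>lborel) = (\<integral>\<^sup>+ s. \<integral>\<^sup>+ t. ?k t s \<partial>lborel \<partial>lborel)"
      by (rule lborel_pair.Fubini'[symmetric]) simp
    also have "\<dots> \<le> (\<integral>\<^sup>+ s. indicator {0..<h} s * ennreal (e powr p) \<partial>lborel)"
    proof (intro nn_integral_mono)
      fix s
      show "(\<integral>\<^sup>+ t. ?k t s \<partial>lborel) \<le> indicator {0..<h} s * ennreal (e powr p)"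
        using inner[of s] by (cases "0 \<le> s \<and> s < h") (auto simp: indicator_def[of "{0..<h}"])
    qed
    also have "\<dots> = ennreal h * ennreal (e powr p)"
      using h by (subst nn_integral_multc) auto
    finally show "(\<integral>\<^sup>+ t. \<integral>\<^sup>+ s. ?k t s \<partial>lborel \<partial>lborel) \<le> ennreal h * ennreal (e powr p)" .
  qed simp
  also have "\<dots> = ennreal (e powr p)"
    using h by (simp add: mult.assoc[symmetric] ennreal_mult[symmetric])
  finally have "(\<integral>\<^sup>+ t. ennreal (norm (?w t) powr p) \<partial>unit_interval) \<le> ennreal (e powr p)" .
  then show ?thesis
    unfolding eq by (intro Lp_norm_le_nn_integral p e(1) borel_measurable_unit_interval) auto
qed

lemma prim_difference_quotient_tendsto:
  assumes p: "1 \<le> p" and u: "u \<in> zext" "ae_class u \<in> Lp p"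
  shows "((\<lambda>h. Lp_norm p (complex_of_real (1 / h) *\<^sub>C (ae_class (prim u) - shift h (ae_class (prim u))) - ae_class u))
      \<longlongrightarrow> 0) (at_right 0)"
proof (rule tendstoI)
  fix e :: real assume "e > 0"
  then have "\<forall>\<^sub>F h in at_right 0. Lp_norm p (shift h (ae_class u) - ae_class u) < e / 2"
    using shift_continuous[OF p u(2)] by (intro order_tendstoD(2)) auto
  then obtain d where d: "0 < d" "\<And>h. 0 < h \<Longrightarrow> h < d \<Longrightarrow> Lp_norm p (shift h (ae_class u) - ae_class u) < e / 2"
    unfolding eventually_at_right_field by blast
  \<comment> \<open>The limit says nothing about \<open>s = 0\<close>, where the difference is 0
    anyway.\<close>
  have small: "Lp_norm p (shift s (ae_class u) - ae_class u) \<le> e / 2" if "0 \<le> s" "s < d" for s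
    using d(2)[of s] that \<open>e > 0\<close> by (cases "s = 0") auto
  show "\<forall>\<^sub>F h in at_right 0. dist (Lp_norm p (complex_of_real (1 / h) *\<^sub>C
      (ae_class (prim u) - shift h (ae_class (prim u))) - ae_class u)) 0 < e"
    using eventually_at_right_0_less[OF d(1)]
  proof eventually_elim
    case (elim h)
    then have "Lp_norm p (complex_of_real (1 / h) *\<^sub>C
      (ae_class (prim u) - shift h (ae_class (prim u))) - ae_class u) \<le> e / 2"
      using \<open>e > 0\<close> by (intro prim_difference_quotient_Lp_norm_le[OF p u] small) auto
    then show ?case
      using \<open>e > 0\<close> by simp
  qed
qed

lemma prim_right_deriv:
  assumes p: "1 \<le> p" and u: "u \<in> zext" "ae_class u \<in> Lp p"
  shows "has_right_deriv0 p shift (ae_class (prim u)) (- ae_class u)"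
proof -
  have "complex_of_real (1 / h) *\<^sub>C (shift h f - f) - (- g)
      = - (complex_of_real (1 / h) *\<^sub>C (f - shift h f) - g)" for f g h
    by (simp add: scaleC_diff_right)
  then have "Lp_norm p (complex_of_real (1 / h) *\<^sub>C (shift h f - f) - (- g))
      = Lp_norm p (complex_of_real (1 / h) *\<^sub>C (f - shift h f) - g)" for f g h
    by (simp only: Lp_norm_minus[OF p])
  then show ?thesis
    using prim_difference_quotient_tendsto[OF assms] unfolding has_right_deriv0_def by (simp only:)
qed

text \<open>Subtracting a suitable primitive makes the right derivative vanish, so the difference is fixed by the
  nilpotent semigroup and hence is 0.\<close>

lemma shift_generator_imp_prim:
  assumes p: "1 \<le> p" and f: "f \<in> Lp p" "g \<in> Lp p" "has_right_deriv0 p shift f g"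
    and u: "u \<in> zext" "- g = ae_class u"
  shows "f = ae_class (prim u)"
proof -
  have uL: "ae_class u \<in> Lp p"
    using f(2) by (simp add: u(2)[symmetric] Lp_uminus)
  have P: "ae_class (prim u) \<in> Lp p"
    using Lp_prim[OF p zext_integrable[OF p u(1) uL]] .
  have "has_right_deriv0 p shift (f - ae_class (prim u)) (g - (- ae_class u))"
    by (intro has_right_deriv0_diff[OF p C0_shift[OF p]] f P Lp_uminus uL prim_right_deriv[OF p u(1) uL])
  then have "has_right_deriv0 p shift (f - ae_class (prim u)) 0"
    by (simp flip: u(2))
  \<comment> \<open>Any time above 1 would serve.\<close>
  then have "shift 2 (f - ae_class (prim u)) = f - ae_class (prim u)"
    by (intro has_right_deriv0_zero_imp_fixed[OF p C0_shift[OF p] contractive_shift[OF p]] Lp_diff p f P) auto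
  then show ?thesis
    by (simp add: shift_eq_0)
qed

text \<open>The approximants are the difference quotients of the primitive of \<open>f\<close>: they
  converge to \<open>f\<close>, and they are in the domain because the primitive is and the domain
  is shift-invariant.\<close>

lemma shift_generator_dense:
  assumes p: "1 \<le> p" and f: "f \<in> Lp p" and e: "0 < e"
  shows "\<exists>v\<in>{f \<in> Lp p. \<exists>g\<in>Lp p. has_right_deriv0 p shift f g}. Lp_norm p (f - v) < e"
proof -
  obtain u where u: "u \<in> zext" "f = ae_class u"
    by (rule zext_cases)
  have uL: "ae_class u \<in> Lp p"
    using f u by simp
  define P where "P = ae_class (prim u)"
  have P: "P \<in> Lp p" "has_right_deriv0 p shift P (- f)"
    using Lp_prim[OF p zext_integrable[OF p u(1) uL]] prim_right_deriv[OF p u(1) uL] u by (auto simp: P_def)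
  have "\<forall>\<^sub>F h in at_right 0. Lp_norm p (complex_of_real (1 / h) *\<^sub>C (P - shift h P) - f) < e"
    using prim_difference_quotient_tendsto[OF p u(1) uL] e unfolding P_def u(2)
    by (intro order_tendstoD(2)) auto
  then have "\<forall>\<^sub>F h in at_right 0. Lp_norm p (complex_of_real (1 / h) *\<^sub>C (P - shift h P) - f) < e \<and> 0 < h"
    using eventually_at_right_0_less[OF zero_less_one] by eventually_elim auto
  then obtain h where h: "0 < h" "Lp_norm p (complex_of_real (1 / h) *\<^sub>C (P - shift h P) - f) < e"
    using eventually_happens'[OF trivial_limit_at_right_real] by blast
  define c where "c = complex_of_real (1 / h)"
  have S: "C0_semigroup p shift"
    by (rule C0_shift[OF p])
  have "has_right_deriv0 p shift (P - shift h P) (- f - shift h (- f))"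
    using h p P f by (intro has_right_deriv0_diff[OF p S] has_right_deriv0_invariant[OF p S] Lp_shift Lp_uminus) auto
  then have "has_right_deriv0 p shift (c *\<^sub>C (P - shift h P)) (c *\<^sub>C (- f - shift h (- f)))"
    using p P by (intro has_right_deriv0_scaleC[OF p S] Lp_diff Lp_shift)
  moreover have "c *\<^sub>C (- f - shift h (- f)) \<in> Lp p" "c *\<^sub>C (P - shift h P) \<in> Lp p"
    using p P f by (auto intro!: Lp_scaleC Lp_diff Lp_shift Lp_uminus)
  ultimately show ?thesis
    using h(2) Lp_norm_minus_commute[OF p, of f "c *\<^sub>C (P - shift h P)"]
    by (intro bexI[of _ "c *\<^sub>C (P - shift h P)"]) (auto simp: c_def)
qed

section \<open>Weak derivatives and the domain of \<open>D\<^sub>0\<close>\<close>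

lemma continuous_borel_unit_interval:
  "continuous_on {0..1} F \<Longrightarrow> F \<in> borel_measurable unit_interval"
  using borel_measurable_continuous_on_restrict[of "{0..1}" F]
  by (simp cong: measurable_cong_sets add: sets_restrict_space)

lemma continuous_integrable_unit_interval:
  fixes F :: "real \<Rightarrow> complex"
  shows "continuous_on {0..1} F \<Longrightarrow> integrable unit_interval F"
  using borel_integrable_atLeastAtMost'[of 0 1 F]
  by (simp add: integrable_unit_interval set_integrable_def)

section \<open>Test functions and integration by parts for primitives\<close>

lemma has_weak_deriv_ae_class:
  "u \<in> borel_measurable unit_interval \<Longrightarrow> v \<in> borel_measurable unit_interval \<Longrightarrow>
    has_weak_deriv (ae_class u) (ae_class v) \<longleftrightarrow> (\<forall>\<phi>. test_fun \<phi> \<longrightarrow>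
        (LINT t|unit_interval. u t * complex_of_real (deriv \<phi> t)) =
        - (LINT t|unit_interval. v t * complex_of_real (\<phi> t)))"
  by (intro has_weak_deriv.abs_eq ae_rel_self)

lemma test_fun_deriv:
  assumes "test_fun \<phi>"
  shows "(\<phi> has_real_derivative deriv \<phi> t) (at t)"
  using assms by (auto simp: test_fun_def C1_differentiable_on_eq DERIV_deriv_iff_real_differentiable differentiable_on_def)

lemma test_fun_boundary:
  assumes "test_fun \<phi>"
  shows "\<phi> 0 = 0" "\<phi> 1 = 0"
  using assms closure_subset[of "{t. \<phi> t \<noteq> 0}"] by (auto simp: test_fun_def)

lemma integrable_times_test_fun:
  assumes g: "integrable unit_interval g" and \<psi>: "continuous_on {0..1} \<psi>"
  shows "integrable unit_interval (\<lambda>t. g t * complex_of_real (\<psi> t))"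
proof -
  have "\<exists>C. \<forall>t\<in>{0..1}. \<bar>\<psi> t\<bar> \<le> C"
    using compact_imp_bounded[OF compact_continuous_image[OF \<psi> compact_Icc]]
    unfolding bounded_iff by auto
  then obtain C where C: "\<And>t. t \<in> {0..1} \<Longrightarrow> \<bar>\<psi> t\<bar> \<le> C"
    by blast
  show ?thesis
  proof (rule Bochner_Integration.integrable_bound)
    show "integrable unit_interval (\<lambda>t. C * norm (g t))"
      using g by auto
    show "AE t in unit_interval. norm (g t * complex_of_real (\<psi> t)) \<le> norm (C * norm (g t))"
      using mult_mono[OF C order_refl]
      by (intro AE_I2) (auto simp: norm_mult space_restrict_space mult.commute[of "norm _"]
          intro!: order_trans[OF _ abs_ge_self] mult_right_mono C)
    have "(\<lambda>t. complex_of_real (\<psi> t)) \<in> borel_measurable unit_interval"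
      using \<psi> by (intro continuous_borel_unit_interval continuous_on_of_real)
    then show "(\<lambda>t. g t * complex_of_real (\<psi> t)) \<in> borel_measurable unit_interval"
      using g by auto
  qed
qed

text \<open>Integration by parts through Fubini on the triangle \<open>s \<le> t\<close>:
  integrating \<open>deriv \<phi>\<close> over [s,1] first leaves \<open>- \<phi> s\<close>, because
  \<open>\<phi> 1 = 0\<close>.\<close>

lemma has_weak_deriv_prim:
  assumes u: "u \<in> zext" "integrable lborel u"
  shows "has_weak_deriv (ae_class (prim u)) (ae_class u)"
proof -
  note [measurable] = zext_measurable[OF u(1)] prim_borel[OF u(2)]
  have "(LINT t|unit_interval. prim u t * complex_of_real (deriv \<phi> t))
      = - (LINT t|unit_interval. u t * complex_of_real (\<phi> t))" if \<phi>: "test_fun \<phi>" for \<phi>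
  proof -
    have cont: "continuous_on {0..1} (deriv \<phi>)"
      using test_fun_continuous(2)[OF \<phi>] continuous_on_subset by blast
    define a where "a t = indicat_real {0..1} t *\<^sub>R complex_of_real (deriv \<phi> t)" for t
    have ia: "integrable lborel a"
      using borel_integrable_atLeastAtMost'[of 0 1 "\<lambda>t. complex_of_real (deriv \<phi> t)"] cont
      unfolding a_def set_integrable_def by (auto intro: continuous_on_of_real)
    then have [measurable]: "a \<in> borel_measurable borel"
      by auto
    define k where "k t s = a t * (indicat_real {..t} s *\<^sub>R u s)" for t s
    have k_eq: "k t s = (if s \<le> t then a t * u s else 0)" for t s
      by (auto simp: k_def indicator_def)
    have [measurable]: "case_prod k \<in> borel_measurable (lborel \<Otimes>\<^sub>M lborel)"
      unfolding k_eq by measurable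
    have ik: "integrable lborel (k t)" for t
      unfolding k_def by (intro integrable_mult_right prim_integrable u)
    have "integrable (lborel \<Otimes>\<^sub>M lborel) (case_prod k)"
    proof (rule lborel_pair.Fubini_integrable)
      show "integrable lborel (\<lambda>t. LINT s|lborel. norm (case_prod k (t, s)))"
      proof (rule Bochner_Integration.integrable_bound[OF integrable_mult_left[OF integrable_norm[OF ia]]])
        show "AE t in lborel. norm (LINT s|lborel. norm (case_prod k (t, s)))
            \<le> norm (norm (a t) * (LINT s|lborel. norm (u s)))"
        proof (rule AE_I2)
          fix t
          have "(LINT s|lborel. norm (k t s)) \<le> (LINT s|lborel. norm (a t) * norm (u s))"
            by (intro integral_mono integrable_norm ik integrable_mult_right u) (auto simp: k_eq norm_mult)
          then show "norm (LINT s|lborel. norm (case_prod k (t, s)))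
              \<le> norm (norm (a t) * (LINT s|lborel. norm (u s)))"
            by (auto simp: integral_nonneg_AE intro: order_trans[OF _ abs_ge_self])
        qed
      qed measurable
    qed (use ik in auto)
    then have swap: "(LINT s|lborel. LINT t|lborel. k t s) = (LINT t|lborel. LINT s|lborel. k t s)"
      by (rule lborel_pair.Fubini_integral)
    have "(LINT s|lborel. k t s) = a t * prim u t" for t
      unfolding k_def prim_def by (rule integral_mult_right_zero)
    then have "(LINT t|unit_interval. prim u t * complex_of_real (deriv \<phi> t)) = (LINT t|lborel. LINT s|lborel. k t s)"
      unfolding integral_unit_interval
      by (intro Bochner_Integration.integral_cong) (simp_all add: a_def)
    also have "\<dots> = (LINT s|lborel. - (u s * complex_of_real (\<phi> s)))"
      unfolding swap[symmetric]
    proof (intro Bochner_Integration.integral_cong refl)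
      fix s
      show "(LINT t|lborel. k t s) = - (u s * complex_of_real (\<phi> s))"
      proof (cases "s \<in> {0..1}")
        case False
        then show ?thesis
          by (simp add: k_def zext_outside[OF u(1)])
      next
        case True
        have "(LINT t|lborel. k t s) = (LINT t|lborel. (indicator {s..1} t *\<^sub>R complex_of_real (deriv \<phi> t)) * u s)"
          using True by (intro Bochner_Integration.integral_cong) (auto simp: k_def a_def indicator_def)
        also have "\<dots> = (LINT t|lborel. indicator {s..1} t *\<^sub>R complex_of_real (deriv \<phi> t)) * u s"
          by (rule integral_mult_left_zero)
        also have "(LINT t|lborel. indicator {s..1} t *\<^sub>R complex_of_real (deriv \<phi> t))
            = complex_of_real (\<phi> 1) - complex_of_real (\<phi> s)"
        proof (rule integral_FTC_atLeastAtMost)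
          show "((\<lambda>x. complex_of_real (\<phi> x)) has_vector_derivative complex_of_real (deriv \<phi> x)) (at x within {s..1})" for x
            by (intro has_vector_derivative_of_real has_vector_derivative_at_within)
               (use test_fun_deriv[OF \<phi>, of x] in \<open>simp add: has_real_derivative_iff_has_vector_derivative\<close>)
          show "continuous_on {s..1} (\<lambda>x. complex_of_real (deriv \<phi> x))"
            using cont True by (intro continuous_on_of_real) (auto elim: continuous_on_subset)
        qed (use True in auto)
        finally show ?thesis
          using test_fun_boundary[OF \<phi>] by simp
      qed
    qed
    also have "\<dots> = - (LINT t|unit_interval. u t * complex_of_real (\<phi> t))"
      unfolding integral_unit_interval using zext_outside[OF u(1)]
      by (subst integral_minus[symmetric]) (intro Bochner_Integration.integral_cong, auto simp: indicator_def)
    finally show ?thesis .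
  qed
  then show ?thesis
    by (subst has_weak_deriv_ae_class) (auto intro!: borel_measurable_unit_interval)
qed

section \<open>Smooth steps and the du Bois-Reymond lemma\<close>

text \<open>A \<open>C\<^sup>1\<close> step from 0 to 1 across \<open>[-r, r]\<close>; its derivative \<open>bump r\<close> is a tent of integral 1.\<close>

definition step :: "real \<Rightarrow> real \<Rightarrow> real" where
  "step r t = ((max 0 (t + r))\<^sup>2 - 2 * (max 0 t)\<^sup>2 + (max 0 (t - r))\<^sup>2) / (2 * r\<^sup>2)"

definition bump :: "real \<Rightarrow> real \<Rightarrow> real" where
  "bump r t = (max 0 (t + r) - 2 * max 0 t + max 0 (t - r)) / r\<^sup>2"

lemma has_real_derivative_max_square:
  "((\<lambda>t. (max 0 t)\<^sup>2) has_real_derivative 2 * max 0 t) (at (t :: real))"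
proof -
  consider "t < 0" | "t = 0" | "t > 0" by linarith
  then show ?thesis
  proof cases
    case 1
    have "((\<lambda>t. 0) has_real_derivative 2 * max 0 t) (at t)"
      using 1 by simp
    then show ?thesis
      by (rule has_field_derivative_transform_within_open[where S = "{..<0}"]) (use 1 in auto)
  next
    case 2
    \<comment> \<open>At the kink of \<open>max 0 t\<close> the quotient of the square is bounded by
      \<open>\<bar>h\<bar>\<close>.\<close>
    have "(\<lambda>h. (max 0 h)\<^sup>2 / h) \<midarrow>0\<rightarrow> (0 :: real)"
    proof (rule Lim_null_comparison[OF always_eventually])
      show "\<forall>h. norm ((max 0 h)\<^sup>2 / h) \<le> \<bar>h\<bar>" for h :: real
        by (auto simp: max_def power2_eq_square)
    qed (auto intro!: tendsto_eq_intros)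
    then show ?thesis
      by (simp add: 2 DERIV_def)
  next
    case 3
    have "((\<lambda>t. t\<^sup>2) has_real_derivative 2 * max 0 t) (at t)"
      using 3 by (auto intro!: derivative_eq_intros)
    then show ?thesis
      by (rule has_field_derivative_transform_within_open[where S = "{0<..}"]) (use 3 in auto)
  qed
qed

lemma has_real_derivative_step:
  assumes "0 < r"
  shows "(step r has_real_derivative bump r t) (at t)"
proof -
  have sq: "((\<lambda>t. (max 0 (t + c))\<^sup>2) has_real_derivative 2 * max 0 (t + c)) (at t)" for c
  proof -
    have "((\<lambda>t. (max 0 (t + c))\<^sup>2) has_real_derivative 2 * max 0 (t + c) * 1) (at t)"
      by (rule DERIV_chain2[OF has_real_derivative_max_square]) (auto intro!: derivative_eq_intros)
    then show ?thesis
      by simp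
  qed
  have "((\<lambda>t. ((max 0 (t + r))\<^sup>2 - 2 * (max 0 (t + 0))\<^sup>2 + (max 0 (t + (- r)))\<^sup>2) / (2 * r\<^sup>2)) has_real_derivative
      (2 * max 0 (t + r) - 2 * (2 * max 0 (t + 0)) + 2 * max 0 (t + (- r))) / (2 * r\<^sup>2)) (at t)"
    by (intro DERIV_cdivide DERIV_add DERIV_diff DERIV_cmult sq)
  moreover have "(2 * max 0 (t + r) - 2 * (2 * max 0 (t + 0)) + 2 * max 0 (t + (- r))) / (2 * r\<^sup>2) = bump r t"
    using assms unfolding bump_def by (simp add: field_simps)
  ultimately show ?thesis
    by (simp add: step_def[abs_def])
qed

lemma continuous_bump: "continuous_on S (bump r)"
  unfolding bump_def[abs_def] divide_inverse by (intro continuous_intros)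

lemma step_left: "0 < r \<Longrightarrow> t \<le> - r \<Longrightarrow> step r t = 0"
  by (simp add: step_def max_absorb1)

lemma step_right: "0 < r \<Longrightarrow> r \<le> t \<Longrightarrow> step r t = 1"
  by (simp add: step_def max_absorb2 field_simps power2_eq_square)

lemma bump_outside: "0 < r \<Longrightarrow> r \<le> \<bar>t\<bar> \<Longrightarrow> bump r t = 0"
  by (cases "0 \<le> t") (simp_all add: bump_def max_absorb1 max_absorb2)

lemma bump_nonneg: "0 < r \<Longrightarrow> 0 \<le> bump r t"
  unfolding bump_def by (intro divide_nonneg_nonneg) (auto simp: max_def)

text \<open>The translated bump is a probability density supported in [x - r, x + r], which lies
  inside the interval, so the integral is an average of values of \<open>F\<close> close to
  \<open>F x\<close>.\<close>

lemma integral_times_bump_near: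
  fixes F :: "real \<Rightarrow> complex"
  assumes F: "continuous_on {0..1} F" and x: "0 < r" "r \<le> x" "x \<le> 1 - r"
    and e: "\<And>t. t \<in> {0..1} \<Longrightarrow> \<bar>t - x\<bar> \<le> r \<Longrightarrow> norm (F t - F x) \<le> e"
  shows "norm ((LINT t|unit_interval. F t * complex_of_real (bump r (t - x))) - F x) \<le> e"
proof -
  have cb: "continuous_on {0..1} (\<lambda>t. bump r (t - x))"
    by (intro continuous_on_compose2[OF continuous_bump[of UNIV]] continuous_intros) auto
  have ib: "integrable unit_interval (\<lambda>t. bump r (t - x))"
    using borel_integrable_atLeastAtMost'[OF cb] by (simp add: integrable_unit_interval set_integrable_def)
  have iFb: "integrable unit_interval (\<lambda>t. G t * complex_of_real (bump r (t - x)))"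
    if "continuous_on {0..1} G" for G
    by (rule integrable_times_test_fun[OF continuous_integrable_unit_interval[OF that] cb])
  have "(LINT t|lborel. indicator {0..1} t *\<^sub>R bump r (t - x)) = step r (1 - x) - step r (0 - x)"
  proof (rule integral_FTC_atLeastAtMost[where F = "\<lambda>t. step r (t - x)"])
    show "((\<lambda>t. step r (t - x)) has_vector_derivative bump r (t - x)) (at t within {0..1})" for t
    proof -
      have "((\<lambda>t. step r (t - x)) has_real_derivative bump r (t - x) * 1) (at t within {0..1})"
        by (intro DERIV_chain2[OF has_real_derivative_step[OF x(1)]]) (auto intro!: derivative_eq_intros)
      then show ?thesis
        by (simp add: has_real_derivative_iff_has_vector_derivative)
    qed
  qed (use cb in auto)
  then have one: "(LINT t|unit_interval. bump r (t - x)) = 1"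
    using x by (simp add: integral_unit_interval step_left step_right)
  have "(LINT t|unit_interval. F t * complex_of_real (bump r (t - x))) - F x
     = (LINT t|unit_interval. F t * complex_of_real (bump r (t - x)))
        - (LINT t|unit_interval. F x * complex_of_real (bump r (t - x)))"
    using one integral_complex_of_real[of unit_interval "\<lambda>t. bump r (t - x)"] by simp
  also have "\<dots> = (LINT t|unit_interval. (F t - F x) * complex_of_real (bump r (t - x)))"
    using iFb[OF F] iFb[of "\<lambda>_. F x"] by (simp add: left_diff_distrib)
  finally have "norm ((LINT t|unit_interval. F t * complex_of_real (bump r (t - x))) - F x)
      \<le> (LINT t|unit_interval. norm ((F t - F x) * complex_of_real (bump r (t - x))))"
    by (simp only: integral_norm_bound)
  also have "\<dots> \<le> (LINT t|unit_interval. e * bump r (t - x))"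
  proof (rule integral_mono)
    show "integrable unit_interval (\<lambda>t. norm ((F t - F x) * complex_of_real (bump r (t - x))))"
      by (intro integrable_norm iFb[of "\<lambda>t. F t - F x"] continuous_on_diff continuous_on_const F)
    show "integrable unit_interval (\<lambda>t. e * bump r (t - x))"
      using ib by simp
    fix t assume t: "t \<in> space unit_interval"
    show "norm ((F t - F x) * complex_of_real (bump r (t - x))) \<le> e * bump r (t - x)"
    proof (cases "\<bar>t - x\<bar> \<le> r")
      case True
      then show ?thesis
        using e[of t] t bump_nonneg[OF x(1)] by (auto simp: norm_mult space_restrict_space intro!: mult_right_mono)
    next
      case False
      then show ?thesis
        using bump_outside[OF x(1), of "t - x"] by simp
    qed
  qed
  also have "\<dots> = e"
    using one by simp
  finally show ?thesis .
qed

text \<open>A single step is not compactly supported, but two steps agree to the left of both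
  transitions (0) and to the right of both (1). Strict inequalities place the closed support in the
  open interval.\<close>

lemma test_fun_step_diff:
  assumes r: "0 < r" and x: "r < x" "x < 1 - r" and y: "r < y" "y < 1 - r"
  shows "test_fun (\<lambda>t. step r (t - x) - step r (t - y))"
    and "deriv (\<lambda>t. step r (t - x) - step r (t - y)) = (\<lambda>t. bump r (t - x) - bump r (t - y))"
proof -
  have "((\<lambda>t. step r (t - z)) has_real_derivative bump r (t - z) * 1) (at t)" for t z
    by (rule DERIV_chain2[OF has_real_derivative_step[OF r]]) (auto intro!: derivative_eq_intros)
  then have d: "((\<lambda>t. step r (t - x) - step r (t - y)) has_real_derivative bump r (t - x) - bump r (t - y)) (at t)" for t
    by (intro DERIV_diff) simp_all
  then show "deriv (\<lambda>t. step r (t - x) - step r (t - y)) = (\<lambda>t. bump r (t - x) - bump r (t - y))"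
    by (auto intro!: DERIV_imp_deriv)
  have "continuous_on UNIV (\<lambda>t. bump r (t - x) - bump r (t - y))"
    by (intro continuous_intros continuous_on_compose2[OF continuous_bump[of UNIV r]]) auto
  then have C1: "(\<lambda>t. step r (t - x) - step r (t - y)) C1_differentiable_on UNIV"
    using d unfolding C1_differentiable_on_def has_real_derivative_iff_has_vector_derivative
    by (intro exI[of _ "\<lambda>t. bump r (t - x) - bump r (t - y)"]) auto
  define a where "a = min x y - r"
  define b where "b = max x y + r"
  have "{t. step r (t - x) - step r (t - y) \<noteq> 0} \<subseteq> {a..b}"
  proof safe
    fix t assume ne: "step r (t - x) - step r (t - y) \<noteq> 0"
    show "t \<in> {a..b}"
    proof (rule ccontr)
      assume "t \<notin> {a..b}"
      then have "(t - x \<le> - r \<and> t - y \<le> - r) \<or> (r \<le> t - x \<and> r \<le> t - y)"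
        by (auto simp: a_def b_def)
      then show False
        using ne r step_left step_right by auto
    qed
  qed
  then have "closure {t. step r (t - x) - step r (t - y) \<noteq> 0} \<subseteq> {a..b}"
    by (intro closure_minimal) auto
  also have "{a..b} \<subseteq> {0<..<1}"
    using x y by (auto simp: a_def b_def)
  finally show "test_fun (\<lambda>t. step r (t - x) - step r (t - y))"
    using C1 by (simp add: test_fun_def)
qed

text \<open>Testing with the difference of two steps shows that \<open>F\<close> has equal local
  averages at \<open>x\<close> and \<open>y\<close>. As the width tends to 0 this gives
  \<open>F x = F y\<close> in the interior, and continuity adds the endpoints.\<close>

lemma du_Bois_Reymond:
  fixes F :: "real \<Rightarrow> complex"
  assumes F: "continuous_on {0..1} F"
    and 0: "\<And>\<phi>. test_fun \<phi> \<Longrightarrow> (LINT t|unit_interval. F t * complex_of_real (deriv \<phi> t)) = 0"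
    and t: "t \<in> {0..1}"
  shows "F t = F 0"
proof -
  have interior: "F x = F y" if x: "x \<in> {0<..<1}" and y: "y \<in> {0<..<1}" for x y
  proof -
    have "norm (F x - F y) \<le> 0 + e" if "e > 0" for e
    proof -
      obtain d where d: "d > 0" "\<And>s t. s \<in> {0..1} \<Longrightarrow> t \<in> {0..1} \<Longrightarrow> dist t s < d \<Longrightarrow> dist (F t) (F s) < e / 2"
        using uniformly_continuous_onE[OF compact_uniformly_continuous[OF F compact_Icc], of "e / 2"] \<open>e > 0\<close>
        by (metis half_gt_zero)
      \<comment> \<open>A width below this minimum keeps both bumps inside the interval and the
        oscillation of \<open>F\<close> on them below \<open>e / 2\<close>.\<close>
      have "0 < Min {d, x, y, 1 - x, 1 - y}"
        using d(1) x y by simp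
      then obtain r where r': "0 < r" "r < Min {d, x, y, 1 - x, 1 - y}"
        using dense by blast
      then have r: "0 < r" "r < d" "r < x" "x < 1 - r" "r < y" "y < 1 - r"
        by simp_all
      have near: "norm ((LINT t|unit_interval. F t * complex_of_real (bump r (t - z))) - F z) \<le> e / 2"
        if "r < z" "z < 1 - r" for z
        using that r(1,2) d(2)[of z]
        by (intro integral_times_bump_near[OF F]) (force simp: dist_norm intro: less_imp_le)+
      have iFb: "integrable unit_interval (\<lambda>t. F t * complex_of_real (bump r (t - z)))" for z
        by (intro integrable_times_test_fun[OF continuous_integrable_unit_interval[OF F]]
            continuous_on_compose2[OF continuous_bump[of UNIV]] continuous_intros) auto
      have "(LINT t|unit_interval. F t * complex_of_real (bump r (t - x) - bump r (t - y))) = 0"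
        using 0[OF test_fun_step_diff(1)[OF r(1,3-6)]] test_fun_step_diff(2)[OF r(1,3-6)] by simp
      then have "(LINT t|unit_interval. F t * complex_of_real (bump r (t - x)))
          = (LINT t|unit_interval. F t * complex_of_real (bump r (t - y)))"
        using iFb by (simp add: right_diff_distrib)
      then have "F x - F y = ((LINT t|unit_interval. F t * complex_of_real (bump r (t - y))) - F y)
          - ((LINT t|unit_interval. F t * complex_of_real (bump r (t - x))) - F x)"
        by simp
      also have "norm \<dots> \<le> e / 2 + e / 2"
        by (intro order_trans[OF norm_triangle_ineq4] add_mono near r)
      finally show ?thesis
        by simp
    qed
    then have "norm (F x - F y) \<le> 0"
      by (rule field_le_epsilon)
    then show ?thesis
      by simp
  qed
  have "F s = F (1 / 2)" if "s \<in> {0..1}" for s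
  proof (rule continuous_constant_on_closure[of "{0<..<1}" F])
    show "F x = F (1 / 2)" if "x \<in> {0<..<1}" for x
      by (rule interior) (use that in auto)
  qed (use F that in auto)
  from this[OF t] this[of 0] show ?thesis
    by simp
qed

section \<open>Uniqueness of weak derivatives; the domain of \<open>D0\<close> as a set of
  primitives\<close>

lemma Lp1_integrable:
  assumes "u \<in> borel_measurable unit_interval" "ae_class u \<in> Lp 1"
  shows "integrable unit_interval u"
  using assms by (simp add: ae_class_in_Lp integrable_norm_iff)

text \<open>\<open>F - prim u\<close> is continuous with weak derivative 0, hence constant; the
  boundary value \<open>F 0 = 0\<close> is what makes the constant 0.\<close>

lemma weak_deriv_eq_prim:
  assumes p: "1 \<le> p" and F: "continuous_on {0..1} F" "F 0 = 0"
    and u: "u \<in> zext" "ae_class u \<in> Lp p" and w: "has_weak_deriv (ae_class F) (ae_class u)"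
  shows "ae_class F = ae_class (prim u)"
proof -
  note int = zext_integrable[OF p u]
  note [measurable] = zext_measurable[OF u(1)] prim_borel[OF int] continuous_borel_unit_interval[OF F(1)]
  have P: "continuous_on {0..1} (prim u)"
    using prim_continuous[OF int] continuous_on_subset by blast
  have eq: "F t - prim u t = F 0 - prim u 0" if t: "t \<in> {0..1}" for t
  proof (rule du_Bois_Reymond[OF _ _ t])
    show "continuous_on {0..1} (\<lambda>t. F t - prim u t)"
      by (intro continuous_intros F P)
    fix \<phi> assume \<phi>: "test_fun \<phi>"
    have c: "continuous_on {0..1} (deriv \<phi>)"
      using test_fun_continuous(2)[OF \<phi>] continuous_on_subset by blast
    have "(LINT t|unit_interval. F t * complex_of_real (deriv \<phi> t))
       = (LINT t|unit_interval. prim u t * complex_of_real (deriv \<phi> t))"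
      using w has_weak_deriv_prim[OF u(1) int] \<phi>
      by (simp add: has_weak_deriv_ae_class borel_measurable_unit_interval)
    then show "(LINT t|unit_interval. (F t - prim u t) * complex_of_real (deriv \<phi> t)) = 0"
      using integrable_times_test_fun[OF continuous_integrable_unit_interval[OF F(1)] c]
        integrable_times_test_fun[OF continuous_integrable_unit_interval[OF P] c]
      by (simp add: left_diff_distrib)
  qed
  show ?thesis
    using eq F(2) prim_nonpos[OF u(1), of 0]
    by (intro ae_class_eqI continuous_borel_unit_interval F P AE_I2) auto
qed

text \<open>The class of the primitive of \<open>g\<close> is 0, yet its right derivative under the
  shift is \<open>- g\<close>. Since the shift fixes 0, the difference quotients vanish and
  \<open>g\<close> must be 0.\<close>

lemma weak_deriv_zero:
  assumes g: "g \<in> Lp 1" and w: "has_weak_deriv 0 g"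
  shows "g = 0"
proof -
  obtain u where u: "u \<in> zext" "g = ae_class u"
    by (rule zext_cases)
  have uL: "ae_class u \<in> Lp 1"
    using g u by simp
  have "ae_class (\<lambda>_. 0) = ae_class (prim u)"
    using w by (intro weak_deriv_eq_prim[of 1] u(1) uL) (auto simp: u zero_eq_ae_class)
  then have "has_right_deriv0 1 shift 0 (- g)"
    using prim_right_deriv[OF order_refl u(1) uL] by (simp add: zero_eq_ae_class u(2))
  moreover have "shift \<tau> 0 = 0" for \<tau>
    using shift_diff[of \<tau> 0 0] by simp
  ultimately have "((\<lambda>\<tau>. Lp_norm 1 g) \<longlongrightarrow> 0) (at_right (0 :: real))"
    by (simp add: has_right_deriv0_def)
  then have "Lp_norm 1 g = 0"
    by (simp add: tendsto_const_iff)
  then show ?thesis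
    using Lp_norm_eq_0D[OF order_refl g] by simp
qed

lemma weak_deriv_unique:
  assumes g: "g \<in> Lp 1" "has_weak_deriv f g" and h: "h \<in> Lp 1" "has_weak_deriv f h"
  shows "g = h"
proof -
  obtain a where a: "a \<in> zext" "f = ae_class a" by (rule zext_cases)
  obtain u where u: "u \<in> zext" "g = ae_class u" by (rule zext_cases)
  obtain v where v: "v \<in> zext" "h = ae_class v" by (rule zext_cases)
  note [measurable] = a(1)[THEN zext_measurable] u(1)[THEN zext_measurable] v(1)[THEN zext_measurable]
  have i: "integrable unit_interval u" "integrable unit_interval v"
    using g(1) h(1) unfolding u v by (auto intro!: Lp1_integrable borel_measurable_unit_interval)
  have "has_weak_deriv (ae_class (\<lambda>_. 0)) (ae_class (\<lambda>t. u t - v t))"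
  proof (subst has_weak_deriv_ae_class, goal_cases)
    case 3
    show ?case
    proof safe
      fix \<phi> assume \<phi>: "test_fun \<phi>"
      have c: "continuous_on {0..1} \<phi>"
        using test_fun_continuous(1)[OF \<phi>] continuous_on_subset by blast
      have "(LINT t|unit_interval. u t * complex_of_real (\<phi> t)) = (LINT t|unit_interval. v t * complex_of_real (\<phi> t))"
        using g(2) h(2) \<phi> unfolding a u v
        by (simp add: has_weak_deriv_ae_class borel_measurable_unit_interval)
      then show "(LINT t|unit_interval. 0 * complex_of_real (deriv \<phi> t))
          = - (LINT t|unit_interval. (u t - v t) * complex_of_real (\<phi> t))"
        using i[THEN integrable_times_test_fun, OF c] by (simp add: left_diff_distrib)
    qed
  qed (auto intro!: borel_measurable_unit_interval)
  then have "has_weak_deriv 0 (g - h)"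
    by (simp add: zero_eq_ae_class u v ae_class_minus borel_measurable_unit_interval)
  then have "g - h = 0"
    using g h by (intro weak_deriv_zero Lp_diff) auto
  then show ?thesis
    by simp
qed

lemma weak_deriv_prim:
  assumes u: "u \<in> zext" "ae_class u \<in> Lp 1"
  shows "weak_deriv (ae_class (prim u)) = ae_class u"
proof -
  have "has_weak_deriv (ae_class (prim u)) (ae_class u)"
    using has_weak_deriv_prim[OF u(1) zext_integrable[OF order_refl u]] .
  then show ?thesis
    unfolding weak_deriv_def using u(2) by (intro the_equality) (blast intro: weak_deriv_unique)+
qed

text \<open>From here on weak derivatives disappear: the comparison with the generator of the shift
  involves primitives only.\<close>

lemma dom_D0_eq:
  assumes p: "1 \<le> p"
  shows "dom_D0 p = {ae_class (prim u) |u. u \<in> zext \<and> ae_class u \<in> Lp p}"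
proof safe
  fix f assume "f \<in> dom_D0 p"
  then obtain g F where g: "g \<in> Lp p" "has_weak_deriv f g"
    and F: "continuous_on {0..1} F" "f = ae_class F" "F 0 = 0"
    by (auto simp: dom_D0_def W1p_def)
  obtain u where u: "u \<in> zext" "g = ae_class u"
    by (rule zext_cases)
  have "f = ae_class (prim u)"
    using weak_deriv_eq_prim[OF p F(1,3) u(1)] g unfolding F u by blast
  then show "\<exists>u. f = ae_class (prim u) \<and> u \<in> zext \<and> ae_class u \<in> Lp p"
    using u g by blast
next
  fix u assume u: "u \<in> zext" "ae_class u \<in> Lp p"
  note int = zext_integrable[OF p u]
  have "continuous_on {0..1} (prim u)"
    using prim_continuous[OF int] continuous_on_subset by blast
  then show "ae_class (prim u) \<in> dom_D0 p"
    using Lp_prim[OF p int] has_weak_deriv_prim[OF u(1) int] u(2) prim_nonpos[OF u(1), of 0]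
    by (auto simp: dom_D0_def W1p_def)
qed

lemma generated_shift:
  assumes p: "1 \<le> p"
  shows "generated_by_minus p (dom_D0 p) D0 shift"
proof -
  have prim: "ae_class (prim u) \<in> Lp p" "has_right_deriv0 p shift (ae_class (prim u)) (- ae_class u)"
    "D0 (ae_class (prim u)) = ae_class u"
    if u: "u \<in> zext" "ae_class u \<in> Lp p" for u
    using Lp_prim[OF p zext_integrable[OF p u]] prim_right_deriv[OF p u] weak_deriv_prim[OF u(1)]
      Lp_subset_L1[OF p] u by (auto simp: D0_def)
  have "dom_D0 p = {f \<in> Lp p. \<exists>g\<in>Lp p. has_right_deriv0 p shift f g}"
  proof safe
    fix f assume "f \<in> dom_D0 p"
    then obtain u where "u \<in> zext" "ae_class u \<in> Lp p" "f = ae_class (prim u)"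
      by (auto simp: dom_D0_eq[OF p])
    then show "f \<in> Lp p" "\<exists>g\<in>Lp p. has_right_deriv0 p shift f g"
      using prim Lp_uminus by blast+
  next
    fix f g assume fg: "f \<in> Lp p" "g \<in> Lp p" "has_right_deriv0 p shift f g"
    obtain u where u: "u \<in> zext" "- g = ae_class u"
      by (rule zext_cases)
    have "f = ae_class (prim u)"
      by (rule shift_generator_imp_prim[OF p fg u])
    moreover have "ae_class u \<in> Lp p"
      using fg(2) u(2) Lp_uminus by metis
    ultimately show "f \<in> dom_D0 p"
      using u(1) by (auto simp: dom_D0_eq[OF p])
  qed
  moreover have "D0 f \<in> Lp p \<and> has_right_deriv0 p shift f (- D0 f)" if "f \<in> dom_D0 p" for f
    using that prim by (auto simp: dom_D0_eq[OF p])
  ultimately show ?thesis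
    unfolding generated_by_minus_def using C0_shift[OF p] by blast
qed

lemma dom_D0_dense:
  assumes p: "1 \<le> p" and "f \<in> Lp p" "0 < e"
  shows "\<exists>g\<in>dom_D0 p. Lp_norm p (f - g) < e"
  using shift_generator_dense[OF assms] generated_by_minus_domain[OF generated_shift[OF p]] by simp

section \<open>Convergence of the product formula\<close>

text \<open>This commutation rule drives both the semigroup law of \<open>transport\<close> and the
  computation of the product formula.\<close>

lemma shift_times:
  assumes [measurable]: "w \<in> borel_measurable borel"
  shows "shift \<tau> (ae_class w * f) = ae_class (\<lambda>t. w (t - \<tau>)) * shift \<tau> f"
proof -
  obtain u where u: "u \<in> zext" "f = ae_class u"
    by (rule zext_cases)
  note [measurable] = zext_measurable[OF u(1)]
  have "(\<lambda>t. w t * u t) \<in> zext"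
    using u(1) by (auto simp: zext_def)
  then show ?thesis
    using u by (simp add: ae_class_times shift_ae_class borel_measurable_unit_interval)
qed

lemma times_ae_class_assoc:
  "v \<in> borel_measurable borel \<Longrightarrow> w \<in> borel_measurable borel \<Longrightarrow>
    ae_class v * (ae_class w * f) = ae_class (\<lambda>t. v t * w t) * f"
  by (simp add: ae_class_times borel_measurable_unit_interval flip: mult.assoc)

lemma one_times_ae_class [simp]: "ae_class (\<lambda>_. 1) * f = f"
  by (cases f rule: zext_cases) (simp add: ae_class_times borel_measurable_unit_interval zext_measurable)

text \<open>With \<open>w = (m \<tau> - 1) / \<tau> + q\<close>, the expression equals
  \<open>w * S \<tau> f - q * (S \<tau> f - f)\<close>: the first factor is uniformly small and the
  second term vanishes by strong continuity. It is applied with the shift for D_0 + Q and with the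
  identity semigroup for Q.\<close>

lemma weighted_perturbation:
  assumes p: "1 \<le> p" and S: "C0_semigroup p S" "contractive p S" and f: "f \<in> Lp p"
    and [measurable]: "\<And>\<tau>. m \<tau> \<in> borel_measurable unit_interval" "q \<in> borel_measurable unit_interval"
    and q: "0 \<le> R" "\<And>t. t \<in> {0..1} \<Longrightarrow> norm (q t) \<le> R"
    and unif: "\<And>e. 0 < e \<Longrightarrow> \<forall>\<^sub>F \<tau> in at_right 0. \<forall>t\<in>{0..1}. norm (complex_of_real (1 / \<tau>) * (m \<tau> t - 1) + q t) \<le> e"
  shows "((\<lambda>\<tau>. Lp_norm p (complex_of_real (1 / \<tau>) *\<^sub>C (ae_class (m \<tau>) * S \<tau> f - S \<tau> f) + ae_class q * f)) \<longlongrightarrow> 0)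
    (at_right 0)"
proof (rule tendsto_0_approx)
  fix e :: real assume "e > 0"
  define d where "d = e / (Lp_norm p f + 1)"
  have d: "0 < d" "d * Lp_norm p f \<le> e"
    using \<open>e > 0\<close> Lp_norm_nonneg[of p f] by (auto simp: d_def field_simps add_pos_nonneg add_nonneg_pos)
  let ?D = "\<lambda>\<tau>. complex_of_real (1 / \<tau>) *\<^sub>C (ae_class (m \<tau>) * S \<tau> f - S \<tau> f) + ae_class q * f"
  have "((\<lambda>\<tau>. Lp_norm p (S \<tau> f - S 0 f)) \<longlongrightarrow> 0) (at_right 0)"
    by (rule tendsto_within_subset[OF C0_cont[OF S(1) _ f]]) auto
  then have lim: "((\<lambda>\<tau>. R * Lp_norm p (S \<tau> f - f)) \<longlongrightarrow> 0) (at_right 0)"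
    by (intro tendsto_mult_right_zero) (simp add: C0_zero[OF S(1) f])
  have "\<forall>\<^sub>F \<tau> in at_right 0. \<bar>Lp_norm p (?D \<tau>)\<bar> \<le> R * Lp_norm p (S \<tau> f - f) + e"
    using unif[OF d(1)] eventually_at_right_0_less[OF zero_less_one]
  proof eventually_elim
    case (elim \<tau>)
    define w where "w = (\<lambda>t. complex_of_real (1 / \<tau>) * (m \<tau> t - 1) + q t)"
    have [measurable]: "w \<in> borel_measurable unit_interval"
      unfolding w_def by measurable
    have SL: "S \<tau> f \<in> Lp p"
      using C0_Lp[OF S(1) _ f] elim by simp
    have D: "?D \<tau> = ae_class w * S \<tau> f - ae_class q * (S \<tau> f - f)"
    proof -
      obtain u where u: "u \<in> zext" "S \<tau> f = ae_class u" by (rule zext_cases)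
      obtain v where v: "v \<in> zext" "f = ae_class v" by (rule zext_cases)
      note [measurable] = u(1)[THEN zext_measurable] v(1)[THEN zext_measurable]
      have "?D \<tau> = ae_class (\<lambda>t. complex_of_real (1 / \<tau>) * (m \<tau> t * u t - u t) + q t * v t)"
        unfolding u(2) unfolding v(2)
        by (simp add: ae_class_times ae_class_minus ae_class_plus ae_class_scaleC borel_measurable_unit_interval)
      also have "(\<lambda>t. complex_of_real (1 / \<tau>) * (m \<tau> t * u t - u t) + q t * v t)
          = (\<lambda>t. w t * u t - q t * (u t - v t))"
        by (auto simp: w_def algebra_simps)
      also have "ae_class \<dots> = ae_class w * S \<tau> f - ae_class q * (S \<tau> f - f)"
        unfolding u(2) unfolding v(2)
        by (simp add: ae_class_times ae_class_minus ae_class_plus ae_class_scaleC borel_measurable_unit_interval)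
      finally show ?thesis .
    qed
    have w: "ae_class w * S \<tau> f \<in> Lp p" "Lp_norm p (ae_class w * S \<tau> f) \<le> d * Lp_norm p (S \<tau> f)"
      using Lp_times_bounded[OF p SL, of d w] d(1) elim by (auto simp: w_def)
    have q': "ae_class q * (S \<tau> f - f) \<in> Lp p"
        "Lp_norm p (ae_class q * (S \<tau> f - f)) \<le> R * Lp_norm p (S \<tau> f - f)"
      using Lp_times_bounded[OF p Lp_diff[OF p SL f] q(1) _ q(2)] by auto
    have "d * Lp_norm p (S \<tau> f) \<le> d * Lp_norm p f"
      using contractiveD[OF S(2) _ f] elim d(1) by simp
    then show ?case
      unfolding D using Lp_norm_triangle_diff[OF p w(1) q'(1)] w(2) q'(2) d(2) by simp
  qed
  with lim show "\<exists>\<phi>. (\<phi> \<longlongrightarrow> 0) (at_right 0) \<and> (\<forall>\<^sub>F \<tau> in at_right 0. \<bar>Lp_norm p (?D \<tau>)\<bar> \<le> \<phi> \<tau> + e)"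
    by blast
qed

text \<open>The upper bound comes from
  \<open>exp (- a) \<le> 1 / (1 + a) = 1 - a + a\<^sup>2 / (1 + a)\<close>, the lower one from the
  tangent of the exponential at 0.\<close>

lemma exp_minus_second_order:
  fixes a :: real
  assumes "0 \<le> a"
  shows "\<bar>exp (- a) - 1 + a\<bar> \<le> a\<^sup>2"
proof -
  have "exp (- a) * (1 + a) \<le> exp (- a) * exp a"
    using exp_ge_add_one_self[of a] by (intro mult_left_mono) auto
  then have "exp (- a) * (1 + a) \<le> 1"
    by (simp flip: exp_add)
  then have "exp (- a) \<le> 1 / (1 + a)"
    using assms by (simp add: field_simps)
  also have "1 / (1 + a) = 1 - a + a\<^sup>2 / (1 + a)"
    using assms by (simp add: field_simps power2_eq_square)
  also have "a\<^sup>2 / (1 + a) \<le> a\<^sup>2 / 1"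
    using assms by (intro divide_left_mono) auto
  finally show ?thesis
    using exp_ge_add_one_self[of "- a"] by simp
qed

lemma exp_minus_lipschitz:
  fixes a b :: real
  assumes "0 \<le> a" "0 \<le> b"
  shows "\<bar>exp (- a) - exp (- b)\<bar> \<le> \<bar>a - b\<bar>"
proof -
  have *: "\<bar>exp (- a) - exp (- b)\<bar> \<le> \<bar>a - b\<bar>" if "0 \<le> a" "a \<le> b" for a b :: real
  proof -
    have "exp (- a) - exp (- b) = exp (- a) * (1 - exp (- (b - a)))"
      by (simp add: right_diff_distrib flip: exp_add)
    also have "\<dots> \<le> 1 * (b - a)"
    proof (intro mult_mono)
      show "1 - exp (- (b - a)) \<le> b - a"
        using exp_ge_add_one_self[of "- (b - a)"] by linarith
    qed (use that in auto)
    finally show ?thesis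
      using that by simp
  qed
  show ?thesis
    using *[of a b] *[of b a] assms by (cases "a \<le> b") (auto simp: abs_minus_commute)
qed

text \<open>\<open>a\<close> is the exponent accumulated during time \<tau>, \<open>R\<close> bounds
  its mean rate and \<open>x\<close> is the rate at the endpoint. The second-order term of the
  exponential contributes \<open>R\<^sup>2 * \<tau>\<close>, the deviation of the mean rate from
  \<open>x\<close> contributes \<open>e\<close>.\<close>

lemma exp_weight_difference_quotient:
  assumes "0 < \<tau>" "0 \<le> a" "a \<le> R * \<tau>" "\<bar>a - \<tau> * x\<bar> \<le> \<tau> * e"
  shows "norm (complex_of_real (1 / \<tau>) * (complex_of_real (exp (- a)) - 1) + complex_of_real x) \<le> R\<^sup>2 * \<tau> + e"
proof -
  have "complex_of_real (1 / \<tau>) * (complex_of_real (exp (- a)) - 1) + complex_of_real x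
      = complex_of_real (((exp (- a) - 1 + a) - (a - \<tau> * x)) / \<tau>)"
    using assms(1) by (simp add: field_simps)
  also have "norm \<dots> = \<bar>(exp (- a) - 1 + a) - (a - \<tau> * x)\<bar> / \<tau>"
    using assms(1) by (simp only: norm_of_real) simp
  also have "\<dots> \<le> ((R * \<tau>)\<^sup>2 + \<tau> * e) / \<tau>"
  proof (intro divide_right_mono)
    have "\<bar>exp (- a) - 1 + a\<bar> \<le> (R * \<tau>)\<^sup>2"
      using exp_minus_second_order[OF assms(2)] power_mono[OF assms(3,2), of 2] by simp
    then show "\<bar>(exp (- a) - 1 + a) - (a - \<tau> * x)\<bar> \<le> (R * \<tau>)\<^sup>2 + \<tau> * e"
      using assms(4) by linarith
  qed (use assms in auto)
  also have "\<dots> = R\<^sup>2 * \<tau> + e"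
    using assms(1) by (simp add: field_simps power2_eq_square)
  finally show ?thesis .
qed

text \<open>The interval starts at -1 because \<open>t - \<tau>\<close> ranges down to -1 for
  \<open>t\<close> and \<tau> in [0,1]. Freezing the values outside makes \<open>J\<close> monotone
  on the whole line, so exponents are nonnegative for all \<tau> \<ge> 0; inside, the mean value
  form replaces integral estimates.\<close>

lemma bounded_antiderivative:
  fixes r :: "real \<Rightarrow> real"
  assumes r: "continuous_on UNIV r" "\<And>t. 0 \<le> r t"
  obtains J where "continuous_on UNIV J" "mono J"
    "\<And>s t. -1 \<le> s \<Longrightarrow> s < t \<Longrightarrow> t \<le> 1 \<Longrightarrow> \<exists>\<xi>\<in>{s..t}. J t - J s = (t - s) * r \<xi>"
proof -
  obtain I where I: "\<And>t. t \<in> {-1..1} \<Longrightarrow> (I has_vector_derivative r t) (at t within {-1..1})"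
    using antiderivative_continuous[of "-1" 1 r] continuous_on_subset[OF r(1)] by blast
  have mvt: "\<exists>\<xi>\<in>{s..t}. I t - I s = (t - s) * r \<xi>" if st: "-1 \<le> s" "s < t" "t \<le> 1" for s t
  proof -
    have "\<exists>x\<in>{s<..<t}. I t - I s = (t - s) *\<^sub>R r x"
    proof (rule mvt_simple[OF st(2), of I "\<lambda>x h. h *\<^sub>R r x"])
      show "(I has_derivative (\<lambda>h. h *\<^sub>R r x)) (at x within {s..t})" if "s \<le> x" "x \<le> t" for x
        using has_vector_derivative_within_subset[OF I, of x "{s..t}"] st that
        by (auto simp: has_vector_derivative_def)
    qed
    then show ?thesis
      by force
  qed
  define J where "J t = I (max (-1) (min 1 t))" for t
  have contI: "continuous_on {-1..1} I"
    unfolding continuous_on_eq_continuous_within by (blast intro: has_vector_derivative_continuous I)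
  show thesis
  proof (rule that)
    show "continuous_on UNIV J"
      unfolding J_def by (intro continuous_on_compose2[OF contI] continuous_intros) auto
    show "mono J"
    proof (rule monoI)
      fix s t :: real assume "s \<le> t"
      then consider "max (-1) (min 1 s) = max (-1) (min 1 t)" | "max (-1) (min 1 s) < max (-1) (min 1 t)"
        by linarith
      then show "J s \<le> J t"
      proof cases
        case 2
        then have "\<exists>\<xi>\<in>{max (-1) (min 1 s)..max (-1) (min 1 t)}.
            J t - J s = (max (-1) (min 1 t) - max (-1) (min 1 s)) * r \<xi>"
          unfolding J_def by (intro mvt) auto
        then obtain \<xi> where "J t - J s = (max (-1) (min 1 t) - max (-1) (min 1 s)) * r \<xi>"
          by blast
        moreover have "\<dots> \<ge> 0"
          using 2 r(2) by (intro mult_nonneg_nonneg) auto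
        ultimately show ?thesis
          by linarith
      qed (simp add: J_def)
    qed
    show "\<exists>\<xi>\<in>{s..t}. J t - J s = (t - s) * r \<xi>" if "-1 \<le> s" "s < t" "t \<le> 1" for s t
      using mvt[OF that] that by (simp add: J_def)
  qed
qed

text \<open>\<open>r\<close> extends the potential to the real line by its boundary values, and \<open>J\<close> is an antiderivative
  of \<open>r\<close> on \<open>[-1, 1]\<close>, frozen outside: \<open>J t - J (t - \<tau>)\<close> is the integral of \<open>r\<close> over \<open>[t - \<tau>, t]\<close> whenever
  the transported function does not already vanish.\<close>

locale holder_potential =
  fixes p \<beta> K :: real and q :: "real \<Rightarrow> complex" and r J :: "real \<Rightarrow> real"
  assumes p: "1 \<le> p" and \<beta>: "0 < \<beta>" and K: "0 \<le> K"
    and r_cont: "continuous_on UNIV r" and r_nonneg: "\<And>t. 0 \<le> r t"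
    and r_holder: "\<And>x y. \<bar>r x - r y\<bar> \<le> K * \<bar>x - y\<bar> powr \<beta>"
    and q_r: "\<And>t. t \<in> {0..1} \<Longrightarrow> q t = complex_of_real (r t)"
    and J_cont: "continuous_on UNIV J" and J_mono: "mono J"
    and J_mvt: "\<And>s t. -1 \<le> s \<Longrightarrow> s < t \<Longrightarrow> t \<le> 1 \<Longrightarrow> \<exists>\<xi>\<in>{s..t}. J t - J s = (t - s) * r \<xi>"
begin

definition transport :: "real \<Rightarrow> ae_fun \<Rightarrow> ae_fun" where
  "transport \<tau> f = ae_class (\<lambda>t. complex_of_real (exp (- (J t - J (t - \<tau>))))) * shift \<tau> f"

definition damping :: "real \<Rightarrow> ae_fun \<Rightarrow> ae_fun" where
  "damping \<tau> f = ae_class (\<lambda>t. complex_of_real (exp (- (\<tau> * r t)))) * f"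

text \<open>By Hoelder continuity from 0, a bound for \<open>r\<close> on [-2,2], which contains
  every point \<open>t - \<tau>\<close> with \<open>t\<close> and \<tau> in [0,1].\<close>

definition R :: real where
  "R = r 0 + K * 2 powr \<beta>"

lemma R_nonneg: "0 \<le> R"
  using r_nonneg K by (simp add: R_def)

lemma r_le_R: "\<bar>t\<bar> \<le> 2 \<Longrightarrow> r t \<le> R"
proof -
  assume "\<bar>t\<bar> \<le> 2"
  then have "K * \<bar>t - 0\<bar> powr \<beta> \<le> K * 2 powr \<beta>"
    using K \<beta> by (intro mult_left_mono powr_mono2) auto
  then show ?thesis
    using r_holder[of t 0] by (simp add: R_def)
qed

lemma borel_r_J [measurable]: "r \<in> borel_measurable borel" "J \<in> borel_measurable borel"
  using r_cont J_cont by (auto intro: borel_measurable_continuous_onI)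

lemma q_measurable [measurable]: "q \<in> borel_measurable unit_interval"
proof -
  have "(\<lambda>t. complex_of_real (r t)) \<in> borel_measurable unit_interval"
    by (rule borel_measurable_unit_interval) simp
  then show ?thesis
    by (rule measurable_cong[THEN iffD1, rotated]) (simp add: q_r space_restrict_space)
qed

lemma q_bound: "t \<in> {0..1} \<Longrightarrow> norm (q t) \<le> R"
  using r_le_R[of t] r_nonneg[of t] by (simp add: q_r)

lemma J_increment_nonneg: "0 \<le> \<tau> \<Longrightarrow> 0 \<le> J t - J (t - \<tau>)"
  using monoD[OF J_mono, of "t - \<tau>" t] by simp

lemma mult_op_Lp: "f \<in> Lp p \<Longrightarrow> mult_op q f \<in> Lp p"
  unfolding mult_op_def by (rule Lp_times_bounded(1)[OF p _ R_nonneg _ q_bound]) auto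

lemma transport_Lp: "f \<in> Lp p \<Longrightarrow> 0 \<le> \<tau> \<Longrightarrow> transport \<tau> f \<in> Lp p"
  and contractive_transport: "contractive p transport"
proof -
  have *: "transport \<tau> f \<in> Lp p \<and> Lp_norm p (transport \<tau> f) \<le> Lp_norm p f" if "f \<in> Lp p" "0 \<le> \<tau>" for f \<tau>
  proof -
    have m: "(\<lambda>t. complex_of_real (exp (- (J t - J (t - \<tau>))))) \<in> borel_measurable unit_interval"
      by (rule borel_measurable_unit_interval) simp
    have "norm (complex_of_real (exp (- (J t - J (t - \<tau>))))) \<le> 1" for t
      using J_increment_nonneg[OF that(2), of t] by (simp add: norm_of_real del: of_real_exp)
    with Lp_times_bounded[OF p Lp_shift[OF p that(1), of \<tau>] zero_le_one m] Lp_norm_shift_le[OF p that(1), of \<tau>]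
    show ?thesis
      by (auto simp: transport_def)
  qed
  show "f \<in> Lp p \<Longrightarrow> 0 \<le> \<tau> \<Longrightarrow> transport \<tau> f \<in> Lp p"
    using * by blast
  show "contractive p transport"
    using * by (auto simp: contractive_def)
qed

text \<open>The exponent is \<open>\<tau> * r \<xi>\<close> with \<xi> within \<tau> of
  \<open>t\<close>, so it differs from \<open>\<tau> * r t\<close> by at most
  \<open>\<tau> * K * \<tau> powr \<beta>\<close>, uniformly in \<open>t\<close>.\<close>

lemma transport_perturbation:
  assumes f: "f \<in> Lp p"
  shows "((\<lambda>\<tau>. Lp_norm p (complex_of_real (1 / \<tau>) *\<^sub>C (transport \<tau> f - shift \<tau> f) + mult_op q f)) \<longlongrightarrow> 0) (at_right 0)"
  unfolding transport_def mult_op_def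
proof (rule weighted_perturbation[OF p C0_shift[OF p] contractive_shift[OF p] f _ q_measurable R_nonneg q_bound])
  fix e :: real assume "e > 0"
  have "((\<lambda>\<tau>. R\<^sup>2 * \<tau> + K * \<tau> powr \<beta>) \<longlongrightarrow> R\<^sup>2 * 0 + K * 0) (at_right 0)"
    using \<beta> by (intro tendsto_intros tendsto_zero_powrI[OF _ tendsto_const]) (auto simp: eventually_at_filter)
  then have "\<forall>\<^sub>F \<tau> in at_right 0. R\<^sup>2 * \<tau> + K * \<tau> powr \<beta> < e"
    using \<open>e > 0\<close> by (intro order_tendstoD(2)) auto
  then show "\<forall>\<^sub>F \<tau> in at_right 0. \<forall>t\<in>{0..1}. norm (complex_of_real (1 / \<tau>) *
      (complex_of_real (exp (- (J t - J (t - \<tau>)))) - 1) + q t) \<le> e"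
    using eventually_at_right_0_less[OF zero_less_one]
  proof eventually_elim
    case (elim \<tau>)
    show ?case
    proof
      fix t :: real assume t: "t \<in> {0..1}"
      obtain \<xi> where \<xi>: "\<xi> \<in> {t - \<tau>..t}" "J t - J (t - \<tau>) = \<tau> * r \<xi>"
        using J_mvt[of "t - \<tau>" t] elim t by auto
      have "\<bar>\<xi> - t\<bar> powr \<beta> \<le> \<tau> powr \<beta>"
        using \<xi>(1) \<beta> by (intro powr_mono2) auto
      then have holder: "\<bar>r \<xi> - r t\<bar> \<le> K * \<tau> powr \<beta>"
        using r_holder[of \<xi> t] K mult_left_mono by (meson order_trans)
      have "\<bar>\<xi>\<bar> \<le> 2"
        using \<xi>(1) elim t by auto
      then have "r \<xi> \<le> R"
        by (rule r_le_R)
      have "\<bar>J t - J (t - \<tau>) - \<tau> * r t\<bar> \<le> \<tau> * (K * \<tau> powr \<beta>)"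
        using elim holder unfolding \<xi>(2) by (simp add: abs_mult flip: right_diff_distrib)
      moreover have "J t - J (t - \<tau>) \<le> R * \<tau>"
        using \<open>r \<xi> \<le> R\<close> \<xi>(2) elim by (simp add: mult.commute)
      ultimately have "norm (complex_of_real (1 / \<tau>) * (complex_of_real (exp (- (J t - J (t - \<tau>)))) - 1)
          + complex_of_real (r t)) \<le> R\<^sup>2 * \<tau> + K * \<tau> powr \<beta>"
        using elim J_increment_nonneg[of \<tau> t] by (intro exp_weight_difference_quotient) auto
      then show "norm (complex_of_real (1 / \<tau>) * (complex_of_real (exp (- (J t - J (t - \<tau>)))) - 1) + q t) \<le> e"
        using elim(1) q_r[OF t] by simp
    qed
  qed
qed (auto intro!: borel_measurable_unit_interval)

text \<open>The exponents telescope through \<open>J (t - \<sigma>)\<close>. As \<open>J\<close> is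
  defined on the whole line, this holds for all times, including those past which the shift is
  0.\<close>

lemma transport_semigroup:
  assumes "0 \<le> \<sigma>" "0 \<le> \<tau>"
  shows "transport (\<sigma> + \<tau>) f = transport \<sigma> (transport \<tau> f)"
proof -
  have "transport \<sigma> (transport \<tau> f) = ae_class (\<lambda>t. complex_of_real (exp (- (J t - J (t - \<sigma>)))) *
      complex_of_real (exp (- (J (t - \<sigma>) - J (t - \<sigma> - \<tau>))))) * shift (\<sigma> + \<tau>) f"
    unfolding transport_def
    by (subst shift_times, simp, subst times_ae_class_assoc) (simp_all add: shift_shift[OF assms])
  also have "(\<lambda>t. complex_of_real (exp (- (J t - J (t - \<sigma>)))) * complex_of_real (exp (- (J (t - \<sigma>) - J (t - \<sigma> - \<tau>)))))
      = (\<lambda>t. complex_of_real (exp (- (J t - J (t - (\<sigma> + \<tau>))))))"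
    by (auto simp: diff_diff_add simp flip: of_real_mult exp_add of_real_exp)
  finally show ?thesis
    by (simp add: transport_def)
qed

lemma C0_transport: "C0_semigroup p transport"
proof (rule contractive_C0_semigroupI[OF p contractive_transport])
  show "((\<lambda>\<tau>. Lp_norm p (transport \<tau> f - f)) \<longlongrightarrow> 0) (at_right 0)" if "f \<in> Lp p" for f
    by (rule perturb_strongly_continuous[where T = transport, OF p C0_shift[OF p] that mult_op_Lp[OF that] _ transport_perturbation[OF that]])
      (use that transport_Lp in auto)
qed (auto simp: transport_Lp transport_semigroup,
    simp_all add: transport_def shift_add shift_scaleC distrib_left times_scaleC)

lemma generated_transport: "generated_by_minus p (dom_D0 p) (\<lambda>f. D0 f + mult_op q f) transport"
  by (rule generated_by_minus_perturb[OF p generated_shift[OF p] C0_transport mult_op_Lp transport_perturbation])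

lemma damping_Lp: "f \<in> Lp p \<Longrightarrow> 0 \<le> \<tau> \<Longrightarrow> damping \<tau> f \<in> Lp p"
  and contractive_damping: "contractive p damping"
proof -
  have *: "damping \<tau> f \<in> Lp p \<and> Lp_norm p (damping \<tau> f) \<le> Lp_norm p f" if "f \<in> Lp p" "0 \<le> \<tau>" for f \<tau>
  proof -
    have m: "(\<lambda>t. complex_of_real (exp (- (\<tau> * r t)))) \<in> borel_measurable unit_interval"
      by (rule borel_measurable_unit_interval) simp
    have "norm (complex_of_real (exp (- (\<tau> * r t)))) \<le> 1" for t
      using r_nonneg[of t] that(2) by (simp add: norm_of_real del: of_real_exp)
    with Lp_times_bounded[OF p that(1) zero_le_one m] show ?thesis
      by (auto simp: damping_def)
  qed
  show "f \<in> Lp p \<Longrightarrow> 0 \<le> \<tau> \<Longrightarrow> damping \<tau> f \<in> Lp p"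
    using * by blast
  show "contractive p damping"
    using * by (auto simp: contractive_def)
qed

lemma C0_identity: "C0_semigroup p (\<lambda>_ f. f)"
  by (auto simp: C0_semigroup_def bounded_op_def intro!: exI[of _ 1])

text \<open>The trivial semigroup with generator 0 on all of \<open>Lp p\<close>; perturbing it by Q
  gives \<open>damping\<close> by the same lemma that turns the shift into
  \<open>transport\<close>.\<close>

lemma generated_identity: "generated_by_minus p (Lp p) (\<lambda>_. 0) (\<lambda>_ f. f)"
proof -
  have "has_right_deriv0 p (\<lambda>_ f. f) f 0" for f
    by (simp add: has_right_deriv0_def)
  then show ?thesis
    unfolding generated_by_minus_def using C0_identity by (auto intro: bexI[of _ 0])
qed

lemma damping_perturbation:
  assumes f: "f \<in> Lp p"
  shows "((\<lambda>\<tau>. Lp_norm p (complex_of_real (1 / \<tau>) *\<^sub>C (damping \<tau> f - f) + mult_op q f)) \<longlongrightarrow> 0) (at_right 0)"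
  unfolding damping_def mult_op_def
proof (rule weighted_perturbation[OF p C0_identity _ f _ q_measurable R_nonneg q_bound])
  fix e :: real assume "e > 0"
  have "((\<lambda>\<tau>. R\<^sup>2 * \<tau>) \<longlongrightarrow> R\<^sup>2 * 0) (at_right 0)"
    by (intro tendsto_intros)
  then have "\<forall>\<^sub>F \<tau> in at_right 0. R\<^sup>2 * \<tau> < e"
    using \<open>e > 0\<close> by (intro order_tendstoD(2)) auto
  then show "\<forall>\<^sub>F \<tau> in at_right 0. \<forall>t\<in>{0..1}. norm (complex_of_real (1 / \<tau>) *
      (complex_of_real (exp (- (\<tau> * r t))) - 1) + q t) \<le> e"
    using eventually_at_right_0_less[OF zero_less_one]
  proof eventually_elim
    case (elim \<tau>)
    show ?case
    proof
      fix t :: real assume t: "t \<in> {0..1}"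
      have "norm (complex_of_real (1 / \<tau>) * (complex_of_real (exp (- (\<tau> * r t))) - 1) + complex_of_real (r t))
          \<le> R\<^sup>2 * \<tau> + 0"
        using elim r_nonneg[of t] r_le_R[of t] t
        by (intro exp_weight_difference_quotient) (auto simp: mult.commute)
      then show "norm (complex_of_real (1 / \<tau>) * (complex_of_real (exp (- (\<tau> * r t))) - 1) + q t) \<le> e"
        using elim(1) q_r[OF t] by simp
    qed
  qed
qed (auto simp: contractive_def intro!: borel_measurable_unit_interval)

lemma damping_semigroup: "damping (\<sigma> + \<tau>) f = damping \<sigma> (damping \<tau> f)"
  unfolding damping_def
  by (subst times_ae_class_assoc) (simp_all add: distrib_right exp_add exp_diff exp_minus field_simps)

lemma C0_damping: "C0_semigroup p damping"
proof (rule contractive_C0_semigroupI[OF p contractive_damping])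
  show "((\<lambda>\<tau>. Lp_norm p (damping \<tau> f - f)) \<longlongrightarrow> 0) (at_right 0)" if "f \<in> Lp p" for f
    by (rule perturb_strongly_continuous[where T = damping, OF p C0_identity that mult_op_Lp[OF that] _ damping_perturbation[OF that]])
      (use that damping_Lp in auto)
qed (auto simp: damping_Lp damping_semigroup, simp_all add: damping_def distrib_left times_scaleC)

lemma generated_damping: "generated_by_minus p (Lp p) (mult_op q) damping"
  using generated_by_minus_perturb[OF p generated_identity C0_damping mult_op_Lp damping_perturbation]
  by simp

lemma exp_minus_D0: "f \<in> Lp p \<Longrightarrow> 0 \<le> \<tau> \<Longrightarrow> exp_minus p (dom_D0 p) D0 \<tau> f = shift \<tau> f"
  by (rule exp_minus_eq[OF p generated_shift[OF p] contractive_shift[OF p] dom_D0_dense[OF p]])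

lemma exp_minus_D0_plus_Q:
  "f \<in> Lp p \<Longrightarrow> 0 \<le> \<tau> \<Longrightarrow> exp_minus p (dom_D0 p) (\<lambda>f. D0 f + mult_op q f) \<tau> f = transport \<tau> f"
  by (rule exp_minus_eq[OF p generated_transport contractive_transport dom_D0_dense[OF p]])

text \<open>The domain is all of \<open>Lp p\<close>, so \<open>f\<close> approximates
  itself.\<close>

lemma exp_minus_Q: "f \<in> Lp p \<Longrightarrow> 0 \<le> \<tau> \<Longrightarrow> exp_minus p (Lp p) (mult_op q) \<tau> f = damping \<tau> f"
  by (rule exp_minus_eq[OF p generated_damping contractive_damping]) (metis Lp_norm_zero diff_self)

section \<open>The product formula as a Riemann sum\<close>

text \<open>In each factor the damping acts before the shift and is therefore carried along by
  \<open>h\<close>. Hence the nodes \<open>t - (j + 1) * h\<close>, the left endpoints of the cells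
  going back from \<open>t\<close>.\<close>

lemma Trotter_product:
  assumes f: "f \<in> Lp p" and h: "0 \<le> h"
  shows "((exp_minus p (dom_D0 p) D0 h \<circ> exp_minus p (Lp p) (mult_op q) h) ^^ k) f
    = ae_class (\<lambda>t. complex_of_real (exp (- (\<Sum>j<k. h * r (t - real (Suc j) * h))))) * shift (real k * h) f"
proof -
  let ?P = "exp_minus p (dom_D0 p) D0 h \<circ> exp_minus p (Lp p) (mult_op q) h"
  let ?w = "\<lambda>k t. complex_of_real (exp (- (\<Sum>j<k. h * r (t - real (Suc j) * h))))"
  have P: "?P g = ae_class (\<lambda>t. complex_of_real (exp (- (h * r (t - h))))) * shift h g" if "g \<in> Lp p" for g
  proof -
    have "?P g = shift h (damping h g)"
      using that h by (simp add: exp_minus_Q exp_minus_D0 damping_Lp)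
    then show ?thesis
      unfolding damping_def by (simp add: shift_times)
  qed
  have "(?P ^^ k) f \<in> Lp p \<and> (?P ^^ k) f = ae_class (?w k) * shift (real k * h) f"
  proof (induction k)
    case 0
    then show ?case
      using f by simp
  next
    case (Suc k)
    have step: "(?P ^^ Suc k) f = ?P ((?P ^^ k) f)"
      by (simp only: funpow.simps o_apply)
    have "?P g \<in> Lp p" if "g \<in> Lp p" for g
      using that h by (simp add: exp_minus_Q exp_minus_D0 damping_Lp Lp_shift[OF p])
    then have "(?P ^^ Suc k) f \<in> Lp p"
      unfolding step using Suc by blast
    moreover have "(?P ^^ Suc k) f = ae_class (?w (Suc k)) * shift (real (Suc k) * h) f"
    proof -
      have "(?P ^^ Suc k) f = ae_class (\<lambda>t. complex_of_real (exp (- (h * r (t - h))))) *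
          shift h (ae_class (?w k) * shift (real k * h) f)"
        unfolding step using P[of "(?P ^^ k) f"] Suc by metis
      also have "\<dots> = ae_class (\<lambda>t. complex_of_real (exp (- (h * r (t - h)))) * ?w k (t - h)) * shift (h + real k * h) f"
        using h by (subst shift_times, measurable, subst times_ae_class_assoc) (measurable, simp add: shift_shift)
      \<comment> \<open>The new outermost factor is the summand \<open>j = 0\<close>; the old
        summands move up by one index.\<close>
      also have "(\<lambda>t. complex_of_real (exp (- (h * r (t - h)))) * ?w k (t - h)) = ?w (Suc k)"
        unfolding sum.lessThan_Suc_shift
        by (auto simp: algebra_simps simp flip: of_real_mult exp_add of_real_exp)
      also have "h + real k * h = real (Suc k) * h"
        by (simp add: distrib_right)
      finally show ?thesis .
    qed
    ultimately show ?case ..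
  qed
  then show ?thesis
    by blast
qed

text \<open>On each cell the mean value theorem samples \<open>r\<close> within \<open>h\<close> of
  the node, an error of at most \<open>h * K * h powr \<beta>\<close>; the \<open>n\<close> cells
  add up to \<open>\<tau> * K * h powr \<beta>\<close>.\<close>

lemma riemann_sum_error:
  assumes t: "t \<in> {0..1}" and \<tau>: "0 \<le> \<tau>" "\<tau> \<le> 1" and n: "0 < n"
  shows "\<bar>(J t - J (t - \<tau>)) - (\<Sum>j<n. \<tau> / real n * r (t - real (Suc j) * (\<tau> / real n)))\<bar> \<le> K * (1 / real n powr \<beta>)"
proof (cases "\<tau> = 0")
  case True
  then show ?thesis
    using K by simp
next
  case False
  define h where "h = \<tau> / real n"
  have h: "0 < h" "real n * h = \<tau>"
    using False \<tau> n by (auto simp: h_def)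
  have summand: "\<bar>(J (t - real j * h) - J (t - real (Suc j) * h)) - h * r (t - real (Suc j) * h)\<bar> \<le> h * (K * h powr \<beta>)"
    if "j < n" for j
  proof -
    \<comment> \<open>This keeps all nodes in [-1,1], where the mean value property of
      \<open>J\<close> is available.\<close>
    have "real (Suc j) * h \<le> \<tau>"
      using that h by (metis Suc_leI less_imp_le mult_right_mono of_nat_mono)
    then have "-1 \<le> t - real (Suc j) * h"
      using t \<tau> by auto
    moreover have "0 \<le> real j * h"
      using h by simp
    then have "t - real j * h \<le> 1"
      using t by auto
    moreover have width: "(t - real j * h) - (t - real (Suc j) * h) = h"
      by (simp add: distrib_right)
    then have "t - real (Suc j) * h < t - real j * h"
      using h by linarith
    ultimately obtain \<xi> where \<xi>: "\<xi> \<in> {t - real (Suc j) * h..t - real j * h}"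
      "J (t - real j * h) - J (t - real (Suc j) * h) = h * r \<xi>"
      using J_mvt[of "t - real (Suc j) * h" "t - real j * h"] unfolding width by blast
    have "\<bar>\<xi> - (t - real (Suc j) * h)\<bar> powr \<beta> \<le> h powr \<beta>"
      using \<xi>(1) \<beta> by (intro powr_mono2) (auto simp: algebra_simps)
    then have "\<bar>r \<xi> - r (t - real (Suc j) * h)\<bar> \<le> K * h powr \<beta>"
      using r_holder[of \<xi> "t - real (Suc j) * h"] K mult_left_mono by (meson order_trans)
    then show ?thesis
      unfolding \<xi>(2) using h by (simp add: abs_mult flip: right_diff_distrib)
  qed
  have "J t - J (t - \<tau>) = (\<Sum>j<n. J (t - real j * h) - J (t - real (Suc j) * h))"
    using sum_lessThan_telescope'[of "\<lambda>j. J (t - real j * h)" n] h by simp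
  then have "\<bar>(J t - J (t - \<tau>)) - (\<Sum>j<n. h * r (t - real (Suc j) * h))\<bar>
      = \<bar>\<Sum>j<n. (J (t - real j * h) - J (t - real (Suc j) * h)) - h * r (t - real (Suc j) * h)\<bar>"
    by (simp only: sum_subtractf)
  also have "\<dots> \<le> (\<Sum>j<n. h * (K * h powr \<beta>))"
    by (intro order_trans[OF sum_abs] sum_mono summand) auto
  also have "\<dots> = \<tau> * (K * h powr \<beta>)"
    using h(2) by simp
  \<comment> \<open>\<open>\<tau> \<le> 1\<close> serves twice: for the length factor and for
    \<open>h \<le> 1 / n\<close>. This makes the bound uniform in \<tau>.\<close>
  also have "\<dots> \<le> 1 * (K * (1 / real n) powr \<beta>)"
    using \<tau> K \<beta> n by (intro mult_mono mult_left_mono powr_mono2) (auto simp: h_def divide_right_mono)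
  finally show ?thesis
    using n by (simp add: h_def powr_divide)
qed

lemma Trotter_error:
  assumes f: "f \<in> Lp p" and \<tau>: "0 \<le> \<tau>" and n: "0 < n"
  shows "Lp_norm p (exp_minus p (dom_D0 p) (\<lambda>g. D0 g + mult_op q g) \<tau> f
      - ((exp_minus p (dom_D0 p) D0 (\<tau> / real n) \<circ> exp_minus p (Lp p) (mult_op q) (\<tau> / real n)) ^^ n) f)
    \<le> K * (1 / real n powr \<beta>) * Lp_norm p f"
proof -
  let ?m = "\<lambda>t. complex_of_real (exp (- (J t - J (t - \<tau>))))"
  let ?w = "\<lambda>t. complex_of_real (exp (- (\<Sum>j<n. \<tau> / real n * r (t - real (Suc j) * (\<tau> / real n)))))"
  have m [measurable]: "?m \<in> borel_measurable borel" "?w \<in> borel_measurable borel"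
    by measurable
  have eq: "exp_minus p (dom_D0 p) (\<lambda>g. D0 g + mult_op q g) \<tau> f
      - ((exp_minus p (dom_D0 p) D0 (\<tau> / real n) \<circ> exp_minus p (Lp p) (mult_op q) (\<tau> / real n)) ^^ n) f
      = ae_class (\<lambda>t. ?m t - ?w t) * shift \<tau> f"
  proof -
    have "exp_minus p (dom_D0 p) (\<lambda>g. D0 g + mult_op q g) \<tau> f
      - ((exp_minus p (dom_D0 p) D0 (\<tau> / real n) \<circ> exp_minus p (Lp p) (mult_op q) (\<tau> / real n)) ^^ n) f
      = ae_class ?m * shift \<tau> f - ae_class ?w * shift \<tau> f"
      using n \<tau> Trotter_product[OF f, of "\<tau> / real n" n] by (simp add: exp_minus_D0_plus_Q[OF f \<tau>] transport_def)
    also have "\<dots> = (ae_class ?m - ae_class ?w) * shift \<tau> f"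
      by (simp add: left_diff_distrib)
    also have "ae_class ?m - ae_class ?w = ae_class (\<lambda>t. ?m t - ?w t)"
      by (intro ae_class_minus borel_measurable_unit_interval m)
    finally show ?thesis .
  qed
  have C: "0 \<le> K * (1 / real n powr \<beta>)"
    using K by simp
  show ?thesis
  proof (cases "\<tau> \<le> 1")
    case False
    then show ?thesis
      unfolding eq using mult_nonneg_nonneg[OF C Lp_norm_nonneg[of p f]] by (simp add: shift_eq_0)
  next
    case True
    have "norm (?m t - ?w t) \<le> K * (1 / real n powr \<beta>)" if t: "t \<in> {0..1}" for t
    proof -
      have "norm (?m t - ?w t) = \<bar>exp (- (J t - J (t - \<tau>)))
          - exp (- (\<Sum>j<n. \<tau> / real n * r (t - real (Suc j) * (\<tau> / real n))))\<bar>"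
        by (simp only: norm_of_real flip: of_real_diff)
      also have "\<dots> \<le> \<bar>(J t - J (t - \<tau>)) - (\<Sum>j<n. \<tau> / real n * r (t - real (Suc j) * (\<tau> / real n)))\<bar>"
        using J_increment_nonneg[OF \<tau>] \<tau> r_nonneg
        by (intro exp_minus_lipschitz sum_nonneg mult_nonneg_nonneg) auto
      also have "\<dots> \<le> K * (1 / real n powr \<beta>)"
        by (rule riemann_sum_error[OF t \<tau> True n])
      finally show ?thesis .
    qed
    then have "Lp_norm p (ae_class (\<lambda>t. ?m t - ?w t) * shift \<tau> f) \<le> K * (1 / real n powr \<beta>) * Lp_norm p (shift \<tau> f)"
      by (intro Lp_times_bounded(2)[OF p Lp_shift[OF p f] C] borel_measurable_unit_interval) auto
    also have "\<dots> \<le> K * (1 / real n powr \<beta>) * Lp_norm p f"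
      by (intro mult_left_mono Lp_norm_shift_le p f C)
    finally show ?thesis
      unfolding eq .
  qed
qed

lemma Trotter_op_norm_le:
  assumes n: "0 < n"
  shows "(SUP \<tau>\<in>{0..}. op_norm p (\<lambda>f. exp_minus p (dom_D0 p) (\<lambda>g. D0 g + mult_op q g) \<tau> f
      - ((exp_minus p (dom_D0 p) D0 (\<tau> / real n) \<circ> exp_minus p (Lp p) (mult_op q) (\<tau> / real n)) ^^ n) f))
    \<le> ennreal (K * (1 / real n powr \<beta>))"
  unfolding op_norm_def
proof (intro SUP_least ennreal_leI)
  fix \<tau> :: real and f assume "\<tau> \<in> {0..}" "f \<in> {f \<in> Lp p. Lp_norm p f \<le> 1}"
  then show "Lp_norm p (exp_minus p (dom_D0 p) (\<lambda>g. D0 g + mult_op q g) \<tau> f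
      - ((exp_minus p (dom_D0 p) D0 (\<tau> / real n) \<circ> exp_minus p (Lp p) (mult_op q) (\<tau> / real n)) ^^ n) f)
    \<le> K * (1 / real n powr \<beta>)"
    using Trotter_error[of f \<tau> n] n K mult_left_mono[of "Lp_norm p f" 1 "K * (1 / real n powr \<beta>)"] by simp
qed

end

text \<open>Composition with the nearest-point map onto [0,1], which is 1-Lipschitz, keeps the
  constant \<open>K\<close> and the sign. The extension is wanted because the nodes
  \<open>t - (j + 1) * h\<close> may be negative.\<close>

lemma holder_space_extension:
  assumes "q \<in> holder_space \<beta>" "0 < \<beta>" "\<forall>t\<in>{0..1}. q t \<in> \<real>\<^sub>\<ge>\<^sub>0"
  obtains K and r :: "real \<Rightarrow> real" where "0 \<le> K" "continuous_on UNIV r" "\<And>t. 0 \<le> r t"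
    "\<And>x y. \<bar>r x - r y\<bar> \<le> K * \<bar>x - y\<bar> powr \<beta>" "\<And>t. t \<in> {0..1} \<Longrightarrow> q t = complex_of_real (r t)"
proof -
  from assms(1) obtain K where K: "K > 0"
    "\<And>x y. x \<in> {0..1} \<Longrightarrow> y \<in> {0..1} \<Longrightarrow> norm (q x - q y) \<le> K * \<bar>x - y\<bar> powr \<beta>"
    by (auto simp: holder_space_def)
  define c :: "real \<Rightarrow> real" where "c x = max 0 (min 1 x)" for x
  have c: "c x \<in> {0..1}" "\<bar>c x - c y\<bar> \<le> \<bar>x - y\<bar>" for x y
    by (auto simp: c_def)
  define r where "r x = Re (q (c x))" for x
  have holder: "\<bar>r x - r y\<bar> \<le> K * \<bar>x - y\<bar> powr \<beta>" for x y
  proof -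
    have "\<bar>r x - r y\<bar> \<le> norm (q (c x) - q (c y))"
      using abs_Re_le_cmod[of "q (c x) - q (c y)"] by (simp add: r_def)
    also have "\<dots> \<le> K * \<bar>c x - c y\<bar> powr \<beta>"
      by (intro K c)
    also have "\<dots> \<le> K * \<bar>x - y\<bar> powr \<beta>"
      using K(1) c(2) assms(2) by (intro mult_left_mono powr_mono2) auto
    finally show ?thesis .
  qed
  show thesis
  proof (rule that[of K r])
    have "(r \<longlongrightarrow> r x) (at x)" for x
    proof (rule LIM_zero_cancel, rule Lim_null_comparison[OF always_eventually])
      show "\<forall>y. norm (r y - r x) \<le> K * \<bar>y - x\<bar> powr \<beta>"
        using holder by simp
      have "((\<lambda>y. \<bar>y - x\<bar>) \<longlongrightarrow> 0) (at x)"
        by (intro tendsto_eq_intros) auto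
      then show "((\<lambda>y. K * \<bar>y - x\<bar> powr \<beta>) \<longlongrightarrow> 0) (at x)"
        using assms(2) by (intro tendsto_mult_right_zero tendsto_zero_powrI[OF _ tendsto_const]) auto
    qed
    then show "continuous_on UNIV r"
      by (simp add: continuous_on_def)
    show "0 \<le> r t" for t
      using assms(3) c(1)[of t] by (auto simp: r_def complex_nonneg_Reals_iff)
    show "q t = complex_of_real (r t)" if "t \<in> {0..1}" for t
    proof -
      have "c t = t"
        using that by (auto simp: c_def)
      then show ?thesis
        using assms(3) that by (auto simp: r_def complex_nonneg_Reals_iff complex_eq_iff)
    qed
  qed (use K holder in auto)
qed

theorem theorem3p4:
  fixes p \<beta> :: real and q :: "real \<Rightarrow> complex"
  assumes "1 \<le> p" and "0 < \<beta>" and "\<beta> \<le> 1"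
    and "q \<in> holder_space \<beta>"
    and "\<forall>t\<in>{0..1}. q t \<in> \<real>\<^sub>\<ge>\<^sub>0"
  shows "limsup (\<lambda>n::nat.
           (SUP \<tau>\<in>{0..}. op_norm p (\<lambda>f.
              exp_minus p (dom_D0 p) (\<lambda>g. D0 g + mult_op q g) \<tau> f
              - ((exp_minus p (dom_D0 p) D0 (\<tau> / real n)
                  \<circ> exp_minus p (Lp p) (mult_op q) (\<tau> / real n)) ^^ n) f))
           / ennreal (1 / real n powr \<beta>)) < \<infinity>"
proof -
  obtain K r where r: "0 \<le> K" "continuous_on UNIV r" "\<And>t. 0 \<le> r t"
    "\<And>x y. \<bar>r x - r y\<bar> \<le> K * \<bar>x - y\<bar> powr \<beta>" "\<And>t. t \<in> {0..1} \<Longrightarrow> q t = complex_of_real (r t)"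
    by (rule holder_space_extension[OF assms(4,2,5)]) blast
  obtain J where J: "continuous_on UNIV J" "mono J"
    "\<And>s t. -1 \<le> s \<Longrightarrow> s < t \<Longrightarrow> t \<le> 1 \<Longrightarrow> \<exists>\<xi>\<in>{s..t}. J t - J s = (t - s) * r \<xi>"
    by (rule bounded_antiderivative[OF r(2,3)]) blast
  interpret holder_potential p \<beta> K q r J
    by unfold_locales (use assms r J in auto)
  let ?E = "\<lambda>n::nat. SUP \<tau>\<in>{0..}. op_norm p (\<lambda>f.
              exp_minus p (dom_D0 p) (\<lambda>g. D0 g + mult_op q g) \<tau> f
              - ((exp_minus p (dom_D0 p) D0 (\<tau> / real n)
                  \<circ> exp_minus p (Lp p) (mult_op q) (\<tau> / real n)) ^^ n) f)"
  \<comment> \<open>At \<open>n = 0\<close> the denominator would be 0 by the convention for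
    division by 0; the limit superior ignores that term.\<close>
  have "?E n / ennreal (1 / real n powr \<beta>) \<le> ennreal K" if "0 < n" for n
  proof -
    have "?E n / ennreal (1 / real n powr \<beta>) \<le> ennreal (K * (1 / real n powr \<beta>)) / ennreal (1 / real n powr \<beta>)"
      by (intro divide_right_mono_ennreal Trotter_op_norm_le that)
    also have "\<dots> = ennreal K"
      using that r(1) by (subst divide_ennreal) auto
    finally show ?thesis .
  qed
  then have "limsup (\<lambda>n. ?E n / ennreal (1 / real n powr \<beta>)) \<le> ennreal K"
    by (intro Limsup_bounded) (auto simp: eventually_sequentially intro: exI[of _ 1])
  also have "\<dots> < \<infinity>"
    by simp
  finally show ?thesis .
qed

end
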